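(* There exist universal constants $c,c'>0$ such that the following holds. Fix any $\gamma\ge 1$ and any input dimension $d_u\in\mathbb N$ with $d_u\ge\sqrt{\log(1+\gamma)}$. Let $d_x=\lfloor\gamma\rfloor$ and $$\mathcal U:=\Big\{(A,B)\in\mathbb R^{d_x\times d_x}\times\mathbb R^{d_x\times d_u}:\ \|A-\tfrac12 I\|_{\mathrm{HS}}\le\tfrac14,\ \|B\|_{\mathrm{HS}}\le\tfrac14\Big\}.$$ Then, for the LQR problem with cost matrices $Q=I_{d_x}$, $R=I_{d_u}$ and a noise covariance $\Sigma_w$ with $\|\Sigma_w\|_{\mathrm{op}}=1$ and $\mathrm{tr}[\Sigma_w]\le\gamma$, $$\min_{\mathsf{alg}}\ \max_{(A,B)\in\mathcal U}\ \mathbb E_{A,B}\big[\mathrm{Regret}_T(\mathsf{alg})\big]\ \ge\ c\cdot\begin{cases}T, & T\in[c'\gamma\log(1+\gamma),\ \gamma d_u^2],\\ \sqrt{\gamma d_u^2\,T}, & T\ge\gamma d_u^2.\end{cases}$$ Here "a noise covariance" means that such a $\Sigma_w$ exists (depending only on $\gamma$), fixed before the minimum and maximum are taken.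
   Context: Online LQR: for system matrices $(A,B)$ unknown to the learner, the state evolves as $x_{t+1}=Ax_t+Bu_t+w_t$, $w_t$ i.i.d. $\mathcal N(0,\Sigma_w)$, $x_1=0$. A (possibly randomized) algorithm $\mathsf{alg}$ chooses $u_t\in\mathbb R^{d_u}$ based on the history of states $x_1,\dots,x_t$ and inputs $u_1,\dots,u_{t-1}$. For a static feedback matrix $K$, $\mathcal J_{A,B}(K)=\lim_{T\to\infty}\frac1T\mathbb E[\sum_{t=1}^T\langle x_t,Qx_t\rangle+\langle u_t,Ru_t\rangle]$ with $u_t=Kx_t$, and $\mathcal J^\star_{A,B}=\inf_K\mathcal J_{A,B}(K)$. The regret on instance $(A,B)$ is $\mathrm{Regret}_T(\mathsf{alg})=\big(\sum_{t=1}^T\langle x_t,Qx_t\rangle+\langle u_t,Ru_t\rangle\big)-T\mathcal J^\star_{A,B}$. $\mathbb E_{A,B}$ is expectation when the true instance is $(A,B)$. $\|\cdot\|_{\mathrm{HS}}$ is the Hilbert–Schmidt (Frobenius) norm.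
   Formalization: The burn-in T ≥ c'γ log(1+γ) is required in the second case too; without it the claim fails at γ = d_u = T = 1, where playing u = 0 from x_1 = 0 has regret at most −1. *)

theory Defs
  imports "HOL-Probability.Probability" "Jordan_Normal_Form.Matrix"
begin

no_notation Finite_Cartesian_Product.vec_nth (infixl \<open>$\<close> 90)
no_notation inner (infix \<open>\<bullet>\<close> 70)

text \<open>
  The dimensions are bound inside the theorem (below the universal constants), so vectors and
  matrices are the dimension-carrying ones of Jordan Normal Form.
\<close>

type_synonym rvec = "real Matrix.vec"
type_synonym rmat = "real Matrix.mat"

definition vec_norm :: "rvec \<Rightarrow> real" where
  "vec_norm v = sqrt (v \<bullet> v)"

definition op_norm :: "rmat \<Rightarrow> real" where
  "op_norm M = Sup {vec_norm (M *\<^sub>v v) | v. v \<in> carrier_vec (dim_col M) \<and> vec_norm v \<le> 1}"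

definition hs_norm :: "rmat \<Rightarrow> real" where
  "hs_norm M = sqrt (\<Sum>i<dim_row M. \<Sum>j<dim_col M. (M $$ (i, j))\<^sup>2)"

definition trace_mat :: "rmat \<Rightarrow> real" where
  "trace_mat M = (\<Sum>i<dim_row M. M $$ (i, i))"

definition psd_mat :: "nat \<Rightarrow> rmat \<Rightarrow> bool" where
  "psd_mat n M \<longleftrightarrow> M \<in> carrier_mat n n \<and> transpose_mat M = M \<and>
     (\<forall>v\<in>carrier_vec n. 0 \<le> v \<bullet> (M *\<^sub>v v))"

definition psd_sqrt :: "nat \<Rightarrow> rmat \<Rightarrow> rmat" where
  "psd_sqrt n M = (THE S. psd_mat n S \<and> S * S = M)"

text \<open>
  \<open>vec_borel n\<close> is \<open>\<real>\<^sup>n\<close> with its Borel sigma-algebra, the one generated by the coordinates;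
  only its space and measurable sets matter.
\<close>

definition vec_borel :: "nat \<Rightarrow> rvec measure" where
  "vec_borel n = vimage_algebra (carrier_vec n) (\<lambda>v. \<lambda>i\<in>{..<n}. v $ i)
     (PiM {..<n} (\<lambda>_. borel))"

text \<open>
  The centred Gaussian with covariance matrix \<open>S\<close>, as the law of \<open>S\<^sup>1\<^sup>/\<^sup>2 z\<close> with i.i.d. standard
  normal coordinates \<open>z\<^sub>i\<close>; this covers singular covariance matrices, which have no density.
\<close>

definition gaussian :: "nat \<Rightarrow> rmat \<Rightarrow> rvec measure" where
  "gaussian n S = distr (PiM {..<n} (\<lambda>_. density lborel std_normal_density)) (vec_borel n)
     (\<lambda>z. psd_sqrt n S *\<^sub>v Matrix.vec n z)"

text \<open>
  A history is a pair \<open>(x, u)\<close> of families of states and inputs indexed by time;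
  \<open>history_space dx du n m\<close> consists of \<open>x\<^sub>1, \<dots>, x\<^sub>n\<close> and \<open>u\<^sub>1, \<dots>, u\<^sub>m\<close>.
\<close>

type_synonym history = "(nat \<Rightarrow> rvec) \<times> (nat \<Rightarrow> rvec)"

definition history_space :: "nat \<Rightarrow> nat \<Rightarrow> nat \<Rightarrow> nat \<Rightarrow> history measure" where
  "history_space dx du n m =
     PiM {1..n} (\<lambda>_. vec_borel dx) \<Otimes>\<^sub>M PiM {1..m} (\<lambda>_. vec_borel du)"

text \<open>
  A randomized algorithm is a sequence of Markov kernels: \<open>alg t\<close> maps \<open>x\<^sub>1, \<dots>, x\<^sub>t\<close> and
  \<open>u\<^sub>1, \<dots>, u\<^sub>t\<^sub>-\<^sub>1\<close> to the conditional law of \<open>u\<^sub>t\<close>. It has no access to \<open>A\<close> and \<open>B\<close>.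
\<close>

type_synonym algorithm = "nat \<Rightarrow> history \<Rightarrow> rvec measure"

definition algorithms :: "nat \<Rightarrow> nat \<Rightarrow> algorithm set" where
  "algorithms dx du = {alg. \<forall>t\<ge>1.
     alg t \<in> history_space dx du t (t - 1) \<rightarrow>\<^sub>M prob_algebra (vec_borel du)}"

text \<open>
  The law of \<open>x\<^sub>t\<^sub>+\<^sub>1\<close> given \<open>x\<^sub>1, \<dots>, x\<^sub>t, u\<^sub>1, \<dots>, u\<^sub>t\<close>. The first state is \<open>x\<^sub>1 = 0\<close>; otherwise
  \<open>x\<^sub>t\<^sub>+\<^sub>1 = A x\<^sub>t + B u\<^sub>t + w\<^sub>t\<close> with a fresh \<open>w\<^sub>t \<sim> N(0, S)\<close>.
\<close>

definition next_state :: "rmat \<Rightarrow> rmat \<Rightarrow> rmat \<Rightarrow> nat \<Rightarrow> history \<Rightarrow> rvec measure" where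
  "next_state A B S t = (\<lambda>(x, u).
     if t = 0 then return (vec_borel (dim_row A)) (0\<^sub>v (dim_row A))
     else distr (gaussian (dim_row A) S) (vec_borel (dim_row A))
            (\<lambda>w. A *\<^sub>v x t + B *\<^sub>v u t + w))"

text \<open>The joint law of \<open>x\<^sub>1, \<dots>, x\<^sub>t, u\<^sub>1, \<dots>, u\<^sub>t\<close> when \<open>alg\<close> runs on the instance \<open>(A, B)\<close>.\<close>

primrec trajectory_law ::
    "rmat \<Rightarrow> rmat \<Rightarrow> rmat \<Rightarrow> algorithm \<Rightarrow> nat \<Rightarrow> history measure" where
  "trajectory_law A B S alg 0 =
     return (history_space (dim_row A) (dim_col B) 0 0) (\<lambda>_. undefined, \<lambda>_. undefined)"
| "trajectory_law A B S alg (Suc t) =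
     trajectory_law A B S alg t \<bind> (\<lambda>(x, u).
       next_state A B S t (x, u) \<bind> (\<lambda>x'.
         alg (Suc t) (x(Suc t := x'), u) \<bind> (\<lambda>u'.
           return (history_space (dim_row A) (dim_col B) (Suc t) (Suc t))
             (x(Suc t := x'), u(Suc t := u')))))"

text \<open>
  Expectation of an extended real random variable. The Bochner integral would assign 0 to the
  regret of an algorithm with infinite expected cost; here that regret is \<open>\<infinity>\<close>.
\<close>

definition expect :: "'a measure \<Rightarrow> ('a \<Rightarrow> ereal) \<Rightarrow> ereal" where
  "expect M f = enn2ereal (\<integral>\<^sup>+ \<omega>. e2ennreal (f \<omega>) \<partial>M) - enn2ereal (\<integral>\<^sup>+ \<omega>. e2ennreal (- f \<omega>) \<partial>M)"

definition total_cost :: "rmat \<Rightarrow> rmat \<Rightarrow> nat \<Rightarrow> history \<Rightarrow> real" where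
  "total_cost Q R T = (\<lambda>(x, u). \<Sum>t=1..T. x t \<bullet> (Q *\<^sub>v x t) + u t \<bullet> (R *\<^sub>v u t))"

definition static_feedback :: "rmat \<Rightarrow> algorithm" where
  "static_feedback K t = (\<lambda>(x, u). return (vec_borel (dim_row K)) (K *\<^sub>v x t))"

text \<open>
  The infinite-horizon cost is extended-real valued: it is \<open>\<infinity>\<close> for destabilizing \<open>K\<close>.
\<close>

definition lqr_cost :: "rmat \<Rightarrow> rmat \<Rightarrow> rmat \<Rightarrow> rmat \<Rightarrow> rmat \<Rightarrow> rmat \<Rightarrow> ereal" where
  "lqr_cost Q R S A B K = lim (\<lambda>T.
     expect (trajectory_law A B S (static_feedback K) T) (\<lambda>h. ereal (total_cost Q R T h))
       / ereal (real T))"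

definition opt_cost :: "rmat \<Rightarrow> rmat \<Rightarrow> rmat \<Rightarrow> rmat \<Rightarrow> rmat \<Rightarrow> ereal" where
  "opt_cost Q R S A B = (INF K\<in>carrier_mat (dim_col B) (dim_row A). lqr_cost Q R S A B K)"

definition regret ::
    "rmat \<Rightarrow> rmat \<Rightarrow> rmat \<Rightarrow> rmat \<Rightarrow> rmat \<Rightarrow> nat \<Rightarrow> history \<Rightarrow> ereal" where
  "regret Q R S A B T h = ereal (total_cost Q R T h) - ereal (real T) * opt_cost Q R S A B"

definition expected_regret ::
    "rmat \<Rightarrow> rmat \<Rightarrow> rmat \<Rightarrow> algorithm \<Rightarrow> nat \<Rightarrow> rmat \<Rightarrow> rmat \<Rightarrow> ereal" where
  "expected_regret Q R S alg T A B = expect (trajectory_law A B S alg T) (regret Q R S A B T)"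

definition instance_class :: "nat \<Rightarrow> nat \<Rightarrow> (rmat \<times> rmat) set" where
  "instance_class dx du = {(A, B). A \<in> carrier_mat dx dx \<and> B \<in> carrier_mat dx du \<and>
     hs_norm (A - (1/2) \<cdot>\<^sub>m 1\<^sub>m dx) \<le> 1/4 \<and> hs_norm B \<le> 1/4}"

definition minimax_regret :: "rmat \<Rightarrow> rmat \<Rightarrow> rmat \<Rightarrow> nat \<Rightarrow> nat \<Rightarrow> nat \<Rightarrow> ereal" where
  "minimax_regret Q R S dx du T =
     (INF alg\<in>algorithms dx du. SUP (A, B)\<in>instance_class dx du.
        expected_regret Q R S alg T A B)"

end

theory Submission
  imports Defs
begin

text \<open>
  Take \<open>\<Sigma>\<^sub>w = 1\<close>, \<open>A = 1/2\<close> and the entries of \<open>B\<close> independent and uniform on \<open>[-e, e]\<close>, where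
  \<open>e\<^sup>2 = min (1 / (4 sqrt (d\<^sub>x T))) (1 / (64 d\<^sub>x d\<^sub>u))\<close>. A controller that knows \<open>B\<close> saves at least
  \<open>|B|\<^sup>2 / 3\<close> per step in Frobenius norm, by the feedback \<open>u = -2/3 B\<^sup>T x\<close>. A learner can only save
  through the correlations \<open>E \<langle>n\<^sub>t, B u\<^sub>t\<rangle>\<close>, where \<open>n\<^sub>t\<close> is the part of the state caused by the noise.
  Integration by parts in each entry of \<open>B\<close> against the uniform prior (a Stein identity) turns these
  correlations into \<open>E \<langle>u\<^sub>t, Z\<^sub>t\<rangle>\<close>, where \<open>Z\<^sub>t\<close> contracts by \<open>1/2\<close> up to increments of energy
  \<open>O(e\<^sup>4 (d\<^sub>x \<Sum>|u|\<^sup>2 + d\<^sub>x\<^sup>2 |u\<^sub>t|\<^sup>2))\<close>. By the choice of \<open>e\<close> the savings are at most the control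
  cost \<open>\<Sum>|u|\<^sup>2\<close> itself, so the average regret is at least a multiple of
  \<open>T d\<^sub>x d\<^sub>u e\<^sup>2 - O(d\<^sub>x)\<close>. The noise must be truncated smoothly (\<open>v\<close> becomes \<open>2 sin (v/2)\<close>), because
  the inputs are merely square integrable and may depend on past noise.
\<close>

section \<open>Coordinates and Gaussian noise\<close>

text \<open>The inputs depend on \<open>B\<close> only through the law of the history. Passing to
  the law for \<open>B = 0\<close> by the Gaussian likelihood ratio freezes the history, inputs
  included, and leaves an integrand that is smooth in the entries of \<open>B\<close>; only then can
  one integrate by parts. The algorithm's kernels cancel in the ratio, so arbitrary randomized
  algorithms are covered. Square integrability of states and inputs comes from an argument by
  contradiction: if the bound fails, the regret is finite on every instance of the box, and so is
  the expected cost. Per step, the truncation of the noise costs |B|^2 / 18 against the saving |B|^2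
  / 3, which leaves 5/18. Of the two bounds on e^2, the first controls the energy of Z over T steps,
  the second keeps B in the class; they produce the two regimes of the theorem. The loss O(d_x) is
  due to the start at 0, where the state is cheaper than in the stationary regime; the lower bounds
  on T and d_u make it negligible. The uniform prior fits because its Stein kernel vanishes at the
  ends of the interval, so that no boundary terms appear.\<close>

lemma space_vec_borel [simp]: "space (vec_borel n) = carrier_vec n"
  by (simp add: vec_borel_def)

lemma measurable_vec_component:
  assumes "i < n"
  shows "(\<lambda>v. v $ i) \<in> borel_measurable (vec_borel n)"
proof -
  have "(\<lambda>v::rvec. \<lambda>i\<in>{..<n}. v $ i) \<in> vec_borel n \<rightarrow>\<^sub>M PiM {..<n} (\<lambda>_. borel)"
    unfolding vec_borel_def by (rule measurable_vimage_algebra1) (auto simp: space_PiM)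
  from measurable_component_singleton'[OF this measurable_ident_sets[OF refl], of i] assms
  show ?thesis by simp
qed

lemma measurable_vec_borelI:
  assumes "\<And>w. w \<in> space M \<Longrightarrow> f w \<in> carrier_vec n"
    and "\<And>i. i < n \<Longrightarrow> (\<lambda>w. f w $ i) \<in> borel_measurable M"
  shows "f \<in> M \<rightarrow>\<^sub>M vec_borel n"
  unfolding vec_borel_def
proof (rule measurable_vimage_algebra2)
  show "(\<lambda>x. \<lambda>i\<in>{..<n}. f x $ i) \<in> M \<rightarrow>\<^sub>M PiM {..<n} (\<lambda>_. borel)"
    using assms by (intro measurable_restrict) auto
qed (use assms in auto)

lemma measurable_vec_component':
  assumes "f \<in> M \<rightarrow>\<^sub>M vec_borel n" "i < n"
  shows "(\<lambda>w. f w $ i) \<in> borel_measurable M"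
  using measurable_compose[OF assms(1) measurable_vec_component[OF assms(2)]] .

lemma measurable_mult_mat_vec:
  assumes f: "f \<in> M \<rightarrow>\<^sub>M vec_borel n" and A: "A \<in> carrier_mat m n"
  shows "(\<lambda>w. A *\<^sub>v f w) \<in> M \<rightarrow>\<^sub>M vec_borel m"
proof (rule measurable_vec_borelI)
  fix i assume i: "i < m"
  have "f w \<in> carrier_vec n" if "w \<in> space M" for w
    using measurable_space[OF f that] by simp
  then have "(A *\<^sub>v f w) $ i = (\<Sum>j<n. A $$ (i, j) * f w $ j)" if "w \<in> space M" for w
    using i A that
    by (subst index_mult_mat_vec) (auto simp: scalar_prod_def row_def atLeast0LessThan intro!: sum.cong)
  then show "(\<lambda>w. (A *\<^sub>v f w) $ i) \<in> borel_measurable M"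
    by (subst measurable_cong[where g="\<lambda>w. \<Sum>j<n. A $$ (i, j) * f w $ j"])
       (auto intro!: borel_measurable_sum borel_measurable_times measurable_vec_component'[OF f])
qed (use measurable_space[OF f] A in auto)

lemma measurable_add_vec:
  assumes f: "f \<in> M \<rightarrow>\<^sub>M vec_borel n" and g: "g \<in> M \<rightarrow>\<^sub>M vec_borel n"
  shows "(\<lambda>w. f w + g w) \<in> M \<rightarrow>\<^sub>M vec_borel n"
proof (rule measurable_vec_borelI)
  fix i assume i: "i < n"
  have "(f w + g w) $ i = f w $ i + g w $ i" if "w \<in> space M" for w
    using i measurable_space[OF f that] measurable_space[OF g that] by auto
  then show "(\<lambda>w. (f w + g w) $ i) \<in> borel_measurable M"
    by (subst measurable_cong[where g="\<lambda>w. f w $ i + g w $ i"])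
       (auto intro!: borel_measurable_add measurable_vec_component'[OF f] measurable_vec_component'[OF g] i)
qed (use measurable_space[OF f] measurable_space[OF g] in auto)

section \<open>Standard Gaussian vectors and their translates\<close>

definition std_gauss :: "nat \<Rightarrow> (nat \<Rightarrow> real) measure" where
  "std_gauss n = PiM {..<n} (\<lambda>_. density lborel std_normal_density)"

lemma prob_space_std_normal: "prob_space (density lborel std_normal_density)"
  by (rule prob_space_normal_density) simp

interpretation std_normal: prob_space "density lborel std_normal_density"
  by (rule prob_space_std_normal)

interpretation std_normal_PiM: product_sigma_finite "\<lambda>_::nat. density lborel std_normal_density"
  by unfold_locales

lemma prob_space_std_gauss: "prob_space (std_gauss n)"
  unfolding std_gauss_def by (rule prob_space_PiM) (rule prob_space_std_normal)

lemma sets_std_gauss [measurable_cong]: "sets (std_gauss n) = sets (PiM {..<n} (\<lambda>_. borel))"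
  unfolding std_gauss_def by (rule sets_PiM_cong) auto

lemma measurable_std_gauss_component: "i < n \<Longrightarrow> (\<lambda>z. z i) \<in> borel_measurable (std_gauss n)"
  using measurable_component_singleton[of i "{..<n}" "\<lambda>_. borel :: real measure"]
  by (simp cong: measurable_cong_sets add: sets_std_gauss)

lemma measurable_vec_std_gauss: "Matrix.vec n \<in> std_gauss n \<rightarrow>\<^sub>M vec_borel n"
proof (rule measurable_vec_borelI)
  fix i assume i: "i < n"
  have "(\<lambda>w. w i) \<in> borel_measurable (std_gauss n)"
    using i by (rule measurable_std_gauss_component)
  then show "(\<lambda>w. Matrix.vec n w $ i) \<in> borel_measurable (std_gauss n)"
    using i by simp
qed auto

lemma psd_mat_one: "psd_mat n (1\<^sub>m n)"
  unfolding psd_mat_def by (auto simp: scalar_prod_def sum_nonneg)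

text \<open>Uniqueness of the positive semidefinite root: with \<open>y = (S - 1) v\<close>, the identity
  \<open>(1 + S) (S - 1) = 0\<close> gives \<open>y \<bullet> y + y \<bullet> S y = 0\<close>.\<close>

lemma psd_sqrt_one: "psd_sqrt n (1\<^sub>m n) = 1\<^sub>m n"
  unfolding psd_sqrt_def
proof (rule the_equality)
  show "psd_mat n (1\<^sub>m n) \<and> 1\<^sub>m n * 1\<^sub>m n = (1\<^sub>m n :: rmat)"
    using psd_mat_one by simp
next
  fix S :: rmat assume S: "psd_mat n S \<and> S * S = 1\<^sub>m n"
  then have Sc: "S \<in> carrier_mat n n" by (simp add: psd_mat_def)
  have "S *\<^sub>v v = v" if v: "v \<in> carrier_vec n" for v
  proof -
    have Sv: "S *\<^sub>v v \<in> carrier_vec n" using Sc v by auto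
    define y where "y = S *\<^sub>v v - v"
    have y: "y \<in> carrier_vec n" unfolding y_def using Sv v by auto
    have SSv: "S *\<^sub>v (S *\<^sub>v v) = v"
      using S Sc v by (metis assoc_mult_mat_vec one_mult_mat_vec)
    have "S *\<^sub>v y = v - S *\<^sub>v v"
      unfolding y_def using Sc Sv v SSv by (simp add: mult_minus_distrib_mat_vec)
    also have "\<dots> = - y" unfolding y_def using Sv v Sc by (intro eq_vecI) auto
    finally have "y \<bullet> (S *\<^sub>v y) = - (y \<bullet> y)" using y by simp
    moreover have "0 \<le> y \<bullet> (S *\<^sub>v y)" using S y by (simp add: psd_mat_def)
    moreover have "0 \<le> y \<bullet> y" by (simp add: scalar_prod_def sum_nonneg)
    ultimately have "y \<bullet> y = 0" by simp
    then have "y = 0\<^sub>v n" using y by (simp add: scalar_prod_def sum_nonneg_eq_0_iff) auto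
    then show ?thesis unfolding y_def using Sv v by (metis (no_types, lifting) carrier_vecD
        index_minus_vec(1) index_zero_vec(1) eq_vecI right_minus_eq)
  qed
  then have "S *\<^sub>v unit_vec n j = unit_vec n j" for j by simp
  moreover have "(S *\<^sub>v unit_vec n j) $ i = S $$ (i, j)" if "i < n" "j < n" for i j
    using Sc that by (simp add: scalar_prod_right_unit)
  ultimately have "S $$ (i, j) = unit_vec n j $ i" if "i < n" "j < n" for i j
    using that by metis
  then show "S = 1\<^sub>m n"
    using Sc by (intro eq_matI) auto
qed

lemma gaussian_one: "gaussian n (1\<^sub>m n) = distr (std_gauss n) (vec_borel n) (Matrix.vec n)"
  unfolding gaussian_def psd_sqrt_one std_gauss_def by simp

text \<open>Completing the square: translating by \<open>m\<close> multiplies the density by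
  \<open>exp (y * m - m\<^sup>2 / 2)\<close>, the one-dimensional Cameron-Martin formula.\<close>

lemma nn_integral_std_normal_shift:
  assumes [measurable]: "g \<in> borel_measurable borel"
  shows "(\<integral>\<^sup>+ y. g (y + m) \<partial>density lborel std_normal_density) =
    (\<integral>\<^sup>+ y. g y * ennreal (exp (y * m - m\<^sup>2 / 2)) \<partial>density lborel std_normal_density)"
proof -
  have eq: "std_normal_density (y - m) = std_normal_density y * exp (y * m - m\<^sup>2 / 2)" for y :: real
    by (simp add: std_normal_density_def mult_exp_exp[symmetric] flip: exp_add)
       (simp add: power2_eq_square field_simps)
  have "(\<integral>\<^sup>+ y. g (y + m) \<partial>density lborel std_normal_density) =
    (\<integral>\<^sup>+ y. ennreal (std_normal_density y) * g (y + m) \<partial>lborel)"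
    by (subst nn_integral_density) auto
  also have "\<dots> = (\<integral>\<^sup>+ y. ennreal (std_normal_density (y - m)) * g y \<partial>lborel)"
    by (subst nn_integral_real_affine[where c=1 and t="- m"]) auto
  also have "\<dots> = (\<integral>\<^sup>+ y. ennreal (std_normal_density y) * (g y * ennreal (exp (y * m - m\<^sup>2 / 2))) \<partial>lborel)"
    by (intro nn_integral_cong) (simp add: eq ennreal_mult ac_simps)
  also have "\<dots> = (\<integral>\<^sup>+ y. g y * ennreal (exp (y * m - m\<^sup>2 / 2)) \<partial>density lborel std_normal_density)"
    by (subst nn_integral_density) auto
  finally show ?thesis .
qed

text \<open>The Cameron-Martin formula for a standard normal vector, one coordinate at a time. With
  nonnegative integrals, Tonelli applies to every measurable \<open>f\<close>.\<close>

lemma nn_integral_PiM_std_normal_shift: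
  assumes "finite I" and "f \<in> borel_measurable (PiM I (\<lambda>_::nat. borel))"
  shows "(\<integral>\<^sup>+ z. f (\<lambda>i\<in>I. z i + \<mu> i) \<partial>PiM I (\<lambda>_. density lborel std_normal_density)) =
    (\<integral>\<^sup>+ z. f z * ennreal (exp (\<Sum>i\<in>I. z i * \<mu> i - (\<mu> i)\<^sup>2 / 2)) \<partial>PiM I (\<lambda>_. density lborel std_normal_density))"
  using assms
proof (induction I arbitrary: f)
  case empty
  then show ?case
    by (simp add: PiM_empty nn_integral_count_space_finite)
next
  case (insert k I)
  let ?N = "density lborel std_normal_density"
  let ?P = "\<lambda>I. PiM I (\<lambda>_::nat. ?N)"
  have sP [measurable_cong]: "sets (?P J) = sets (PiM J (\<lambda>_. borel))" for J
    by (rule sets_PiM_cong) auto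
  note f [measurable] = insert.prems
  let ?E = "\<lambda>z. \<Sum>i\<in>I. z i * \<mu> i - (\<mu> i)\<^sup>2 / 2"
  have upd [measurable]: "(\<lambda>(z, y). z(k := y)) \<in> PiM I (\<lambda>_. borel) \<Otimes>\<^sub>M borel \<rightarrow>\<^sub>M PiM (insert k I) (\<lambda>_. borel :: real measure)"
    by (rule measurable_add_dim)
  \<comment> \<open>\<open>F\<close> integrates out the new coordinate with its weight already
    attached, so that the induction hypothesis for \<open>F\<close> shifts the remaining
    ones.\<close>
  define F where "F = (\<lambda>z. \<integral>\<^sup>+ y. f (z(k := y)) * ennreal (exp (y * \<mu> k - (\<mu> k)\<^sup>2 / 2)) \<partial>?N)"
  have F [measurable]: "F \<in> borel_measurable (PiM I (\<lambda>_. borel))"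
    unfolding F_def
    by (rule sigma_finite_measure.borel_measurable_nn_integral[OF std_normal.sigma_finite_measure])
       (use upd in measurable)
  have sh [measurable]: "(\<lambda>z. \<lambda>i\<in>insert k I. z i + \<mu> i) \<in> PiM (insert k I) (\<lambda>_. borel) \<rightarrow>\<^sub>M PiM (insert k I) (\<lambda>_. borel :: real measure)"
    by (intro measurable_restrict) measurable
  have "(\<integral>\<^sup>+ z. f (\<lambda>i\<in>insert k I. z i + \<mu> i) \<partial>?P (insert k I)) =
     (\<integral>\<^sup>+ z. (\<integral>\<^sup>+ y. f (\<lambda>i\<in>insert k I. (z(k := y)) i + \<mu> i) \<partial>?N) \<partial>?P I)"
    by (rule std_normal_PiM.product_nn_integral_insert) (use insert in auto)
  also have "\<dots> = (\<integral>\<^sup>+ z. F (\<lambda>i\<in>I. z i + \<mu> i) \<partial>?P I)"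
  proof (intro nn_integral_cong)
    fix z assume z: "z \<in> space (?P I)"
    have eq: "(\<lambda>i\<in>insert k I. (z(k := y)) i + \<mu> i) = (\<lambda>i\<in>I. z i + \<mu> i)(k := y + \<mu> k)" for y
      using insert.hyps by (auto simp: fun_eq_iff restrict_def)
    have m: "(\<lambda>y. f ((\<lambda>i\<in>I. z i + \<mu> i)(k := y))) \<in> borel_measurable borel"
      by (rule measurable_compose[OF measurable_component_update f])
         (use insert.hyps in \<open>auto simp: space_PiM\<close>)
    show "(\<integral>\<^sup>+ y. f (\<lambda>i\<in>insert k I. (z(k := y)) i + \<mu> i) \<partial>?N) = F (\<lambda>i\<in>I. z i + \<mu> i)"
      unfolding eq F_def by (rule nn_integral_std_normal_shift[OF m])
  qed
  also have "\<dots> = (\<integral>\<^sup>+ z. F z * ennreal (exp (?E z)) \<partial>?P I)"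
    by (rule insert.IH[OF F])
  also have "\<dots> = (\<integral>\<^sup>+ z. (\<integral>\<^sup>+ y. f (z(k := y)) * ennreal (exp (\<Sum>i\<in>insert k I. (z(k := y)) i * \<mu> i - (\<mu> i)\<^sup>2 / 2)) \<partial>?N) \<partial>?P I)"
  proof (intro nn_integral_cong)
    fix z assume z: "z \<in> space (?P I)"
    have m [measurable]: "(\<lambda>y. f (z(k := y))) \<in> borel_measurable borel"
      by (rule measurable_compose[OF measurable_component_update f])
         (use insert.hyps z in \<open>auto simp: space_PiM\<close>)
    have eq: "(\<Sum>i\<in>insert k I. (z(k := y)) i * \<mu> i - (\<mu> i)\<^sup>2 / 2) = (y * \<mu> k - (\<mu> k)\<^sup>2 / 2) + ?E z" for y
      using insert.hyps by (subst sum.insert) (auto intro!: sum.cong)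
    show "F z * ennreal (exp (?E z)) = (\<integral>\<^sup>+ y. f (z(k := y)) * ennreal (exp (\<Sum>i\<in>insert k I. (z(k := y)) i * \<mu> i - (\<mu> i)\<^sup>2 / 2)) \<partial>?N)"
      unfolding F_def eq exp_add ennreal_mult[OF exp_ge_zero exp_ge_zero]
      by (subst nn_integral_multc[symmetric]) (auto simp: ac_simps)
  qed
  also have "\<dots> = (\<integral>\<^sup>+ z. f z * ennreal (exp (\<Sum>i\<in>insert k I. z i * \<mu> i - (\<mu> i)\<^sup>2 / 2)) \<partial>?P (insert k I))"
    by (rule std_normal_PiM.product_nn_integral_insert[symmetric]) (use insert in auto)
  finally show ?case .
qed

lemma measurable_fun_upd_atLeastAtMost:
  assumes "f \<in> N \<rightarrow>\<^sub>M PiM {1..t} (\<lambda>_. M)" and "g \<in> N \<rightarrow>\<^sub>M M"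
  shows "(\<lambda>w. (f w)(Suc t := g w)) \<in> N \<rightarrow>\<^sub>M PiM {1..Suc t} (\<lambda>_. M)"
  by (rule measurable_fun_upd[where J="{1..t}"]) (use assms in auto)

section \<open>One time step as a composition of Markov kernels\<close>

locale lqr_system =
  fixes dx du :: nat and A :: rmat and alg :: algorithm
  assumes A: "A \<in> carrier_mat dx dx" and alg: "alg \<in> algorithms dx du"
begin

abbreviation "H \<equiv> history_space dx du"
abbreviation "P B \<equiv> trajectory_law A B (1\<^sub>m dx) alg"

definition push :: "nat \<Rightarrow> history \<Rightarrow> rvec \<Rightarrow> rvec \<Rightarrow> history" where
  "push t h x' u' = ((fst h)(Suc t := x'), (snd h)(Suc t := u'))"

text \<open>The new input is integrated out while the new state \<open>x'\<close> stays free. The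
  algorithm's kernel, common to all instances, is thereby kept apart from \<open>next_state\<close>,
  the only place where \<open>A\<close> and \<open>B\<close> enter.\<close>

definition act :: "nat \<Rightarrow> (history \<Rightarrow> ennreal) \<Rightarrow> history \<Rightarrow> rvec \<Rightarrow> ennreal" where
  "act t f h x' = (\<integral>\<^sup>+ u'. f (push t h x' u') \<partial>alg (Suc t) ((fst h)(Suc t := x'), snd h))"

lemma measurable_fst_history: "fst \<in> H n m \<rightarrow>\<^sub>M PiM {1..n} (\<lambda>_. vec_borel dx)"
  and measurable_snd_history: "snd \<in> H n m \<rightarrow>\<^sub>M PiM {1..m} (\<lambda>_. vec_borel du)"
  unfolding history_space_def by auto

lemma measurable_state: "t \<in> {1..n} \<Longrightarrow> (\<lambda>h. fst h t) \<in> H n m \<rightarrow>\<^sub>M vec_borel dx"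
  by (rule measurable_compose[OF measurable_fst_history measurable_component_singleton])

lemma measurable_input: "t \<in> {1..m} \<Longrightarrow> (\<lambda>h. snd h t) \<in> H n m \<rightarrow>\<^sub>M vec_borel du"
  by (rule measurable_compose[OF measurable_snd_history measurable_component_singleton])

lemma measurable_add_state:
  "(\<lambda>(h, x'). ((fst h)(Suc t := x'), snd h)) \<in> H t m \<Otimes>\<^sub>M vec_borel dx \<rightarrow>\<^sub>M H (Suc t) m"
proof -
  have "(\<lambda>w. (fst (fst w))(Suc t := snd w)) \<in> H t m \<Otimes>\<^sub>M vec_borel dx \<rightarrow>\<^sub>M PiM {1..Suc t} (\<lambda>_. vec_borel dx)"
    by (rule measurable_fun_upd_atLeastAtMost)
       (rule measurable_compose[OF measurable_fst measurable_fst_history] measurable_snd)+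
  moreover have "(\<lambda>w. snd (fst w)) \<in> H t m \<Otimes>\<^sub>M vec_borel dx \<rightarrow>\<^sub>M PiM {1..m} (\<lambda>_. vec_borel du)"
    by (rule measurable_compose[OF measurable_fst measurable_snd_history])
  ultimately show ?thesis
    unfolding history_space_def[of dx du "Suc t"] case_prod_beta' by (rule measurable_Pair)
qed

lemma measurable_push:
  "(\<lambda>((h, x'), u'). push t h x' u') \<in> (H t t \<Otimes>\<^sub>M vec_borel dx) \<Otimes>\<^sub>M vec_borel du \<rightarrow>\<^sub>M H (Suc t) (Suc t)"
proof -
  let ?N = "(H t t \<Otimes>\<^sub>M vec_borel dx) \<Otimes>\<^sub>M vec_borel du"
  have 0: "(\<lambda>w. fst (fst w)) \<in> ?N \<rightarrow>\<^sub>M H t t" by simp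
  have "(\<lambda>w. (fst (fst (fst w)))(Suc t := snd (fst w))) \<in> ?N \<rightarrow>\<^sub>M PiM {1..Suc t} (\<lambda>_. vec_borel dx)"
    by (rule measurable_fun_upd_atLeastAtMost)
       (rule measurable_compose[OF 0 measurable_fst_history] measurable_compose[OF measurable_fst measurable_snd])+
  moreover have "(\<lambda>w. (snd (fst (fst w)))(Suc t := snd w)) \<in> ?N \<rightarrow>\<^sub>M PiM {1..Suc t} (\<lambda>_. vec_borel du)"
    by (rule measurable_fun_upd_atLeastAtMost)
       (rule measurable_compose[OF 0 measurable_snd_history] measurable_snd)+
  ultimately show ?thesis
    unfolding history_space_def[of dx du "Suc t"] case_prod_beta' push_def by (rule measurable_Pair)
qed

lemma alg_kernel: "alg (Suc t) \<in> H (Suc t) t \<rightarrow>\<^sub>M prob_algebra (vec_borel du)"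
  using alg unfolding algorithms_def by (auto dest: spec[of _ "Suc t"])

lemma alg_kernel':
  "(\<lambda>(h, x'). alg (Suc t) ((fst h)(Suc t := x'), snd h)) \<in> H t t \<Otimes>\<^sub>M vec_borel dx \<rightarrow>\<^sub>M prob_algebra (vec_borel du)"
  using measurable_compose[OF measurable_add_state alg_kernel] by (simp add: case_prod_beta')

lemma measurable_act:
  assumes f: "f \<in> borel_measurable (H (Suc t) (Suc t))"
  shows "(\<lambda>(h, x'). act t f h x') \<in> borel_measurable (H t t \<Otimes>\<^sub>M vec_borel dx)"
  unfolding act_def case_prod_beta'
proof (rule nn_integral_measurable_subprob_algebra2)
  show "(\<lambda>(w, u'). f (push t (fst w) (snd w) u')) \<in> borel_measurable ((H t t \<Otimes>\<^sub>M vec_borel dx) \<Otimes>\<^sub>M vec_borel du)"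
    using measurable_compose[OF measurable_push f] by (simp add: case_prod_beta')
  show "(\<lambda>w. alg (Suc t) ((fst (fst w))(Suc t := snd w), snd (fst w)))
      \<in> H t t \<Otimes>\<^sub>M vec_borel dx \<rightarrow>\<^sub>M subprob_algebra (vec_borel du)"
    using measurable_prob_algebraD[OF alg_kernel'] by (simp add: case_prod_beta')
qed

lemma prob_space_alg:
  assumes "h \<in> space (H t t)" "x' \<in> carrier_vec dx"
  shows "prob_space (alg (Suc t) ((fst h)(Suc t := x'), snd h))"
    and "sets (alg (Suc t) ((fst h)(Suc t := x'), snd h)) = sets (vec_borel du)"
  using measurable_space[OF alg_kernel', of "(h, x')"] assms
  by (auto simp: space_pair_measure space_prob_algebra)

lemma act_const:
  assumes "h \<in> space (H t t)" "x' \<in> carrier_vec dx"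
    and "\<And>u'. u' \<in> carrier_vec du \<Longrightarrow> f (push t h x' u') = c"
  shows "act t f h x' = c"
proof -
  interpret a: prob_space "alg (Suc t) ((fst h)(Suc t := x'), snd h)"
    by (rule prob_space_alg) fact+
  have sp: "space (alg (Suc t) ((fst h)(Suc t := x'), snd h)) = carrier_vec du"
    using sets_eq_imp_space_eq[OF prob_space_alg(2)[OF assms(1,2)]] by simp
  show ?thesis unfolding act_def
    by (subst nn_integral_cong[where v="\<lambda>_. c"]) (auto simp: sp assms(3) a.emeasure_space_1[unfolded sp])
qed

text \<open>The likelihood ratio of a step involves the new state but not the new input, so it acts
  as a constant \<open>c\<close> for the integral over the algorithm's randomness.\<close>

lemma act_mult:
  assumes f: "f \<in> borel_measurable (H (Suc t) (Suc t))"
    and h: "h \<in> space (H t t)" "x' \<in> carrier_vec dx"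
    and g: "\<And>u'. u' \<in> carrier_vec du \<Longrightarrow> f' (push t h x' u') = f (push t h x' u') * c"
  shows "act t f' h x' = act t f h x' * c"
proof -
  have sp: "space (alg (Suc t) ((fst h)(Suc t := x'), snd h)) = carrier_vec du"
    using sets_eq_imp_space_eq[OF prob_space_alg(2)[OF h]] by simp
  have "(\<lambda>u'. f (push t h x' u')) \<in> borel_measurable (vec_borel du)"
    using measurable_compose[OF measurable_Pair1' measurable_compose[OF measurable_push f], of "(h, x')"] h
    by (simp add: space_pair_measure)
  then have m: "(\<lambda>u'. f (push t h x' u')) \<in> borel_measurable (alg (Suc t) ((fst h)(Suc t := x'), snd h))"
    by (simp cong: measurable_cong_sets add: prob_space_alg(2)[OF h])
  show ?thesis unfolding act_def
    by (subst nn_integral_multc[OF m, symmetric]) (auto intro!: nn_integral_cong simp: sp g)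
qed

end

context lqr_system begin

lemma next_state_kernel:
  assumes B: "B \<in> carrier_mat dx du"
  shows "next_state A B (1\<^sub>m dx) t \<in> H t t \<rightarrow>\<^sub>M prob_algebra (vec_borel dx)"
proof (cases "t = 0")
  case True
  have "return (vec_borel dx) (0\<^sub>v dx) \<in> space (prob_algebra (vec_borel dx))"
    by (simp add: space_prob_algebra prob_space_return)
  moreover have "next_state A B (1\<^sub>m dx) t = (\<lambda>_. return (vec_borel dx) (0\<^sub>v dx))"
    using True A by (auto simp: next_state_def fun_eq_iff)
  ultimately show ?thesis by simp
next
  case False
  let ?f = "\<lambda>h w. A *\<^sub>v fst h t + B *\<^sub>v snd h t + w"
  have eq: "next_state A B (1\<^sub>m dx) t = (\<lambda>h. distr (gaussian dx (1\<^sub>m dx)) (vec_borel dx) (?f h))"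
    using False A by (auto simp: next_state_def fun_eq_iff)
  have g: "gaussian dx (1\<^sub>m dx) \<in> space (prob_algebra (vec_borel dx))"
    unfolding gaussian_one space_prob_algebra
    by (auto intro!: prob_space.prob_space_distr[OF prob_space_std_gauss] measurable_vec_std_gauss)
  have t: "t \<in> {1..t}" using False by auto
  have m: "(\<lambda>(h, w). ?f h w) \<in> H t t \<Otimes>\<^sub>M vec_borel dx \<rightarrow>\<^sub>M vec_borel dx"
    unfolding case_prod_beta'
    by (intro measurable_add_vec measurable_mult_mat_vec[OF _ A] measurable_mult_mat_vec[OF _ B]
        measurable_snd measurable_compose[OF measurable_fst measurable_state[OF t]]
        measurable_compose[OF measurable_fst measurable_input[OF t]])
  show ?thesis unfolding eq
    by (rule measurable_distr_prob_space2[OF measurable_const[OF g] m])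
qed

lemma space_history:
  assumes "h \<in> space (H n m)"
  shows "t \<in> {1..n} \<Longrightarrow> fst h t \<in> carrier_vec dx" "t \<in> {1..m} \<Longrightarrow> snd h t \<in> carrier_vec du"
  using measurable_space[OF measurable_state assms] measurable_space[OF measurable_input assms]
  by simp_all

lemma trajectory_law_Suc:
  assumes B: "B \<in> carrier_mat dx du"
  shows "P B (Suc t) = P B t \<bind> (\<lambda>h. next_state A B (1\<^sub>m dx) t h \<bind> (\<lambda>x'.
       alg (Suc t) ((fst h)(Suc t := x'), snd h) \<bind> (\<lambda>u'. return (H (Suc t) (Suc t)) (push t h x' u'))))"
  using A B by (simp add: case_prod_beta' push_def)

lemma step_kernels:
  assumes B: "B \<in> carrier_mat dx du"
  shows "(\<lambda>((h, x'), u'). return (H (Suc t) (Suc t)) (push t h x' u'))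
     \<in> (H t t \<Otimes>\<^sub>M vec_borel dx) \<Otimes>\<^sub>M vec_borel du \<rightarrow>\<^sub>M prob_algebra (H (Suc t) (Suc t))" (is ?r)
    and "(\<lambda>(h, x'). alg (Suc t) ((fst h)(Suc t := x'), snd h) \<bind> (\<lambda>u'. return (H (Suc t) (Suc t)) (push t h x' u')))
     \<in> H t t \<Otimes>\<^sub>M vec_borel dx \<rightarrow>\<^sub>M prob_algebra (H (Suc t) (Suc t))" (is ?a)
    and "(\<lambda>h. next_state A B (1\<^sub>m dx) t h \<bind> (\<lambda>x'.
       alg (Suc t) ((fst h)(Suc t := x'), snd h) \<bind> (\<lambda>u'. return (H (Suc t) (Suc t)) (push t h x' u'))))
     \<in> H t t \<rightarrow>\<^sub>M prob_algebra (H (Suc t) (Suc t))" (is ?n)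
proof -
  show r: ?r
    using measurable_compose[OF measurable_push measurable_return_prob_space] by (simp add: case_prod_beta')
  show a: ?a
    unfolding case_prod_beta'
    by (rule measurable_bind_prob_space2[where N="vec_borel du"])
       (use alg_kernel' r in \<open>simp_all add: case_prod_beta'\<close>)
  show ?n
    by (rule measurable_bind_prob_space2[OF next_state_kernel[OF B]])
       (use a in \<open>simp add: case_prod_beta'\<close>)
qed

lemma trajectory_in_prob_algebra:
  assumes B: "B \<in> carrier_mat dx du"
  shows "P B t \<in> space (prob_algebra (H t t))"
proof (induction t)
  case 0
  have "(\<lambda>_. undefined, \<lambda>_. undefined) \<in> space (H 0 0)"
    unfolding history_space_def space_pair_measure by (auto simp: space_PiM)
  then show ?case using A B by (simp add: space_prob_algebra prob_space_return)
next
  case (Suc t)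
  show ?case unfolding trajectory_law_Suc[OF B]
    using measurable_space[OF measurable_bind_prob_space[OF measurable_ident_sets[OF refl] step_kernels(3)[OF B]], OF Suc]
    by simp
qed

lemma prob_space_trajectory: "B \<in> carrier_mat dx du \<Longrightarrow> prob_space (P B t)"
  and sets_trajectory: "B \<in> carrier_mat dx du \<Longrightarrow> sets (P B t) = sets (H t t)"
  using trajectory_in_prob_algebra[of B t] by (auto simp: space_prob_algebra)

lemma space_trajectory: "B \<in> carrier_mat dx du \<Longrightarrow> space (P B t) = space (H t t)"
  by (rule sets_eq_imp_space_eq[OF sets_trajectory])

lemma measurable_trajectory: "B \<in> carrier_mat dx du \<Longrightarrow> (f \<in> P B t \<rightarrow>\<^sub>M N) = (f \<in> H t t \<rightarrow>\<^sub>M N)"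
  by (rule arg_cong[where f="\<lambda>S. f \<in> S"]) (rule measurable_cong_sets[OF sets_trajectory refl])

text \<open>The nested binds of one step as an iterated integral; later computations with a single
  step of the law start from this form.\<close>

lemma nn_integral_trajectory_Suc:
  assumes B: "B \<in> carrier_mat dx du" and f: "f \<in> borel_measurable (H (Suc t) (Suc t))"
  shows "(\<integral>\<^sup>+ h. f h \<partial>P B (Suc t)) = (\<integral>\<^sup>+ h. \<integral>\<^sup>+ x'. act t f h x' \<partial>next_state A B (1\<^sub>m dx) t h \<partial>P B t)"
proof -
  have sub: "P B t \<in> space (subprob_algebra (H t t))"
    using measurable_space[OF measurable_prob_algebraD[OF measurable_ident_sets[OF refl]] trajectory_in_prob_algebra[OF B, of t]]
    by simp
  have 1: "(\<integral>\<^sup>+ h. f h \<partial>P B (Suc t)) = (\<integral>\<^sup>+ h. \<integral>\<^sup>+ h'. f h' \<partial>(next_state A B (1\<^sub>m dx) t h \<bind> (\<lambda>x'.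
       alg (Suc t) ((fst h)(Suc t := x'), snd h) \<bind> (\<lambda>u'. return (H (Suc t) (Suc t)) (push t h x' u')))) \<partial>P B t)"
    unfolding trajectory_law_Suc[OF B]
    by (rule nn_integral_bind[OF f])
       (use measurable_prob_algebraD[OF step_kernels(3)[OF B]] in
        \<open>simp add: measurable_trajectory[OF B]\<close>)
  show ?thesis unfolding 1
  proof (intro nn_integral_cong)
    fix h assume "h \<in> space (P B t)"
    then have h: "h \<in> space (H t t)" by (simp add: space_trajectory[OF B])
    have ns: "sets (next_state A B (1\<^sub>m dx) t h) = sets (vec_borel dx)"
      using measurable_space[OF next_state_kernel[OF B] h] by (simp add: space_prob_algebra)
    let ?K = "\<lambda>x'. alg (Suc t) ((fst h)(Suc t := x'), snd h) \<bind> (\<lambda>u'. return (H (Suc t) (Suc t)) (push t h x' u'))"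
    have K: "?K \<in> vec_borel dx \<rightarrow>\<^sub>M subprob_algebra (H (Suc t) (Suc t))"
      using measurable_compose[OF measurable_Pair1'[OF h] measurable_prob_algebraD[OF step_kernels(2)[OF B]]]
      by simp
    have "(\<integral>\<^sup>+ h'. f h' \<partial>(next_state A B (1\<^sub>m dx) t h \<bind> ?K)) = (\<integral>\<^sup>+ x'. \<integral>\<^sup>+ h'. f h' \<partial>?K x' \<partial>next_state A B (1\<^sub>m dx) t h)"
      by (rule nn_integral_bind[OF f]) (use K in \<open>simp cong: measurable_cong_sets add: ns\<close>)
    also have "\<dots> = (\<integral>\<^sup>+ x'. act t f h x' \<partial>next_state A B (1\<^sub>m dx) t h)"
    proof (intro nn_integral_cong)
      fix x' assume "x' \<in> space (next_state A B (1\<^sub>m dx) t h)"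
      then have x': "x' \<in> carrier_vec dx" using sets_eq_imp_space_eq[OF ns] by simp
      have hx: "(h, x') \<in> space (H t t \<Otimes>\<^sub>M vec_borel dx)" using h x' by (simp add: space_pair_measure)
      have p: "(\<lambda>u'. push t h x' u') \<in> vec_borel du \<rightarrow>\<^sub>M H (Suc t) (Suc t)"
        using measurable_compose[OF measurable_Pair1'[OF hx] measurable_push] by simp
      have ps: "push t h x' u' \<in> space (H (Suc t) (Suc t))" if "u' \<in> carrier_vec du" for u'
        using measurable_space[OF p] that by simp
      have "(\<integral>\<^sup>+ h'. f h' \<partial>?K x') = (\<integral>\<^sup>+ u'. \<integral>\<^sup>+ h'. f h' \<partial>return (H (Suc t) (Suc t)) (push t h x' u')
          \<partial>alg (Suc t) ((fst h)(Suc t := x'), snd h))"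
        by (rule nn_integral_bind[OF f])
           (use measurable_compose[OF p measurable_prob_algebraD[OF measurable_return_prob_space]] in
             \<open>simp cong: measurable_cong_sets add: prob_space_alg(2)[OF h x']\<close>)
      also have "\<dots> = act t f h x'"
        unfolding act_def
        by (intro nn_integral_cong nn_integral_return ps f)
           (simp add: sets_eq_imp_space_eq[OF prob_space_alg(2)[OF h x']])
      finally show "(\<integral>\<^sup>+ h'. f h' \<partial>?K x') = act t f h x'" .
    qed
    finally show "(\<integral>\<^sup>+ h'. f h' \<partial>(next_state A B (1\<^sub>m dx) t h \<bind> ?K)) = (\<integral>\<^sup>+ x'. act t f h x' \<partial>next_state A B (1\<^sub>m dx) t h)" .
  qed
qed

lemma nn_integral_next_state:
  assumes B: "B \<in> carrier_mat dx du" and t: "t \<noteq> 0" and h: "h \<in> space (H t t)"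
    and \<phi>: "\<phi> \<in> borel_measurable (vec_borel dx)"
  shows "(\<integral>\<^sup>+ x'. \<phi> x' \<partial>next_state A B (1\<^sub>m dx) t h) =
    (\<integral>\<^sup>+ z. \<phi> (A *\<^sub>v fst h t + B *\<^sub>v snd h t + Matrix.vec dx z) \<partial>std_gauss dx)"
proof -
  have tt: "t \<in> {1..t}" using t by auto
  note hc = space_history[OF h, of t]
  have v: "A *\<^sub>v fst h t + B *\<^sub>v snd h t \<in> carrier_vec dx" using A B hc tt by auto
  have m: "(\<lambda>w. A *\<^sub>v fst h t + B *\<^sub>v snd h t + w) \<in> vec_borel dx \<rightarrow>\<^sub>M vec_borel dx"
    by (rule measurable_add_vec[OF measurable_const]) (use v in auto)
  have "next_state A B (1\<^sub>m dx) t h = distr (gaussian dx (1\<^sub>m dx)) (vec_borel dx) (\<lambda>w. A *\<^sub>v fst h t + B *\<^sub>v snd h t + w)"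
    using t A by (simp add: next_state_def case_prod_beta')
  also have "\<dots> = distr (std_gauss dx) (vec_borel dx) ((\<lambda>w. A *\<^sub>v fst h t + B *\<^sub>v snd h t + w) \<circ> Matrix.vec dx)"
    unfolding gaussian_one by (rule distr_distr[OF m measurable_vec_std_gauss])
  finally have "next_state A B (1\<^sub>m dx) t h = \<dots>" .
  then show ?thesis
    using measurable_comp[OF measurable_vec_std_gauss m] \<phi> by (simp add: nn_integral_distr)
qed

text \<open>Radon-Nikodym derivative of the next state under \<open>B\<close> with respect to the
  next state under the zero input matrix, given the history: the noise is shifted by
  \<open>B *\<^sub>v snd h t\<close>.\<close>

definition drift_density :: "rmat \<Rightarrow> nat \<Rightarrow> history \<Rightarrow> rvec \<Rightarrow> real" where
  "drift_density B t h x' = exp (\<Sum>i<dx. (x' $ i - (A *\<^sub>v fst h t) $ i) * (B *\<^sub>v snd h t) $ i - ((B *\<^sub>v snd h t) $ i)\<^sup>2 / 2)"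

lemma nn_integral_next_state_density:
  assumes B: "B \<in> carrier_mat dx du" and t: "t \<noteq> 0" and h: "h \<in> space (H t t)"
    and \<phi>: "\<phi> \<in> borel_measurable (vec_borel dx)"
  shows "(\<integral>\<^sup>+ x'. \<phi> x' \<partial>next_state A B (1\<^sub>m dx) t h) =
    (\<integral>\<^sup>+ x'. \<phi> x' * ennreal (drift_density B t h x') \<partial>next_state A (0\<^sub>m dx du) (1\<^sub>m dx) t h)"
proof -
  have tt: "t \<in> {1..t}" using t by auto
  note hc = space_history[OF h, of t]
  have v: "A *\<^sub>v fst h t \<in> carrier_vec dx" "B *\<^sub>v snd h t \<in> carrier_vec dx" using A B hc tt by auto
  let ?m = "\<lambda>i. (B *\<^sub>v snd h t) $ i"
  define F where "F = (\<lambda>z. \<phi> (A *\<^sub>v fst h t + Matrix.vec dx z))"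
  have mv: "Matrix.vec dx \<in> PiM {..<dx} (\<lambda>_. borel) \<rightarrow>\<^sub>M vec_borel dx"
    using measurable_vec_std_gauss by (simp cong: measurable_cong_sets add: sets_std_gauss)
  have F: "F \<in> borel_measurable (PiM {..<dx} (\<lambda>_. borel))"
    unfolding F_def
    by (rule measurable_compose[OF _ \<phi>], rule measurable_add_vec[OF measurable_const mv]) (use v in simp)
  have "(\<integral>\<^sup>+ x'. \<phi> x' \<partial>next_state A B (1\<^sub>m dx) t h) = (\<integral>\<^sup>+ z. F (\<lambda>i\<in>{..<dx}. z i + ?m i) \<partial>std_gauss dx)"
    unfolding nn_integral_next_state[OF assms] F_def
    by (intro nn_integral_cong arg_cong[where f=\<phi>] eq_vecI) (use v in auto)
  also have "\<dots> = (\<integral>\<^sup>+ z. F z * ennreal (exp (\<Sum>i<dx. z i * ?m i - (?m i)\<^sup>2 / 2)) \<partial>std_gauss dx)"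
    unfolding std_gauss_def by (rule nn_integral_PiM_std_normal_shift[OF _ F]) simp
  also have "\<dots> = (\<integral>\<^sup>+ z. (\<lambda>x'. \<phi> x' * ennreal (drift_density B t h x')) (A *\<^sub>v fst h t + 0\<^sub>m dx du *\<^sub>v snd h t + Matrix.vec dx z) \<partial>std_gauss dx)"
  proof (intro nn_integral_cong)
    fix z
    have eq: "A *\<^sub>v fst h t + 0\<^sub>m dx du *\<^sub>v snd h t + Matrix.vec dx z = A *\<^sub>v fst h t + Matrix.vec dx z"
      using v hc tt by auto
    have "drift_density B t h (A *\<^sub>v fst h t + Matrix.vec dx z) = exp (\<Sum>i<dx. z i * ?m i - (?m i)\<^sup>2 / 2)"
      unfolding drift_density_def using v A by (intro arg_cong[where f=exp] sum.cong) auto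
    then show "F z * ennreal (exp (\<Sum>i<dx. z i * ?m i - (?m i)\<^sup>2 / 2)) =
      (\<lambda>x'. \<phi> x' * ennreal (drift_density B t h x')) (A *\<^sub>v fst h t + 0\<^sub>m dx du *\<^sub>v snd h t + Matrix.vec dx z)"
      unfolding eq F_def by simp
  qed
  also have "\<dots> = (\<integral>\<^sup>+ x'. \<phi> x' * ennreal (drift_density B t h x') \<partial>next_state A (0\<^sub>m dx du) (1\<^sub>m dx) t h)"
  proof (rule nn_integral_next_state[OF _ t h, symmetric])
    have "(\<lambda>x'. drift_density B t h x') \<in> borel_measurable (vec_borel dx)"
      unfolding drift_density_def
      by (intro borel_measurable_exp[THEN measurable_compose[rotated]] borel_measurable_sum borel_measurable_diff
         borel_measurable_times measurable_vec_component measurable_const) auto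
    then show "(\<lambda>x'. \<phi> x' * ennreal (drift_density B t h x')) \<in> borel_measurable (vec_borel dx)"
      using \<phi> by measurable
  qed simp
  finally show ?thesis .
qed

end

section \<open>Likelihood ratios and independence of the noise\<close>

context lqr_system begin

text \<open>Product of the step densities. The last input \<open>snd h t\<close> does not occur,
  since it acts only on the state that follows it.\<close>

definition likelihood :: "rmat \<Rightarrow> nat \<Rightarrow> history \<Rightarrow> real" where
  "likelihood B t h = exp (\<Sum>q\<in>{1..<t}. \<Sum>i<dx. (fst h (Suc q) $ i - (A *\<^sub>v fst h q) $ i) * (B *\<^sub>v snd h q) $ i
     - ((B *\<^sub>v snd h q) $ i)\<^sup>2 / 2)"

lemma likelihood_pos: "0 < likelihood B t h"
  by (simp add: likelihood_def)

lemma measurable_likelihood: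
  assumes B: "B \<in> carrier_mat dx du"
  shows "likelihood B t \<in> borel_measurable (H t t)"
  unfolding likelihood_def
  by (intro borel_measurable_exp[THEN measurable_compose[rotated]] borel_measurable_sum borel_measurable_diff
      borel_measurable_times borel_measurable_divide borel_measurable_power measurable_const
      measurable_vec_component'[OF measurable_state] measurable_vec_component'[OF measurable_mult_mat_vec[OF measurable_state A]]
      measurable_vec_component'[OF measurable_mult_mat_vec[OF measurable_input B]]) auto

lemma measurable_nn_integral_next_state:
  assumes B: "B \<in> carrier_mat dx du" and g: "(\<lambda>(h, x'). g h x') \<in> borel_measurable (H t t \<Otimes>\<^sub>M vec_borel dx)"
  shows "(\<lambda>h. \<integral>\<^sup>+ x'. g h x' \<partial>next_state A B (1\<^sub>m dx) t h) \<in> borel_measurable (H t t)"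
  by (rule nn_integral_measurable_subprob_algebra2[OF g measurable_prob_algebraD[OF next_state_kernel[OF B]]])

lemma next_state_prob:
  assumes B: "B \<in> carrier_mat dx du" and h: "h \<in> space (H t t)"
  shows "prob_space (next_state A B (1\<^sub>m dx) t h)"
    and "sets (next_state A B (1\<^sub>m dx) t h) = sets (vec_borel dx)"
    and "space (next_state A B (1\<^sub>m dx) t h) = carrier_vec dx"
  using measurable_space[OF next_state_kernel[OF B] h] sets_eq_imp_space_eq[of _ "vec_borel dx"]
  by (auto simp: space_prob_algebra)

lemma measurable_act':
  assumes "f \<in> borel_measurable (H (Suc t) (Suc t))" "h \<in> space (H t t)"
  shows "act t f h \<in> borel_measurable (vec_borel dx)"
  using measurable_compose[OF measurable_Pair1'[OF assms(2)] measurable_act[OF assms(1)]] by simp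

text \<open>Girsanov's formula in discrete time: each step contributes its Gaussian density, while
  the inputs are drawn from the same kernel under both laws.\<close>

lemma nn_integral_trajectory_density:
  assumes B: "B \<in> carrier_mat dx du" and f: "f \<in> borel_measurable (H t t)"
  shows "(\<integral>\<^sup>+ h. f h \<partial>P B t) = (\<integral>\<^sup>+ h. f h * ennreal (likelihood B t h) \<partial>P (0\<^sub>m dx du) t)"
  using f
proof (induction t arbitrary: f)
  case 0
  then show ?case using A B by (simp add: likelihood_def)
next
  case (Suc t)
  let ?Z = "0\<^sub>m dx du :: rmat"
  have Z: "?Z \<in> carrier_mat dx du" by simp
  note f = Suc.prems
  let ?f' = "\<lambda>h. f h * ennreal (likelihood B (Suc t) h)"
  have f': "?f' \<in> borel_measurable (H (Suc t) (Suc t))"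
    using f measurable_likelihood[OF B, of "Suc t"] by measurable
  have "(\<integral>\<^sup>+ h. f h \<partial>P B (Suc t)) = (\<integral>\<^sup>+ h. \<integral>\<^sup>+ x'. act t f h x' \<partial>next_state A B (1\<^sub>m dx) t h \<partial>P B t)"
    by (rule nn_integral_trajectory_Suc[OF B f])
  also have "\<dots> = (\<integral>\<^sup>+ h. (\<integral>\<^sup>+ x'. act t f h x' \<partial>next_state A B (1\<^sub>m dx) t h) * ennreal (likelihood B t h) \<partial>P ?Z t)"
    by (rule Suc.IH[OF measurable_nn_integral_next_state[OF B measurable_act[OF f]]])
  also have "\<dots> = (\<integral>\<^sup>+ h. \<integral>\<^sup>+ x'. act t ?f' h x' \<partial>next_state A ?Z (1\<^sub>m dx) t h \<partial>P ?Z t)"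
  proof (intro nn_integral_cong)
    fix h assume "h \<in> space (P ?Z t)"
    then have h: "h \<in> space (H t t)" by (simp add: space_trajectory[OF Z])
    note ns = next_state_prob[OF Z h]
    \<comment> \<open>At \<open>t = 0\<close> the new state is 0 whatever \<open>B\<close> is, so
      the first step has density 1.\<close>
    define d where "d = (\<lambda>x'. if t = 0 then 1 else drift_density B t h x')"
    have d: "d \<in> borel_measurable (vec_borel dx)"
      unfolding d_def drift_density_def
      by (cases "t = 0")
        (auto intro!: borel_measurable_exp[THEN measurable_compose[rotated]] borel_measurable_sum borel_measurable_diff
         borel_measurable_times measurable_vec_component measurable_const)
    have lik: "likelihood B (Suc t) (push t h x' u') = d x' * likelihood B t h" for x' u'
    proof (cases "t = 0")
      case False
      then have "{1..<Suc t} = insert t {1..<t}" by auto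
      then have "likelihood B (Suc t) (push t h x' u') = drift_density B t h x' * exp (\<Sum>q\<in>{1..<t}. \<Sum>i<dx.
          (fst (push t h x' u') (Suc q) $ i - (A *\<^sub>v fst (push t h x' u') q) $ i) * (B *\<^sub>v snd (push t h x' u') q) $ i
          - ((B *\<^sub>v snd (push t h x' u') q) $ i)\<^sup>2 / 2)"
        by (simp add: likelihood_def drift_density_def exp_add push_def)
      also have "exp (\<Sum>q\<in>{1..<t}. \<Sum>i<dx.
          (fst (push t h x' u') (Suc q) $ i - (A *\<^sub>v fst (push t h x' u') q) $ i) * (B *\<^sub>v snd (push t h x' u') q) $ i
          - ((B *\<^sub>v snd (push t h x' u') q) $ i)\<^sup>2 / 2) = likelihood B t h"
        unfolding likelihood_def by (intro arg_cong[where f=exp] sum.cong refl) (auto simp: push_def)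
      finally show ?thesis using False by (simp add: d_def)
    qed (simp add: likelihood_def d_def)
    have dnn: "d x' \<ge> 0" for x' by (simp add: d_def drift_density_def)
    have "(\<integral>\<^sup>+ x'. act t f h x' \<partial>next_state A B (1\<^sub>m dx) t h) = (\<integral>\<^sup>+ x'. act t f h x' * ennreal (d x') \<partial>next_state A ?Z (1\<^sub>m dx) t h)"
    proof (cases "t = 0")
      case True
      then show ?thesis using A by (simp add: next_state_def d_def case_prod_beta')
    next
      case False
      then show ?thesis using nn_integral_next_state_density[OF B False h measurable_act'[OF f h]]
        by (simp add: d_def)
    qed
    then have "(\<integral>\<^sup>+ x'. act t f h x' \<partial>next_state A B (1\<^sub>m dx) t h) * ennreal (likelihood B t h)
      = (\<integral>\<^sup>+ x'. act t f h x' * ennreal (d x') * ennreal (likelihood B t h) \<partial>next_state A ?Z (1\<^sub>m dx) t h)"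
      using d measurable_act'[OF f h]
      by (subst nn_integral_multc) (auto cong: measurable_cong_sets simp: ns(2))
    also have "\<dots> = (\<integral>\<^sup>+ x'. act t ?f' h x' \<partial>next_state A ?Z (1\<^sub>m dx) t h)"
    proof (intro nn_integral_cong)
      fix x' assume "x' \<in> space (next_state A ?Z (1\<^sub>m dx) t h)"
      then have x': "x' \<in> carrier_vec dx" by (simp add: ns(3))
      have "act t ?f' h x' = act t f h x' * (ennreal (d x') * ennreal (likelihood B t h))"
        by (rule act_mult[OF f h x']) (simp only: lik ennreal_mult[OF dnn less_imp_le[OF likelihood_pos]])
      then show "act t f h x' * ennreal (d x') * ennreal (likelihood B t h) = act t ?f' h x'"
        by (simp add: ac_simps)
    qed
    finally show "(\<integral>\<^sup>+ x'. act t f h x' \<partial>next_state A B (1\<^sub>m dx) t h) * ennreal (likelihood B t h) =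
       (\<integral>\<^sup>+ x'. act t ?f' h x' \<partial>next_state A ?Z (1\<^sub>m dx) t h)" .
  qed
  also have "\<dots> = (\<integral>\<^sup>+ h. ?f' h \<partial>P ?Z (Suc t))"
    by (rule nn_integral_trajectory_Suc[OF Z f', symmetric])
  finally show ?case .
qed

text \<open>One dominating measure serves all \<open>B\<close>: the matrix then occurs only in an
  explicit smooth density, which makes differentiation in its entries possible.\<close>

lemma trajectory_eq_density:
  assumes B: "B \<in> carrier_mat dx du"
  shows "P B t = density (P (0\<^sub>m dx du) t) (\<lambda>h. ennreal (likelihood B t h))"
proof (rule measure_eqI)
  have Z: "0\<^sub>m dx du \<in> carrier_mat dx du" by simp
  show "sets (P B t) = sets (density (P (0\<^sub>m dx du) t) (\<lambda>h. ennreal (likelihood B t h)))"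
    by (simp add: sets_trajectory[OF B] sets_trajectory[OF Z])
  fix X assume X: "X \<in> sets (P B t)"
  then have X': "X \<in> sets (H t t)" by (simp add: sets_trajectory[OF B])
  have "emeasure (P B t) X = (\<integral>\<^sup>+ h. indicator X h \<partial>P B t)" using X by simp
  also have "\<dots> = (\<integral>\<^sup>+ h. indicator X h * ennreal (likelihood B t h) \<partial>P (0\<^sub>m dx du) t)"
    by (rule nn_integral_trajectory_density[OF B]) (use X' in simp)
  also have "\<dots> = emeasure (density (P (0\<^sub>m dx du) t) (\<lambda>h. ennreal (likelihood B t h))) X"
    using X' measurable_likelihood[OF B, of t]
    by (subst emeasure_density) (auto simp: sets_trajectory[OF Z] ac_simps cong: measurable_cong_sets)
  finally show "emeasure (P B t) X = \<dots>" .
qed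

section \<open>Restriction to the past and independence of the noise\<close>

definition past :: "nat \<Rightarrow> history \<Rightarrow> history" where
  "past s h = (restrict (fst h) {1..s}, restrict (snd h) {1..s})"

lemma measurable_past: "s \<le> t \<Longrightarrow> past s \<in> H t t \<rightarrow>\<^sub>M H s s"
  unfolding past_def history_space_def[of dx du s]
  by (intro measurable_Pair measurable_compose[OF measurable_fst_history measurable_restrict_subset]
      measurable_compose[OF measurable_snd_history measurable_restrict_subset]) auto

lemma past_space: "h \<in> space (H s s) \<Longrightarrow> past s h = h"
  by (cases h) (auto simp: past_def history_space_def space_pair_measure space_PiM PiE_iff extensional_restrict)

lemma past_push: "s \<le> t \<Longrightarrow> past s (push t h x' u') = past s h"
  by (auto simp: past_def push_def fun_eq_iff restrict_def)

lemma past_past: "s \<le> t \<Longrightarrow> past s (past t h) = past s h"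
  by (auto simp: past_def restrict_def fun_eq_iff)

text \<open>Later steps are kernels of total mass 1 and integrate out, so the laws for different
  horizons are consistent.\<close>

lemma nn_integral_past:
  assumes B: "B \<in> carrier_mat dx du" and f: "f \<in> borel_measurable (H s s)" and st: "s \<le> t"
  shows "(\<integral>\<^sup>+ h. f (past s h) \<partial>P B t) = (\<integral>\<^sup>+ h. f h \<partial>P B s)"
  using st
proof (induction t rule: dec_induct)
  case base
  show ?case by (intro nn_integral_cong) (simp add: space_trajectory[OF B] past_space)
next
  case (step t)
  have m: "(\<lambda>h. f (past s h)) \<in> borel_measurable (H (Suc t) (Suc t))"
    by (rule measurable_compose[OF measurable_past f]) (use step in simp)
  have "(\<integral>\<^sup>+ h. f (past s h) \<partial>P B (Suc t)) = (\<integral>\<^sup>+ h. f (past s h) \<partial>P B t)"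
    unfolding nn_integral_trajectory_Suc[OF B m]
  proof (intro nn_integral_cong)
    fix h assume "h \<in> space (P B t)"
    then have h: "h \<in> space (H t t)" by (simp add: space_trajectory[OF B])
    note ns = next_state_prob[OF B h]
    interpret ns: prob_space "next_state A B (1\<^sub>m dx) t h" by (rule ns)
    have "(\<integral>\<^sup>+ x'. act t (\<lambda>h. f (past s h)) h x' \<partial>next_state A B (1\<^sub>m dx) t h) =
       (\<integral>\<^sup>+ x'. f (past s h) \<partial>next_state A B (1\<^sub>m dx) t h)"
      by (intro nn_integral_cong act_const[OF h]) (use step in \<open>auto simp: ns past_push\<close>)
    then show "(\<integral>\<^sup>+ x'. act t (\<lambda>h. f (past s h)) h x' \<partial>next_state A B (1\<^sub>m dx) t h) = f (past s h)"
      by (simp add: ns.emeasure_space_1)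
  qed
  then show ?case using step.IH by simp
qed

lemma distr_past:
  assumes B: "B \<in> carrier_mat dx du" and st: "s \<le> t"
  shows "distr (P B t) (H s s) (past s) = P B s"
proof (rule measure_eqI)
  have m: "past s \<in> P B t \<rightarrow>\<^sub>M H s s"
    using measurable_past[OF st] by (simp add: measurable_trajectory[OF B])
  fix X assume "X \<in> sets (distr (P B t) (H s s) (past s))"
  then have X: "X \<in> sets (H s s)" by simp
  have "emeasure (distr (P B t) (H s s) (past s)) X = (\<integral>\<^sup>+ h. indicator X h \<partial>distr (P B t) (H s s) (past s))"
    using X by simp
  also have "\<dots> = (\<integral>\<^sup>+ h. indicator X (past s h) \<partial>P B t)"
    by (rule nn_integral_distr[OF m]) (use X in simp)
  also have "\<dots> = (\<integral>\<^sup>+ h. indicator X h \<partial>P B s)"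
    by (rule nn_integral_past[OF B _ st]) (use X in simp)
  finally show "emeasure (distr (P B t) (H s s) (past s)) X = emeasure (P B s) X"
    using X by (simp add: sets_trajectory[OF B])
qed (simp add: sets_trajectory[OF B])

text \<open>The noise reconstructed from the history when the input matrix is known. The restriction
  makes it a point of the product space over \<open>{..<dx}\<close>.\<close>

definition noise :: "rmat \<Rightarrow> nat \<Rightarrow> history \<Rightarrow> nat \<Rightarrow> real" where
  "noise B s h = (\<lambda>i\<in>{..<dx}. fst h (Suc s) $ i - (A *\<^sub>v fst h s) $ i - (B *\<^sub>v snd h s) $ i)"

lemma measurable_noise:
  assumes B: "B \<in> carrier_mat dx du" and s: "1 \<le> s" "s < t"
  shows "noise B s \<in> H t t \<rightarrow>\<^sub>M PiM {..<dx} (\<lambda>_. borel)"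
  unfolding noise_def
  by (intro measurable_restrict borel_measurable_diff
      measurable_vec_component'[OF measurable_state] measurable_vec_component'[OF measurable_mult_mat_vec[OF measurable_state A]]
      measurable_vec_component'[OF measurable_mult_mat_vec[OF measurable_input B]]) (use s in auto)

text \<open>Given the history up to time \<open>s\<close>, subtracting the drift returns the
  Gaussian vector that was added, whatever that history is. The product form expresses
  independence.\<close>

lemma nn_integral_noise:
  assumes B: "B \<in> carrier_mat dx du" and s: "1 \<le> s" "s < t"
    and f: "f \<in> borel_measurable (H s s)" and g: "g \<in> borel_measurable (PiM {..<dx} (\<lambda>_. borel))"
  shows "(\<integral>\<^sup>+ h. f (past s h) * g (noise B s h) \<partial>P B t) = (\<integral>\<^sup>+ h. f h \<partial>P B s) * (\<integral>\<^sup>+ z. g z \<partial>std_gauss dx)"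
proof -
  let ?F = "\<lambda>h. f (past s h) * g (noise B s h)"
  have F: "?F \<in> borel_measurable (H (Suc s) (Suc s))"
    using measurable_compose[OF measurable_past f, of "Suc s"] measurable_compose[OF measurable_noise[OF B s(1)] g, of "Suc s"]
    by (intro borel_measurable_times_ennreal) auto
  \<comment> \<open>The integrand depends on the first \<open>s + 1\<close> times only, so the
    horizon can be lowered to \<open>Suc s\<close>, where the noise enters in the last step.\<close>
  have "noise B s (past (Suc s) h) = noise B s h" for h
    using s by (auto simp: noise_def past_def fun_eq_iff)
  then have "(\<integral>\<^sup>+ h. ?F h \<partial>P B t) = (\<integral>\<^sup>+ h. ?F (past (Suc s) h) \<partial>P B t)"
    by (simp add: past_past)
  also have "\<dots> = (\<integral>\<^sup>+ h. ?F h \<partial>P B (Suc s))"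
    by (rule nn_integral_past[OF B F]) (use s in simp)
  also have "\<dots> = (\<integral>\<^sup>+ h. f h * (\<integral>\<^sup>+ z. g z \<partial>std_gauss dx) \<partial>P B s)"
    unfolding nn_integral_trajectory_Suc[OF B F]
  proof (intro nn_integral_cong)
    fix h assume "h \<in> space (P B s)"
    then have h: "h \<in> space (H s s)" by (simp add: space_trajectory[OF B])
    have s0: "s \<noteq> 0" using s by auto
    have hc: "fst h s \<in> carrier_vec dx" "snd h s \<in> carrier_vec du"
      using space_history[OF h, of s] s by auto
    note ns = next_state_prob[OF B h]
    let ?n = "\<lambda>x'. (\<lambda>i\<in>{..<dx}. x' $ i - (A *\<^sub>v fst h s) $ i - (B *\<^sub>v snd h s) $ i)"
    have n: "?n \<in> vec_borel dx \<rightarrow>\<^sub>M PiM {..<dx} (\<lambda>_. borel)"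
      by (intro measurable_restrict borel_measurable_diff measurable_vec_component measurable_const) auto
    have "(\<integral>\<^sup>+ x'. act s ?F h x' \<partial>next_state A B (1\<^sub>m dx) s h) =
       (\<integral>\<^sup>+ x'. f h * g (?n x') \<partial>next_state A B (1\<^sub>m dx) s h)"
    proof (intro nn_integral_cong act_const[OF h])
      fix x' u'
      have "noise B s (push s h x' u') = ?n x'"
        using s by (auto simp: noise_def push_def fun_eq_iff)
      then show "?F (push s h x' u') = f h * g (?n x')"
        by (simp add: past_push past_space[OF h])
    qed (simp add: ns)
    also have "\<dots> = f h * (\<integral>\<^sup>+ x'. g (?n x') \<partial>next_state A B (1\<^sub>m dx) s h)"
      by (rule nn_integral_cmult)
         (use measurable_compose[OF n g] in \<open>simp cong: measurable_cong_sets add: ns\<close>)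
    also have "(\<integral>\<^sup>+ x'. g (?n x') \<partial>next_state A B (1\<^sub>m dx) s h) =
        (\<integral>\<^sup>+ z. g (?n (A *\<^sub>v fst h s + B *\<^sub>v snd h s + Matrix.vec dx z)) \<partial>std_gauss dx)"
      by (rule nn_integral_next_state[OF B s0 h measurable_compose[OF n g]])
    also have "\<dots> = (\<integral>\<^sup>+ z. g z \<partial>std_gauss dx)"
    proof (intro nn_integral_cong arg_cong[where f=g])
      fix z assume "z \<in> space (std_gauss dx)"
      then have z: "z \<in> extensional {..<dx}" by (simp add: std_gauss_def space_PiM PiE_iff)
      show "?n (A *\<^sub>v fst h s + B *\<^sub>v snd h s + Matrix.vec dx z) = z"
        using A B hc by (intro extensionalityI[OF _ z]) auto
    qed
    finally show "(\<integral>\<^sup>+ x'. act s ?F h x' \<partial>next_state A B (1\<^sub>m dx) s h) = f h * (\<integral>\<^sup>+ z. g z \<partial>std_gauss dx)" .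
  qed
  also have "\<dots> = (\<integral>\<^sup>+ h. f h \<partial>P B s) * (\<integral>\<^sup>+ z. g z \<partial>std_gauss dx)"
    by (rule nn_integral_multc) (use f in \<open>simp add: measurable_trajectory[OF B]\<close>)
  finally show ?thesis .
qed

lemma emeasure_past_noise:
  assumes B: "B \<in> carrier_mat dx du" and s: "1 \<le> s" "s < t"
    and X: "X \<in> sets (H s s)" and Y: "Y \<in> sets (PiM {..<dx} (\<lambda>_. borel))"
  shows "emeasure (P B t) {h \<in> space (P B t). past s h \<in> X \<and> noise B s h \<in> Y} =
    emeasure (P B s) X * emeasure (std_gauss dx) Y"
proof -
  have p: "past s \<in> P B t \<rightarrow>\<^sub>M H s s"
    using measurable_past[of s t] s by (simp add: measurable_trajectory[OF B])
  have n: "noise B s \<in> P B t \<rightarrow>\<^sub>M PiM {..<dx} (\<lambda>_. borel)"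
    using measurable_noise[OF B s] by (simp add: measurable_trajectory[OF B])
  have set: "{h \<in> space (P B t). past s h \<in> X \<and> noise B s h \<in> Y} = (past s -` X \<inter> space (P B t)) \<inter> (noise B s -` Y \<inter> space (P B t))"
    by auto
  have "emeasure (P B t) {h \<in> space (P B t). past s h \<in> X \<and> noise B s h \<in> Y} =
     (\<integral>\<^sup>+ h. indicator {h \<in> space (P B t). past s h \<in> X \<and> noise B s h \<in> Y} h \<partial>P B t)"
    unfolding set using measurable_sets[OF p X] measurable_sets[OF n Y] by simp
  also have "\<dots> = (\<integral>\<^sup>+ h. indicator X (past s h) * indicator Y (noise B s h) \<partial>P B t)"
    by (intro nn_integral_cong) (auto simp: indicator_def)
  also have "\<dots> = (\<integral>\<^sup>+ h. indicator X h \<partial>P B s) * (\<integral>\<^sup>+ z. indicator Y z \<partial>std_gauss dx)"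
    by (rule nn_integral_noise[OF B s]) (use X Y in auto)
  finally show ?thesis using X Y by (simp add: sets_trajectory[OF B] sets_std_gauss)
qed

lemma expectation_past_noise:
  assumes B: "B \<in> carrier_mat dx du" and s: "1 \<le> s" "s < t"
    and f: "f \<in> borel_measurable (H s s)" "integrable (P B t) (\<lambda>h. f (past s h))"
    and g: "g \<in> borel_measurable (PiM {..<dx} (\<lambda>_. borel))" "integrable (std_gauss dx) g"
  shows "integrable (P B t) (\<lambda>h. f (past s h) * g (noise B s h) :: real)"
    and "(\<integral>h. f (past s h) * g (noise B s h) \<partial>P B t) = (\<integral>h. f (past s h) \<partial>P B t) * (\<integral>z. g z \<partial>std_gauss dx)"
proof -
  interpret prob_space "P B t" by (rule prob_space_trajectory[OF B])
  interpret Ps: prob_space "P B s" by (rule prob_space_trajectory[OF B])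
  interpret G: prob_space "std_gauss dx" by (rule prob_space_std_gauss)
  let ?N = "PiM {..<dx} (\<lambda>_. borel :: real measure)"
  have p: "past s \<in> P B t \<rightarrow>\<^sub>M H s s"
    using measurable_past[of s t] s by (simp add: measurable_trajectory[OF B])
  have n: "noise B s \<in> P B t \<rightarrow>\<^sub>M ?N"
    using measurable_noise[OF B s] by (simp add: measurable_trajectory[OF B])
  \<comment> \<open>Taking the whole space as the event in the past gives the law of the noise
    alone.\<close>
  have dn: "distr (P B t) ?N (noise B s) = std_gauss dx"
  proof (rule measure_eqI)
    fix Y assume "Y \<in> sets (distr (P B t) ?N (noise B s))"
    then have Y: "Y \<in> sets ?N" by simp
    have "noise B s -` Y \<inter> space (P B t) = {h \<in> space (P B t). past s h \<in> space (H s s) \<and> noise B s h \<in> Y}"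
      using measurable_space[OF p] by auto
    then show "emeasure (distr (P B t) ?N (noise B s)) Y = emeasure (std_gauss dx) Y"
      using emeasure_past_noise[OF B s sets.top Y] Ps.emeasure_space_1 Y
      by (simp add: emeasure_distr[OF n] space_trajectory[OF B])
  qed (simp add: sets_std_gauss)
  have fp: "f \<circ> past s \<in> borel_measurable (P B t)" and gn: "g \<circ> noise B s \<in> borel_measurable (P B t)"
    using measurable_comp[OF p f(1)] measurable_comp[OF n g(1)] by auto
  \<comment> \<open>Signed integrands reduce to the product rule for independent variables;
    independence is a statement about the rectangles measured in
    \<open>emeasure_past_noise\<close>.\<close>
  have iv: "indep_var borel (f \<circ> past s) borel (g \<circ> noise B s)"
    unfolding indep_var_distribution_eq
  proof (intro conjI fp gn)
    show "distr (P B t) borel (f \<circ> past s) \<Otimes>\<^sub>M distr (P B t) borel (g \<circ> noise B s) =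
        distr (P B t) (borel \<Otimes>\<^sub>M borel) (\<lambda>h. ((f \<circ> past s) h, (g \<circ> noise B s) h))"
    proof (rule pair_measure_eqI)
      show "sigma_finite_measure (distr (P B t) borel (f \<circ> past s))" "sigma_finite_measure (distr (P B t) borel (g \<circ> noise B s))"
        using prob_space_distr[OF fp] prob_space_distr[OF gn] by (auto dest: prob_space_imp_sigma_finite)
      fix X Y assume "X \<in> sets (distr (P B t) borel (f \<circ> past s))" "Y \<in> sets (distr (P B t) borel (g \<circ> noise B s))"
      then have X: "X \<in> sets borel" and Y: "Y \<in> sets borel" by auto
      define X' where "X' = f -` X \<inter> space (H s s)"
      define Y' where "Y' = g -` Y \<inter> space ?N"
      have X': "X' \<in> sets (H s s)" and Y': "Y' \<in> sets ?N"
        unfolding X'_def Y'_def using measurable_sets[OF f(1) X] measurable_sets[OF g(1) Y] by auto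
      have 1: "emeasure (distr (P B t) borel (f \<circ> past s)) X = emeasure (P B s) X'"
      proof -
        have "(f \<circ> past s) -` X \<inter> space (P B t) = {h \<in> space (P B t). past s h \<in> X' \<and> noise B s h \<in> space ?N}"
          using measurable_space[OF p] measurable_space[OF n] by (auto simp: X'_def)
        then show ?thesis
          using emeasure_past_noise[OF B s X' sets.top] G.emeasure_space_1 sets_eq_imp_space_eq[OF sets_std_gauss, of dx]
          by (simp add: emeasure_distr[OF fp X])
      qed
      have 2: "emeasure (distr (P B t) borel (g \<circ> noise B s)) Y = emeasure (std_gauss dx) Y'"
      proof -
        have "(g \<circ> noise B s) -` Y \<inter> space (P B t) = noise B s -` Y' \<inter> space (P B t)"
          using measurable_space[OF n] by (auto simp: Y'_def)
        then show ?thesis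
          using emeasure_distr[OF n Y'] dn by (simp add: emeasure_distr[OF gn Y])
      qed
      have 3: "(\<lambda>h. ((f \<circ> past s) h, (g \<circ> noise B s) h)) -` (X \<times> Y) \<inter> space (P B t) =
          {h \<in> space (P B t). past s h \<in> X' \<and> noise B s h \<in> Y'}"
        using measurable_space[OF p] measurable_space[OF n] by (auto simp: X'_def Y'_def)
      show "emeasure (distr (P B t) borel (f \<circ> past s)) X * emeasure (distr (P B t) borel (g \<circ> noise B s)) Y =
          emeasure (distr (P B t) (borel \<Otimes>\<^sub>M borel) (\<lambda>h. ((f \<circ> past s) h, (g \<circ> noise B s) h))) (X \<times> Y)"
        unfolding 1 2 emeasure_past_noise[OF B s X' Y', symmetric] 3[symmetric]
        by (rule emeasure_distr[symmetric], rule measurable_Pair[OF fp gn]) (use X Y in auto)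
    qed (simp cong: sets_pair_measure_cong)
  qed
  have gi: "integrable (P B t) (g \<circ> noise B s)"
    using integrable_distr[OF n, of g] g(2) dn by (simp add: comp_def)
  have fi: "integrable (P B t) (f \<circ> past s)" using f(2) by (simp add: comp_def)
  have "(\<integral>h. g (noise B s h) \<partial>P B t) = (\<integral>z. g z \<partial>std_gauss dx)"
    using integral_distr[OF n g(1)] dn by simp
  then show "(\<integral>h. f (past s h) * g (noise B s h) \<partial>P B t) = (\<integral>h. f (past s h) \<partial>P B t) * (\<integral>z. g z \<partial>std_gauss dx)"
    using indep_var_lebesgue_integral[OF iv fi gi] by (simp add: comp_def)
  show "integrable (P B t) (\<lambda>h. f (past s h) * g (noise B s h))"
    using indep_var_integrable[OF iv fi gi] by (simp add: comp_def)
qed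

end

section \<open>Square-integrable martingale increments\<close>

abbreviation std_normal :: "real measure" where
  "std_normal \<equiv> density lborel std_normal_density"

text \<open>Odd, so the truncated noise stays centred; of slope 1 at 0, so the error is cubic; and
  both the function and its derivative \<open>cos (v / 2)\<close> are bounded.\<close>

definition sine_trunc :: "real \<Rightarrow> real" where
  "sine_trunc v = 2 * sin (v / 2)"

lemma integrable_std_normal_iff:
  fixes g :: "real \<Rightarrow> real"
  assumes [measurable]: "g \<in> borel_measurable borel"
  shows "integrable std_normal g \<longleftrightarrow> integrable lborel (\<lambda>v. std_normal_density v * g v)"
  by (subst integrable_density) auto

lemma integral_std_normal:
  fixes g :: "real \<Rightarrow> real"
  assumes [measurable]: "g \<in> borel_measurable borel"
  shows "(\<integral>v. g v \<partial>std_normal) = (\<integral>v. std_normal_density v * g v \<partial>lborel)"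
  by (subst integral_density) auto

lemma std_normal_power:
  shows "integrable std_normal (\<lambda>v. v ^ k)"
  using integrable_std_normal_moment[of k] by (simp add: integrable_std_normal_iff)

lemma std_normal_mean: "(\<integral>v. v \<partial>std_normal) = 0"
  using integral_std_normal_moment_odd[of 0] by (simp add: integral_std_normal)

lemma std_normal_second: "(\<integral>v. v\<^sup>2 \<partial>std_normal) = 1"
  using integral_std_normal_moment_even[of 1] by (simp add: integral_std_normal)

lemma std_normal_sixth: "(\<integral>v. v ^ 6 \<partial>std_normal) = 15"
  using integral_std_normal_moment_even[of 3] by (simp add: integral_std_normal fact_numeral)

lemma integral_std_normal_odd:
  fixes g :: "real \<Rightarrow> real"
  assumes [measurable]: "g \<in> borel_measurable borel" and "\<And>v. g (- v) = - g v"
  shows "(\<integral>v. g v \<partial>std_normal) = 0"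
proof -
  have "(\<integral>v. std_normal_density v * g v \<partial>lborel) = (\<integral>v. std_normal_density (- v) * g (- v) \<partial>lborel)"
    using lborel_integral_real_affine[of "-1" "\<lambda>v. std_normal_density v * g v" 0] by simp
  also have "\<dots> = - (\<integral>v. std_normal_density v * g v \<partial>lborel)"
    by (simp add: assms std_normal_density_def)
  finally show ?thesis by (simp add: integral_std_normal)
qed

lemma sine_trunc_bounds: "\<bar>sine_trunc v\<bar> \<le> 2" "\<bar>sine_trunc v\<bar> \<le> \<bar>v\<bar>"
  using abs_sin_le_one[of "v / 2"] abs_sin_x_le_abs_x[of "v / 2"] by (auto simp: sine_trunc_def abs_mult)

lemma sine_trunc_measurable [measurable]: "sine_trunc \<in> borel_measurable borel"
  unfolding sine_trunc_def by measurable

lemma sine_trunc_minus: "sine_trunc (- v) = - sine_trunc v"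
  by (simp add: sine_trunc_def)

lemma sine_trunc_diff: "(v - sine_trunc v)\<^sup>2 \<le> v ^ 6 / 576"
proof -
  have "\<bar>sin (v / 2) - v / 2\<bar> \<le> \<bar>v / 2\<bar> ^ 3 / 6"
  proof -
    have *: "(\<Sum>m<Suc (Suc (Suc 0)). sin_coeff m * (v / 2) ^ m) = v / 2"
      by (simp add: sin_coeff_def)
    have f: "fact (Suc (Suc (Suc 0))) = (6 :: real)" by simp
    show ?thesis
      using Maclaurin_sin_bound[of "v / 2" "Suc (Suc (Suc 0))"] unfolding * f
      by (simp only: numeral_3_eq_3 divide_inverse mult.commute)
  qed
  moreover have "\<bar>v - sine_trunc v\<bar> = 2 * \<bar>sin (v / 2) - v / 2\<bar>"
  proof -
    have "v - sine_trunc v = - 2 * (sin (v / 2) - v / 2)"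
      by (simp add: sine_trunc_def right_diff_distrib)
    then have "\<bar>v - sine_trunc v\<bar> = \<bar>- 2\<bar> * \<bar>sin (v / 2) - v / 2\<bar>" by (simp only: abs_mult)
    then show ?thesis by simp
  qed
  ultimately have "\<bar>v - sine_trunc v\<bar> \<le> \<bar>v\<bar> ^ 3 / 24"
    by (simp add: power_divide)
  then have "\<bar>v - sine_trunc v\<bar>\<^sup>2 \<le> (\<bar>v\<bar> ^ 3 / 24)\<^sup>2"
    by (rule power_mono) simp
  also have "\<dots> = v ^ 6 / 576"
    by (simp add: power_divide power_mult_distrib power_even_abs flip: power_mult)
  finally show ?thesis by simp
qed

text \<open>Oddness gives the means. The constant 1/32 comes from the sixth moment: 15/576 lies just
  below it.\<close>

lemma std_normal_sine_trunc:
  shows "(\<integral>v. sine_trunc v \<partial>std_normal) = 0"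
    and "integrable std_normal (\<lambda>v. (sine_trunc v)\<^sup>2)"
    and "(\<integral>v. (sine_trunc v)\<^sup>2 \<partial>std_normal) \<le> 1"
    and "(\<integral>v. v - sine_trunc v \<partial>std_normal) = 0"
    and "integrable std_normal (\<lambda>v. (v - sine_trunc v)\<^sup>2)"
    and "(\<integral>v. (v - sine_trunc v)\<^sup>2 \<partial>std_normal) \<le> 1 / 32"
proof -
  show "(\<integral>v. sine_trunc v \<partial>std_normal) = 0" "(\<integral>v. v - sine_trunc v \<partial>std_normal) = 0"
    by (rule integral_std_normal_odd; simp add: sine_trunc_minus)+
  have le: "(sine_trunc v)\<^sup>2 \<le> v\<^sup>2" for v
    using sine_trunc_bounds(2) by (simp add: abs_le_square_iff)
  show 1: "integrable std_normal (\<lambda>v. (sine_trunc v)\<^sup>2)"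
    by (rule Bochner_Integration.integrable_bound[OF std_normal_power[of 2]]) (use le in auto)
  show "(\<integral>v. (sine_trunc v)\<^sup>2 \<partial>std_normal) \<le> 1"
    using integral_mono[OF 1 std_normal_power[of 2] le] by (simp add: std_normal_second)
  show 2: "integrable std_normal (\<lambda>v. (v - sine_trunc v)\<^sup>2)"
    by (rule Bochner_Integration.integrable_bound[OF integrable_divide[OF std_normal_power[of 6], of 576]])
       (use sine_trunc_diff in auto)
  have "(\<integral>v. (v - sine_trunc v)\<^sup>2 \<partial>std_normal) \<le> (\<integral>v. v ^ 6 / 576 \<partial>std_normal)"
    by (rule integral_mono[OF 2 integrable_divide[OF std_normal_power[of 6]] sine_trunc_diff])
  then show "(\<integral>v. (v - sine_trunc v)\<^sup>2 \<partial>std_normal) \<le> 1 / 32"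
    by (simp add: std_normal_sixth)
qed

lemma std_gauss_component:
  fixes g :: "real \<Rightarrow> real"
  assumes i: "i < n" and g: "g \<in> borel_measurable borel" "integrable std_normal g"
  shows "integrable (std_gauss n) (\<lambda>z. g (z i))" and "(\<integral>z. g (z i) \<partial>std_gauss n) = (\<integral>v. g v \<partial>std_normal)"
proof -
  interpret product_prob_space "\<lambda>_. std_normal" "{..<n}" by unfold_locales
  have d: "distr (std_gauss n) std_normal (\<lambda>z. z i) = std_normal"
    unfolding std_gauss_def using PiM_component[of i] i by simp
  have m: "(\<lambda>z. z i) \<in> std_gauss n \<rightarrow>\<^sub>M std_normal"
    using measurable_std_gauss_component[OF i] by simp
  have gm: "g \<in> borel_measurable std_normal" using g by simp
  show "integrable (std_gauss n) (\<lambda>z. g (z i))"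
    using integrable_distr_eq[OF m gm] g(2) d by simp
  show "(\<integral>z. g (z i) \<partial>std_gauss n) = (\<integral>v. g v \<partial>std_normal)"
    using integral_distr[OF m gm] d by simp
qed

lemma std_gauss_two_components:
  fixes g g' :: "real \<Rightarrow> real"
  assumes ik: "i < n" "k < n" "i \<noteq> k" and g: "integrable std_normal g" and g': "integrable std_normal g'"
  shows "integrable (std_gauss n) (\<lambda>z. g (z i) * g' (z k))"
    and "(\<integral>z. g (z i) * g' (z k) \<partial>std_gauss n) = (\<integral>v. g v \<partial>std_normal) * (\<integral>v. g' v \<partial>std_normal)"
proof -
  \<comment> \<open>Padding with the constant 1 turns the two factors into a product over all
    coordinates, to which their independence applies.\<close>
  define f where "f = (\<lambda>l. if l = i then g else if l = k then g' else (\<lambda>_. 1))"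
  have f: "integrable std_normal (f l)" for l
    using g g' by (simp add: f_def)
  have p: "(\<Prod>l<n. F l) = F i * F k" if "\<And>l. l \<noteq> i \<Longrightarrow> l \<noteq> k \<Longrightarrow> F l = 1" for F :: "nat \<Rightarrow> real"
  proof -
    have "(\<Prod>l<n. F l) = prod F {i, k}"
      by (rule prod.mono_neutral_right) (use ik that in auto)
    then show ?thesis using ik by simp
  qed
  have eq: "(\<Prod>l<n. f l (z l)) = g (z i) * g' (z k)" for z
    by (subst p) (use ik in \<open>auto simp: f_def\<close>)
  show "integrable (std_gauss n) (\<lambda>z. g (z i) * g' (z k))"
    using std_normal_PiM.product_integrable_prod[of "{..<n}" f] f unfolding eq std_gauss_def by simp
  have "(\<integral>z. g (z i) * g' (z k) \<partial>std_gauss n) = (\<Prod>l<n. \<integral>v. f l v \<partial>std_normal)"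
    using std_normal_PiM.product_integral_prod[of "{..<n}" f] f unfolding eq std_gauss_def by simp
  also have "\<dots> = (\<integral>v. g v \<partial>std_normal) * (\<integral>v. g' v \<partial>std_normal)"
    by (subst p) (use ik std_normal.prob_space in \<open>auto simp: f_def\<close>)
  finally show "(\<integral>z. g (z i) * g' (z k) \<partial>std_gauss n) = (\<integral>v. g v \<partial>std_normal) * (\<integral>v. g' v \<partial>std_normal)" .
qed

section \<open>Square-integrable functions\<close>

definition (in prob_space) square_integrable :: "('a \<Rightarrow> real) \<Rightarrow> bool" where
  "square_integrable f \<longleftrightarrow> f \<in> borel_measurable M \<and> integrable M (\<lambda>h. (f h)\<^sup>2)"

context prob_space
begin

lemma square_integrable_mult:
  assumes "square_integrable f" "square_integrable g"
  shows "integrable M (\<lambda>h. f h * g h)"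
proof (rule Bochner_Integration.integrable_bound)
  show "integrable M (\<lambda>h. (f h)\<^sup>2 + (g h)\<^sup>2)"
    using assms by (auto simp: square_integrable_def)
  show "(\<lambda>h. f h * g h) \<in> borel_measurable M"
    using assms by (auto simp: square_integrable_def)
  have "\<bar>a * b\<bar> \<le> a\<^sup>2 + b\<^sup>2" for a b :: real
  proof -
    have "0 \<le> \<bar>a\<bar> * \<bar>b\<bar>" by simp
    then show ?thesis
      using sum_squares_bound[of "\<bar>a\<bar>" "\<bar>b\<bar>"] unfolding abs_mult power2_abs by linarith
  qed
  then show "AE h in M. norm (f h * g h) \<le> norm ((f h)\<^sup>2 + (g h)\<^sup>2)"
    by auto
qed

lemma square_integrable_const: "square_integrable (\<lambda>_. c)"
  by (simp add: square_integrable_def)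

lemma square_integrable_integrable: "square_integrable f \<Longrightarrow> integrable M f"
  using square_integrable_mult[OF _ square_integrable_const[of 1], of f] by simp

lemma square_integrable_bound:
  assumes g: "square_integrable g" and f: "f \<in> borel_measurable M" and le: "\<And>h. \<bar>f h\<bar> \<le> C * \<bar>g h\<bar>"
  shows "square_integrable f"
  unfolding square_integrable_def
proof (rule conjI[OF f], rule Bochner_Integration.integrable_bound)
  show "integrable M (\<lambda>h. C\<^sup>2 * (g h)\<^sup>2)"
    using g by (auto simp: square_integrable_def)
  have "(f h)\<^sup>2 \<le> (C * \<bar>g h\<bar>)\<^sup>2" for h
    using power_mono[OF le[of h] abs_ge_zero, of 2] by simp
  then show "AE h in M. norm ((f h)\<^sup>2) \<le> norm (C\<^sup>2 * (g h)\<^sup>2)"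
    by (simp add: power_mult_distrib)
qed (use f in measurable)

lemma square_integrable_add:
  assumes "square_integrable f" "square_integrable g"
  shows "square_integrable (\<lambda>h. f h + g h)"
  using assms square_integrable_mult[OF assms]
  by (auto simp: square_integrable_def power2_sum mult.assoc)

lemma square_integrable_cmult: "square_integrable f \<Longrightarrow> square_integrable (\<lambda>h. c * f h)"
  by (auto simp: square_integrable_def power_mult_distrib)

lemma square_integrable_diff:
  assumes "square_integrable f" "square_integrable g"
  shows "square_integrable (\<lambda>h. f h - g h)"
  using square_integrable_add[OF assms(1) square_integrable_cmult[OF assms(2), of "-1"]] by simp

lemma square_integrable_divide: "square_integrable f \<Longrightarrow> square_integrable (\<lambda>h. f h / c)"
  using square_integrable_cmult[of f "inverse c"] by (simp add: divide_inverse mult.commute)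

lemma square_integrable_sum:
  "(\<And>i. i \<in> I \<Longrightarrow> square_integrable (f i)) \<Longrightarrow> square_integrable (\<lambda>h. \<Sum>i\<in>I. f i h)"
  by (induction I rule: infinite_finite_induct) (auto intro: square_integrable_const square_integrable_add)

end

text \<open>\<open>adapted t\<close> stands for measurability with respect to the past up to time \<open>t\<close>, and \<open>w t\<close> is the noise
  between the times \<open>t\<close> and \<open>t + 1\<close>, which this past does not contain.\<close>

locale adapted_process = prob_space M for M :: "'a measure" +
  fixes adapted :: "nat \<Rightarrow> ('a \<Rightarrow> real) \<Rightarrow> bool" and dx T :: nat and w :: "nat \<Rightarrow> nat \<Rightarrow> 'a \<Rightarrow> real"
  assumes adapted_measurable: "t < T \<Longrightarrow> adapted t f \<Longrightarrow> f \<in> borel_measurable M"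
    and adapted_const: "adapted t (\<lambda>_. c)"
    and adapted_add: "adapted t f \<Longrightarrow> adapted t g \<Longrightarrow> adapted t (\<lambda>h. f h + g h)"
    and adapted_mult: "adapted t f \<Longrightarrow> adapted t g \<Longrightarrow> adapted t (\<lambda>h. f h * g h)"
    and adapted_compose: "\<phi> \<in> borel_measurable borel \<Longrightarrow> adapted t f \<Longrightarrow> adapted t (\<lambda>h. \<phi> (f h))"
    and adapted_Suc: "Suc t < T \<Longrightarrow> adapted t f \<Longrightarrow> adapted (Suc t) f"
    and w_adapted: "Suc t < T \<Longrightarrow> i < dx \<Longrightarrow> adapted (Suc t) (w t i)"
    and w_indep: "Suc t < T \<Longrightarrow> adapted t f \<Longrightarrow> integrable M f \<Longrightarrow> \<psi> \<in> borel_measurable (PiM {..<dx} (\<lambda>_. borel)) \<Longrightarrow>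
       integrable (std_gauss dx) \<psi> \<Longrightarrow> integrable M (\<lambda>h. f h * \<psi> (\<lambda>i\<in>{..<dx}. w t i h)) \<and>
       (\<integral>h. f h * \<psi> (\<lambda>i\<in>{..<dx}. w t i h) \<partial>M) = (\<integral>h. f h \<partial>M) * (\<integral>z. \<psi> z \<partial>std_gauss dx)"
begin

lemma adapted_divide: "adapted t f \<Longrightarrow> adapted t (\<lambda>h. f h / c)"
  using adapted_mult[OF _ adapted_const[of t "inverse c"], of f] by (simp add: divide_inverse)

lemma adapted_diff: "adapted t f \<Longrightarrow> adapted t g \<Longrightarrow> adapted t (\<lambda>h. f h - g h)"
  using adapted_add[OF _ adapted_mult[OF adapted_const[of t "-1"]], of f g] by simp

lemma adapted_sum: "(\<And>i. i \<in> I \<Longrightarrow> adapted t (f i)) \<Longrightarrow> adapted t (\<lambda>h. \<Sum>i\<in>I. f i h)"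
  by (induction I rule: infinite_finite_induct) (auto intro: adapted_const adapted_add)

lemmas adapted_intros = adapted_const adapted_add adapted_mult adapted_divide adapted_diff adapted_sum

lemma component_measurable:
  "i < dx \<Longrightarrow> g \<in> borel_measurable borel \<Longrightarrow> (\<lambda>z. g (z i)) \<in> borel_measurable (PiM {..<dx} (\<lambda>_. borel :: real measure))"
  by (rule measurable_compose[OF measurable_component_singleton]) auto

lemma w_component:
  fixes g :: "real \<Rightarrow> real"
  assumes "Suc t < T" "adapted t f" "integrable M f" "i < dx" "g \<in> borel_measurable borel" "integrable std_normal g"
  shows "integrable M (\<lambda>h. f h * g (w t i h))"
    and "(\<integral>h. f h * g (w t i h) \<partial>M) = (\<integral>h. f h \<partial>M) * (\<integral>v. g v \<partial>std_normal)"
  using w_indep[OF assms(1-3) component_measurable[OF assms(4,5)] std_gauss_component(1)[OF assms(4-6)]]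
    std_gauss_component(2)[OF assms(4-6)] assms(4) by auto

lemma w_two_components:
  fixes g g' :: "real \<Rightarrow> real"
  assumes "Suc t < T" "adapted t f" "integrable M f" "i < dx" "k < dx" "i \<noteq> k" "integrable std_normal g" "integrable std_normal g'"
  shows "integrable M (\<lambda>h. f h * (g (w t i h) * g' (w t k h)))"
    and "(\<integral>h. f h * (g (w t i h) * g' (w t k h)) \<partial>M) = (\<integral>h. f h \<partial>M) * ((\<integral>v. g v \<partial>std_normal) * (\<integral>v. g' v \<partial>std_normal))"
proof -
  have g: "g \<in> borel_measurable borel" "g' \<in> borel_measurable borel"
    using borel_measurable_integrable[OF assms(7)] borel_measurable_integrable[OF assms(8)] by auto
  have m: "(\<lambda>z. g (z i) * g' (z k)) \<in> borel_measurable (PiM {..<dx} (\<lambda>_. borel))"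
    by (intro borel_measurable_times component_measurable assms g)
  note * = w_indep[OF assms(1-3) m std_gauss_two_components(1)[OF assms(4-8)]] std_gauss_two_components(2)[OF assms(4-8)]
  show "integrable M (\<lambda>h. f h * (g (w t i h) * g' (w t k h)))"
    "(\<integral>h. f h * (g (w t i h) * g' (w t k h)) \<partial>M) = (\<integral>h. f h \<partial>M) * ((\<integral>v. g v \<partial>std_normal) * (\<integral>v. g' v \<partial>std_normal))"
    using * assms(4,5) by auto
qed

text \<open>The increment is centred given the past and its coordinates are independent, so every
  cross term vanishes. This Pythagorean identity for one martingale step drives the energy
  recursions below.\<close>

lemma noise_square:
  fixes g :: "real \<Rightarrow> real"
  assumes t: "Suc t < T" and a: "adapted t a" "square_integrable a"
    and f: "\<And>i. i < dx \<Longrightarrow> adapted t (f i)" "\<And>i. i < dx \<Longrightarrow> square_integrable (f i)"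
    and g: "g \<in> borel_measurable borel" "(\<integral>v. g v \<partial>std_normal) = 0" "integrable std_normal (\<lambda>v. (g v)\<^sup>2)"
    and I: "I \<subseteq> {..<dx}"
  shows "square_integrable (\<lambda>h. a h + (\<Sum>i\<in>I. f i h * g (w t i h)))"
    and "(\<integral>h. (a h + (\<Sum>i\<in>I. f i h * g (w t i h)))\<^sup>2 \<partial>M) =
       (\<integral>h. (a h)\<^sup>2 \<partial>M) + (\<integral>v. (g v)\<^sup>2 \<partial>std_normal) * (\<Sum>i\<in>I. \<integral>h. (f i h)\<^sup>2 \<partial>M)"
proof -
  have fin: "finite I" and I': "i \<in> I \<Longrightarrow> i < dx" for i using I finite_subset by auto
  have tT: "t < T" using t by simp
  have gi: "integrable std_normal g"
    using std_normal.square_integrable_integrable[unfolded std_normal.square_integrable_def, of g] g by simp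
  let ?v = "\<integral>v. (g v)\<^sup>2 \<partial>std_normal"
  let ?c = "\<lambda>i k h. (f i h * g (w t i h)) * (f k h * g (w t k h))"
  have cross: "integrable M (\<lambda>h. a h * (f i h * g (w t i h))) \<and> (\<integral>h. a h * (f i h * g (w t i h)) \<partial>M) = 0" if i: "i \<in> I" for i
    using w_component[OF t adapted_mult[OF a(1) f(1)] square_integrable_mult[OF a(2) f(2)] I'[OF i] g(1) gi] I'[OF i] g(2)
    by (simp add: mult.assoc)
  have sq: "integrable M (?c i k) \<and> (\<integral>h. ?c i k h \<partial>M) = (if i = k then ?v * (\<integral>h. (f i h)\<^sup>2 \<partial>M) else 0)"
    if i: "i \<in> I" and k: "k \<in> I" for i k
  proof (cases "i = k")
    case True
    have eq: "?c i i = (\<lambda>h. (f i h * f i h) * (g (w t i h))\<^sup>2)" by (simp add: fun_eq_iff power2_eq_square)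
    have m: "(\<lambda>v. (g v)\<^sup>2) \<in> borel_measurable borel" using g(1) by measurable
    show ?thesis unfolding True[symmetric] eq
      using w_component[OF t adapted_mult[OF f(1) f(1)] square_integrable_mult[OF f(2) f(2)] I'[OF i] m g(3)] I'[OF i]
      by (simp add: power2_eq_square)
  next
    case False
    have eq: "?c i k = (\<lambda>h. (f i h * f k h) * (g (w t i h) * g (w t k h)))" by (simp add: fun_eq_iff)
    show ?thesis unfolding eq
      using w_two_components[OF t adapted_mult[OF f(1) f(1)] square_integrable_mult[OF f(2) f(2)] I'[OF i] I'[OF k] False gi gi]
        I'[OF i] I'[OF k] False g(2)
      by simp
  qed
  have expand: "(a h + (\<Sum>i\<in>I. f i h * g (w t i h)))\<^sup>2 =
     (a h)\<^sup>2 + 2 * (\<Sum>i\<in>I. a h * (f i h * g (w t i h))) + (\<Sum>i\<in>I. \<Sum>k\<in>I. ?c i k h)" for h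
    by (simp add: power2_sum sum_product sum_distrib_left[symmetric] power2_eq_square[of "sum _ _"])
  have i1: "integrable M (\<lambda>h. (a h)\<^sup>2)" using a by (simp add: square_integrable_def)
  have i2: "integrable M (\<lambda>h. \<Sum>i\<in>I. a h * (f i h * g (w t i h)))" using cross by auto
  have i3: "integrable M (\<lambda>h. \<Sum>i\<in>I. \<Sum>k\<in>I. ?c i k h)" using sq by (auto intro!: Bochner_Integration.integrable_sum)
  have wm: "w t i \<in> borel_measurable M" if "i < dx" for i
    using adapted_measurable[OF t w_adapted[OF t that]] .
  show "square_integrable (\<lambda>h. a h + (\<Sum>i\<in>I. f i h * g (w t i h)))"
    unfolding square_integrable_def expand
  proof (intro conjI)
    show "(\<lambda>h. a h + (\<Sum>i\<in>I. f i h * g (w t i h))) \<in> borel_measurable M"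
      using f(1) I' wm measurable_compose[OF wm g(1)]
      by (intro borel_measurable_add borel_measurable_sum borel_measurable_times)
         (auto intro: adapted_measurable[OF tT] a)
  qed (use i1 i2 i3 in simp)
  have "(\<integral>h. (a h + (\<Sum>i\<in>I. f i h * g (w t i h)))\<^sup>2 \<partial>M) =
     (\<integral>h. (a h)\<^sup>2 \<partial>M) + 2 * (\<Sum>i\<in>I. \<integral>h. a h * (f i h * g (w t i h)) \<partial>M) + (\<Sum>i\<in>I. \<Sum>k\<in>I. \<integral>h. ?c i k h \<partial>M)"
    unfolding expand using i1 i2 i3 cross sq
    by (simp add: Bochner_Integration.integral_sum)
  also have "(\<Sum>i\<in>I. \<integral>h. a h * (f i h * g (w t i h)) \<partial>M) = 0" using cross by simp
  also have "(\<Sum>i\<in>I. \<Sum>k\<in>I. \<integral>h. ?c i k h \<partial>M) = (\<Sum>i\<in>I. \<Sum>k\<in>I. if i = k then ?v * (\<integral>h. (f i h)\<^sup>2 \<partial>M) else 0)"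
    using sq by (intro sum.cong) auto
  also have "\<dots> = ?v * (\<Sum>i\<in>I. \<integral>h. (f i h)\<^sup>2 \<partial>M)"
    using fin by (simp add: sum.delta' sum_distrib_left)
  finally show "(\<integral>h. (a h + (\<Sum>i\<in>I. f i h * g (w t i h)))\<^sup>2 \<partial>M) =
       (\<integral>h. (a h)\<^sup>2 \<partial>M) + ?v * (\<Sum>i\<in>I. \<integral>h. (f i h)\<^sup>2 \<partial>M)" by simp
qed

end

section \<open>Lower bound on the cost for a fixed instance\<close>

text \<open>For \<open>w = y - b u\<close>, the derivative in \<open>b\<close> of \<open>trunc_noise w k\<close> is \<open>- sensitivity w u k\<close>, and that of the
  Gaussian log-likelihood is \<open>score w u k\<close>; hence \<open>stein_factor w u k\<close> times the likelihood is the derivative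
  of \<open>trunc_noise w k\<close> times the likelihood.\<close>

primrec trunc_noise :: "(nat \<Rightarrow> real) \<Rightarrow> nat \<Rightarrow> real" where
  "trunc_noise w 0 = 0"
| "trunc_noise w (Suc k) = trunc_noise w k / 2 + sine_trunc (w k)"

primrec score :: "(nat \<Rightarrow> real) \<Rightarrow> (nat \<Rightarrow> real) \<Rightarrow> nat \<Rightarrow> real" where
  "score w u 0 = 0"
| "score w u (Suc k) = score w u k + w k * u k"

primrec sensitivity :: "(nat \<Rightarrow> real) \<Rightarrow> (nat \<Rightarrow> real) \<Rightarrow> nat \<Rightarrow> real" where
  "sensitivity w u 0 = 0"
| "sensitivity w u (Suc k) = sensitivity w u k / 2 + u k * cos (w k / 2)"

definition stein_factor :: "(nat \<Rightarrow> real) \<Rightarrow> (nat \<Rightarrow> real) \<Rightarrow> nat \<Rightarrow> real" where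
  "stein_factor w u k = trunc_noise w k * score w u k - sensitivity w u k"

text \<open>Besides the contraction by 1/2 there are a centred increment, orthogonal over the rows
  of \<open>B\<close>, and a term proportional to the current input. Summed over the rows, the first
  costs a factor \<open>dx\<close> in energy, the second a factor \<open>dx\<^sup>2\<close>.\<close>

lemma stein_factor_Suc:
  "stein_factor w u (Suc k) = stein_factor w u k / 2 + score w u k * sine_trunc (w k)
     + u k * (trunc_noise w k / 2 * w k + sine_trunc (w k) * w k - cos (w k / 2))"
  by (simp add: stein_factor_def algebra_simps diff_divide_distrib)

text \<open>4 is the fixed point of \<open>a / 2 + 2\<close>.\<close>

lemma trunc_noise_bound: "\<bar>trunc_noise w k\<bar> \<le> 4"
proof (induction k)
  case (Suc k)
  then show ?case using sine_trunc_bounds(1)[of "w k"] by simp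
qed simp

text \<open>A crude bound without decay. It serves integrability only, so its constant is
  immaterial.\<close>

lemma sensitivity_bound: "(sensitivity w u k)\<^sup>2 \<le> 2 * (\<Sum>q<k. (u q)\<^sup>2)"
proof (induction k)
  case (Suc k)
  let ?s = "sensitivity w u k" and ?c = "u k * cos (w k / 2)"
  have "?c\<^sup>2 \<le> (u k)\<^sup>2 * 1"
    unfolding power_mult_distrib by (intro mult_left_mono) (auto simp: abs_square_le_1)
  moreover have "(?s / 2 + ?c)\<^sup>2 \<le> ?s\<^sup>2 + 2 * ?c\<^sup>2"
    using zero_le_power2[of "?s - ?c"] zero_le_power2[of ?s] zero_le_power2[of "?s / 2 - ?c"]
    by (simp add: power2_eq_square field_simps) (smt (verit) zero_le_square mult.commute)
  ultimately show ?case using Suc by simp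
qed simp

section \<open>Linear recursions with factors 1/4 and 1/2\<close>

text \<open>The weight of time \<open>t\<close> in the total energy of a recursion with factor \<open>1/4\<close>, when \<open>n\<close> steps remain.\<close>

definition discount_weight :: "nat \<Rightarrow> real" where
  "discount_weight n = 4 / 3 * (1 - (1 / 4) ^ n)"

lemma discount_weight_bounds: "0 \<le> discount_weight n" "discount_weight n \<le> 4 / 3"
  using power_le_one[of "1/4 :: real" n] by (auto simp: discount_weight_def)

text \<open>Unrolling and exchanging the two sums: an increment at time \<open>k\<close> is counted
  with the geometric weights of the remaining \<open>n - k\<close> steps. Both claims share one
  induction, since the new total needs the closed form of \<open>D\<close>.\<close>

lemma sum_quarter_recursion:
  fixes D e :: "nat \<Rightarrow> real"
  assumes "D 0 = 0" and "\<And>k. k < n \<Longrightarrow> D (Suc k) = D k / 4 + e k"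
  shows "D n = (\<Sum>k<n. (1 / 4) ^ (n - Suc k) * e k)"
    and "(\<Sum>k<Suc n. D k) = (\<Sum>k<n. discount_weight (n - k) * e k)"
proof -
  have "D n = (\<Sum>k<n. (1 / 4) ^ (n - Suc k) * e k) \<and> (\<Sum>k<Suc n. D k) = (\<Sum>k<n. discount_weight (n - k) * e k)"
    using assms
  proof (induction n)
    case 0
    then show ?case by simp
  next
    case (Suc n)
    then have IH: "D n = (\<Sum>k<n. (1 / 4) ^ (n - Suc k) * e k)" "(\<Sum>k<Suc n. D k) = (\<Sum>k<n. discount_weight (n - k) * e k)"
      by auto
    have "(\<Sum>k<n. (1 / 4) ^ (n - Suc k) * e k) / 4 = (\<Sum>k<n. (1 / 4) ^ (n - k) * e k)"
      unfolding sum_divide_distrib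
    proof (intro sum.cong refl)
      fix k assume "k \<in> {..<n}"
      then have "n - k = Suc (n - Suc k)" by auto
      then show "(1 / 4) ^ (n - Suc k) * e k / 4 = (1 / 4) ^ (n - k) * e k" by simp
    qed
    then have D: "D (Suc n) = (\<Sum>k<Suc n. (1 / 4) ^ (n - k) * e k)"
      using Suc.prems(2)[of n] IH(1) by simp
    have "discount_weight (Suc n - k) = discount_weight (n - k) + (1 / 4) ^ (n - k)" if "k \<le> n" for k
      using that by (simp add: discount_weight_def Suc_diff_le field_simps)
    then have "(\<Sum>k<Suc n. discount_weight (Suc n - k) * e k) =
        (\<Sum>k<Suc n. discount_weight (n - k) * e k + (1 / 4) ^ (n - k) * e k)"
      by (intro sum.cong refl) (auto simp: ring_distribs)
    also have "\<dots> = (\<Sum>k<n. discount_weight (n - k) * e k) + D (Suc n)"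
      unfolding D by (simp add: sum.distrib discount_weight_def)
    finally show ?case using D IH by simp
  qed
  then show "D n = (\<Sum>k<n. (1 / 4) ^ (n - Suc k) * e k)"
    "(\<Sum>k<Suc n. D k) = (\<Sum>k<n. discount_weight (n - k) * e k)" by auto
qed

text \<open>Every step weighs 4/3 up to a geometric error; the deficit 16/9 is the price of starting
  at rest. The main term is written with \<open>Suc n\<close>, the number of states in the
  horizon.\<close>

lemma sum_discount_weight: "(\<Sum>k<n. discount_weight (n - k)) \<ge> 4 / 3 * real (Suc n) - 16 / 9"
proof -
  have "(\<Sum>k<n. discount_weight (n - k)) = 4 / 3 * real (Suc n) - 16 / 9 + 4 / 9 * (1 / 4) ^ n"
  proof (induction n)
    case (Suc n)
    have "(\<Sum>k<Suc n. discount_weight (Suc n - k)) = discount_weight (Suc n) + (\<Sum>k<n. discount_weight (n - k))"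
      by (subst sum.lessThan_Suc_shift) simp
    then show ?case using Suc by (simp add: discount_weight_def field_simps)
  qed simp
  then show ?thesis by simp
qed

lemma sum_half_recursion:
  fixes z c :: "nat \<Rightarrow> real"
  assumes "z 0 \<le> 0" and "\<And>k. k < n \<Longrightarrow> z (Suc k) \<le> z k / 2 + c k" and "\<And>k. k \<le> n \<Longrightarrow> 0 \<le> z k"
  shows "(\<Sum>k<Suc n. z k) \<le> 2 * (\<Sum>k<n. c k)"
proof -
  \<comment> \<open>The factor 2 on the last term closes the induction: 2 is the total of 1, 1/2,
    1/4 and so on, by which \<open>z n\<close> still contributes later.\<close>
  have "(\<Sum>k<n. z k) + 2 * z n \<le> 2 * (\<Sum>k<n. c k)"
    using assms
  proof (induction n)
    case (Suc n)
    then have "(\<Sum>k<n. z k) + 2 * z n \<le> 2 * (\<Sum>k<n. c k)" by simp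
    then show ?case using Suc.prems(2)[of n] by simp
  qed simp
  then show ?thesis using assms(3)[of n] by simp
qed

lemma sum_weighted_square_le:
  fixes a r :: "nat \<Rightarrow> real"
  assumes "\<And>i. i < n \<Longrightarrow> \<bar>a i\<bar> \<le> e"
  shows "(\<Sum>i<n. a i * r i)\<^sup>2 \<le> real n * e\<^sup>2 * (\<Sum>i<n. (r i)\<^sup>2)"
proof -
  have "(\<Sum>i<n. a i * r i)\<^sup>2 \<le> (\<Sum>i<n. (a i)\<^sup>2) * (\<Sum>i<n. (r i)\<^sup>2)"
    by (rule Cauchy_Schwarz_ineq_sum)
  also have "\<dots> \<le> (\<Sum>i<n. e\<^sup>2) * (\<Sum>i<n. (r i)\<^sup>2)"
  proof (intro mult_right_mono sum_mono sum_nonneg)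
    fix i assume "i \<in> {..<n}"
    then show "(a i)\<^sup>2 \<le> e\<^sup>2" using assms[of i] by (simp add: abs_le_square_iff[symmetric] order_trans[OF _ abs_ge_self])
  qed auto
  finally show ?thesis by simp
qed

section \<open>State energy and its correlation with the inputs\<close>

locale lqr_process = adapted_process +
  fixes du :: nat and x u :: "nat \<Rightarrow> nat \<Rightarrow> 'a \<Rightarrow> real" and b :: "nat \<Rightarrow> nat \<Rightarrow> real"
  assumes x_adapted: "t < T \<Longrightarrow> i < dx \<Longrightarrow> adapted t (x t i)"
    and u_adapted: "t < T \<Longrightarrow> j < du \<Longrightarrow> adapted t (u t j)"
    and x_Suc: "Suc t < T \<Longrightarrow> i < dx \<Longrightarrow> x (Suc t) i h = x t i h / 2 + (\<Sum>j<du. b i j * u t j h) + w t i h"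
    and x_square: "t < T \<Longrightarrow> i < dx \<Longrightarrow> square_integrable (x t i)"
    and u_square: "t < T \<Longrightarrow> j < du \<Longrightarrow> square_integrable (u t j)"
begin

abbreviation energy :: "('a \<Rightarrow> real) \<Rightarrow> real" where
  "energy f \<equiv> \<integral>h. (f h)\<^sup>2 \<partial>M"
abbreviation "Bu t i h \<equiv> \<Sum>j<du. b i j * u t j h"
abbreviation "nt t i h \<equiv> trunc_noise (\<lambda>q. w q i h) t"
abbreviation "sc t i j h \<equiv> score (\<lambda>q. w q i h) (\<lambda>q. u q j h) t"
abbreviation "se t i j h \<equiv> sensitivity (\<lambda>q. w q i h) (\<lambda>q. u q j h) t"
abbreviation "sf t i j h \<equiv> stein_factor (\<lambda>q. w q i h) (\<lambda>q. u q j h) t"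

lemma energy_nonneg: "0 \<le> energy f"
  by simp

lemma energy_integrable: "square_integrable f \<Longrightarrow> integrable M (\<lambda>h. (f h)\<^sup>2)"
  by (simp add: square_integrable_def)

lemma Bu_adapted: "t < T \<Longrightarrow> adapted t (Bu t i)"
  by (intro adapted_sum adapted_mult adapted_const u_adapted) auto

lemma Bu_square: "t < T \<Longrightarrow> square_integrable (Bu t i)"
  by (intro square_integrable_sum square_integrable_cmult u_square) auto

text \<open>The response of the system to the inputs alone, so that \<open>x - input_response\<close> is the filtered noise.\<close>

primrec input_response :: "nat \<Rightarrow> nat \<Rightarrow> 'a \<Rightarrow> real" where
  "input_response 0 i = x 0 i"
| "input_response (Suc t) i = (\<lambda>h. input_response t i h / 2 + Bu t i h)"

abbreviation "flt t i h \<equiv> x t i h - input_response t i h"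

lemma input_response_adapted: "t < T \<Longrightarrow> i < dx \<Longrightarrow> adapted t (input_response t i) \<and> square_integrable (input_response t i)"
proof (induction t)
  case 0
  then show ?case using x_adapted x_square by simp
next
  case (Suc t)
  then have IH: "adapted t (input_response t i)" "square_integrable (input_response t i)" by auto
  have "adapted t (input_response (Suc t) i)"
    using Suc by (auto intro!: adapted_add adapted_divide IH Bu_adapted)
  then show ?case
    using Suc by (auto intro!: square_integrable_add square_integrable_divide IH Bu_square dest: adapted_Suc)
qed

lemma nt_adapted: "t < T \<Longrightarrow> i < dx \<Longrightarrow> adapted t (nt t i)"
proof (induction t)
  case (Suc t)
  have "adapted (Suc t) (\<lambda>h. sine_trunc (w t i h))"
    by (rule adapted_compose[OF sine_trunc_measurable w_adapted]) (use Suc in auto)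
  then show ?case using Suc adapted_Suc by (auto intro!: adapted_add adapted_divide)
qed (simp add: adapted_const)

lemma u_Suc_adapted: "Suc t < T \<Longrightarrow> j < du \<Longrightarrow> adapted (Suc t) (u t j)"
  by (rule adapted_Suc[OF _ u_adapted]) auto

lemma sc_adapted: "t < T \<Longrightarrow> i < dx \<Longrightarrow> j < du \<Longrightarrow> adapted t (sc t i j)"
proof (induction t)
  case (Suc t)
  then show ?case using adapted_Suc w_adapted u_Suc_adapted by (auto intro!: adapted_add adapted_mult)
qed (simp add: adapted_const)

lemma se_adapted: "t < T \<Longrightarrow> i < dx \<Longrightarrow> j < du \<Longrightarrow> adapted t (se t i j)"
proof (induction t)
  case (Suc t)
  have "adapted (Suc t) (\<lambda>h. cos (w t i h / 2))"
    by (rule adapted_compose[OF _ w_adapted]) (use Suc in auto)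
  then show ?case using Suc adapted_Suc u_Suc_adapted by (auto intro!: adapted_add adapted_mult adapted_divide)
qed (simp add: adapted_const)

lemma nt_square: "t < T \<Longrightarrow> i < dx \<Longrightarrow> square_integrable (nt t i)"
  by (rule square_integrable_bound[OF square_integrable_const[of 1], of _ 4])
     (auto intro: adapted_measurable nt_adapted trunc_noise_bound)

lemma std_normal_square: "integrable std_normal (\<lambda>v. v\<^sup>2)"
  by (rule std_normal_power)

lemma sc_square:
  "t < T \<Longrightarrow> i < dx \<Longrightarrow> j < du \<Longrightarrow> square_integrable (sc t i j) \<and> energy (sc t i j) = (\<Sum>q<t. energy (u q j))"
proof (induction t)
  case (Suc t)
  then have IH: "square_integrable (sc t i j)" "energy (sc t i j) = (\<Sum>q<t. energy (u q j))" by auto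
  note N = noise_square[where g="\<lambda>v. v" and f="\<lambda>_. u t j" and I="{i}" and t=t and a="sc t i j",
      OF Suc.prems(1) sc_adapted IH(1) u_adapted u_square]
  show ?case
    using N(1) N(2) Suc.prems IH(2) std_normal_mean std_normal_second std_normal_square
    by (simp add: mult.commute)
qed (simp add: square_integrable_const)

lemma se_square: "t < T \<Longrightarrow> i < dx \<Longrightarrow> j < du \<Longrightarrow> square_integrable (se t i j)"
proof -
  assume t: "t < T" "i < dx" "j < du"
  have 1: "se t i j \<in> borel_measurable M" using t by (auto intro: adapted_measurable se_adapted)
  show ?thesis
    unfolding square_integrable_def
  proof (rule conjI[OF 1], rule Bochner_Integration.integrable_bound[where f="\<lambda>h. 2 * (\<Sum>q<t. (u q j h)\<^sup>2)"])
  show "(\<lambda>h. (se t i j h)\<^sup>2) \<in> borel_measurable M" using 1 by measurable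
  show "integrable M (\<lambda>h. 2 * (\<Sum>q<t. (u q j h)\<^sup>2))"
    using t by (auto intro!: energy_integrable u_square)
  show "AE h in M. norm ((se t i j h)\<^sup>2) \<le> norm (2 * (\<Sum>q<t. (u q j h)\<^sup>2))"
    using sensitivity_bound by (auto simp: sum_nonneg)
  qed
qed

lemma sf_square:
  assumes "t < T" "i < dx" "j < du"
  shows "square_integrable (sf t i j)"
  unfolding stein_factor_def
proof (intro square_integrable_diff se_square assms)
  show "square_integrable (\<lambda>h. nt t i h * sc t i j h)"
  proof (rule square_integrable_bound[of "sc t i j" _ 4])
    show "(\<lambda>h. nt t i h * sc t i j h) \<in> borel_measurable M"
      using assms by (intro borel_measurable_times adapted_measurable[OF assms(1)] nt_adapted sc_adapted)
    show "\<bar>nt t i h * sc t i j h\<bar> \<le> 4 * \<bar>sc t i j h\<bar>" for h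
      unfolding abs_mult by (rule mult_right_mono[OF trunc_noise_bound]) simp
  qed (use sc_square assms in auto)
qed

lemma integral_mult_ge:
  assumes "square_integrable f" "square_integrable g"
  shows "(\<integral>h. f h * g h \<partial>M) \<ge> - energy f / 4 - energy g"
proof -
  have "(\<integral>h. - ((f h)\<^sup>2 / 4) - (g h)\<^sup>2 \<partial>M) \<le> (\<integral>h. f h * g h \<partial>M)"
  proof (rule integral_mono)
    fix h
    show "- ((f h)\<^sup>2 / 4) - (g h)\<^sup>2 \<le> f h * g h"
      using zero_le_power2[of "f h / 2 + g h"] by (simp add: power2_eq_square algebra_simps)
  qed (use assms in \<open>auto intro!: energy_integrable square_integrable_mult Bochner_Integration.integrable_diff\<close>)
  then show ?thesis using assms by (simp add: energy_integrable)
qed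

text \<open>Subtracting the energy of the input response cancels the square of \<open>Bu\<close>.
  What remains of the inputs is their correlation with the filtered noise, the only channel through
  which they can lower the state energy.\<close>

lemma state_energy_Suc:
  assumes t: "Suc t < T" and i: "i < dx"
  shows "energy (x (Suc t) i) - energy (input_response (Suc t) i) =
     (energy (x t i) - energy (input_response t i)) / 4 + (\<integral>h. flt t i h * Bu t i h \<partial>M) + 1"
proof -
  have tT: "t < T" using t by simp
  note m = input_response_adapted[OF tT i, THEN conjunct2]
  note xs = x_square[OF tT i] and bs = Bu_square[OF tT, of i]
  let ?a = "\<lambda>h. x t i h / 2 + Bu t i h"
  have N: "energy (\<lambda>h. ?a h + (\<Sum>i\<in>{i}. 1 * w t i h)) = energy ?a + (\<integral>v. v\<^sup>2 \<partial>std_normal) * (\<Sum>i\<in>{i}. energy (\<lambda>_. 1))"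
    by (rule noise_square(2)[OF t, where g="\<lambda>v. v" and f="\<lambda>_ _. 1"])
       (use i tT in \<open>auto intro!: adapted_intros square_integrable_add square_integrable_divide xs bs square_integrable_const
          x_adapted Bu_adapted std_normal_mean std_normal_power u_adapted\<close>)
  have eqx: "x (Suc t) i = (\<lambda>h. ?a h + w t i h)" using x_Suc[OF t i] by (simp add: fun_eq_iff)
  have ex: "energy (x (Suc t) i) = energy ?a + 1"
    using N by (simp add: eqx std_normal_second prob_space)
  have "energy ?a - energy (input_response (Suc t) i) = (\<integral>h. (?a h)\<^sup>2 - (input_response (Suc t) i h)\<^sup>2 \<partial>M)"
    by (rule Bochner_Integration.integral_diff[symmetric])
       (auto intro!: energy_integrable square_integrable_add square_integrable_divide xs bs m)
  also have "\<dots> = (\<integral>h. ((x t i h)\<^sup>2 - (input_response t i h)\<^sup>2) / 4 + flt t i h * Bu t i h \<partial>M)"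
    by (intro Bochner_Integration.integral_cong) (auto simp: power2_eq_square field_simps)
  also have "\<dots> = (energy (x t i) - energy (input_response t i)) / 4 + (\<integral>h. flt t i h * Bu t i h \<partial>M)"
    using energy_integrable[OF xs] energy_integrable[OF m] square_integrable_mult[OF square_integrable_diff[OF xs m] bs]
    by simp
  finally show ?thesis using ex by simp
qed

end

context lqr_process begin

text \<open>The energy of the input response is nonnegative and is dropped; the other terms are
  summed with their discount weights.\<close>

lemma sum_state_energy:
  assumes T: "T = Suc n"
  shows "(\<Sum>t<T. \<Sum>i<dx. energy (x t i)) \<ge>
    (\<Sum>t<n. discount_weight (n - t) * ((\<Sum>i<dx. \<integral>h. flt t i h * Bu t i h \<partial>M) + real dx))"
proof -
  define D where "D = (\<lambda>t. \<Sum>i<dx. energy (x t i) - energy (input_response t i))"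
  have "D (Suc t) = D t / 4 + ((\<Sum>i<dx. \<integral>h. flt t i h * Bu t i h \<partial>M) + real dx)" if "t < n" for t
  proof -
    have "D (Suc t) = (\<Sum>i<dx. (energy (x t i) - energy (input_response t i)) / 4 + (\<integral>h. flt t i h * Bu t i h \<partial>M) + 1)"
      unfolding D_def using that T by (intro sum.cong refl state_energy_Suc) auto
    then show ?thesis by (simp add: D_def sum.distrib sum_divide_distrib)
  qed
  \<comment> \<open>\<open>D 0 = 0\<close> holds exactly because \<open>input_response\<close>
    starts at \<open>x 0\<close>.\<close>
  then have "(\<Sum>t<T. D t) = (\<Sum>t<n. discount_weight (n - t) * ((\<Sum>i<dx. \<integral>h. flt t i h * Bu t i h \<partial>M) + real dx))"
    unfolding T by (intro sum_quarter_recursion(2)) (auto simp: D_def)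
  moreover have "(\<Sum>t<T. D t) \<le> (\<Sum>t<T. \<Sum>i<dx. energy (x t i))"
    unfolding D_def by (intro sum_mono) (simp add: energy_nonneg)
  ultimately show ?thesis by simp
qed

section \<open>Truncation error and the correlation after integration by parts\<close>

definition tail :: "nat \<Rightarrow> nat \<Rightarrow> 'a \<Rightarrow> real" where
  "tail t j h = (\<Sum>i<dx. b i j * (flt t i h - nt t i h))"

lemma tail_adapted: "t < T \<Longrightarrow> adapted t (tail t j)"
  unfolding tail_def using input_response_adapted x_adapted nt_adapted
  by (intro adapted_sum adapted_mult adapted_diff adapted_const) auto

lemma tail_square: "t < T \<Longrightarrow> square_integrable (tail t j)"
  unfolding tail_def using input_response_adapted x_square nt_square
  by (intro square_integrable_sum square_integrable_cmult square_integrable_diff) auto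

text \<open>The truncation error is centred and independent of the past, so its energy obeys a
  recursion with factor 1/4 and increment at most 1/32, in units of the squared length of column
  \<open>j\<close>; 1/24 is the fixed point.\<close>

lemma tail_energy: "t < T \<Longrightarrow> energy (tail t j) \<le> (\<Sum>i<dx. (b i j)\<^sup>2) / 24"
proof (induction t)
  case 0
  have "tail 0 j = (\<lambda>_. 0)" by (simp add: tail_def fun_eq_iff)
  then show ?case by (simp add: sum_nonneg)
next
  case (Suc t)
  let ?g = "\<lambda>v. v - sine_trunc v"
  let ?k = "\<integral>v. (?g v)\<^sup>2 \<partial>std_normal"
  let ?s = "\<Sum>i<dx. (b i j)\<^sup>2"
  have t: "t < T" using Suc.prems by simp
  have eq: "tail (Suc t) j = (\<lambda>h. tail t j h / 2 + (\<Sum>i<dx. b i j * ?g (w t i h)))"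
  proof
    fix h
    have "tail (Suc t) j h = (\<Sum>i<dx. b i j * (flt t i h - nt t i h) / 2 + b i j * ?g (w t i h))"
      unfolding tail_def by (intro sum.cong refl) (simp add: x_Suc[OF Suc.prems] field_simps)
    then show "tail (Suc t) j h = tail t j h / 2 + (\<Sum>i<dx. b i j * ?g (w t i h))"
      by (simp add: tail_def sum.distrib sum_divide_distrib)
  qed
  have "energy (tail (Suc t) j) = energy (\<lambda>h. tail t j h / 2) + ?k * (\<Sum>i<dx. energy (\<lambda>_. b i j))"
    unfolding eq
    by (rule noise_square(2)[OF Suc.prems, where f="\<lambda>i _. b i j"])
       (auto intro!: adapted_divide tail_adapted t square_integrable_divide tail_square adapted_const
          square_integrable_const std_normal_sine_trunc)
  also have "\<dots> = energy (tail t j) / 4 + ?k * ?s"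
    by (simp add: power_divide prob_space)
  also have "\<dots> \<le> (?s / 24) / 4 + 1 / 32 * ?s"
    using Suc.IH[OF t] std_normal_sine_trunc(6)
    by (intro add_mono mult_right_mono sum_nonneg divide_right_mono) auto
  finally show ?case by simp
qed

text \<open>Coordinate \<open>j\<close> of the vector that the integration by parts puts in the
  place of the back-projected noise, called Z in the overview; \<open>\<tau>\<close> stands for the
  Stein kernel at the entries of \<open>B\<close>.\<close>

definition gain :: "(nat \<Rightarrow> nat \<Rightarrow> real) \<Rightarrow> nat \<Rightarrow> nat \<Rightarrow> 'a \<Rightarrow> real" where
  "gain \<tau> t j h = (\<Sum>i<dx. \<tau> i j * sf t i j h)"

text \<open>Integrand before the integration by parts minus the one after it. It vanishes only on
  average over the prior, so for a fixed matrix it is carried along as an error.\<close>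

definition stein_gap :: "(nat \<Rightarrow> nat \<Rightarrow> real) \<Rightarrow> nat \<Rightarrow> nat \<Rightarrow> nat \<Rightarrow> 'a \<Rightarrow> real" where
  "stein_gap \<tau> t i j h = b i j * nt t i h * u t j h - \<tau> i j * sf t i j h * u t j h"

context
  fixes \<tau> :: "nat \<Rightarrow> nat \<Rightarrow> real" and e :: real
  assumes \<tau>: "\<And>i j. i < dx \<Longrightarrow> j < du \<Longrightarrow> \<bar>\<tau> i j\<bar> \<le> e / 2"
begin

lemma gain_square: "t < T \<Longrightarrow> j < du \<Longrightarrow> square_integrable (gain \<tau> t j)"
  unfolding gain_def by (intro square_integrable_sum square_integrable_cmult sf_square) auto

lemma \<tau>_square: "i < dx \<Longrightarrow> j < du \<Longrightarrow> (\<tau> i j)\<^sup>2 \<le> e\<^sup>2 / 4"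
  using power_mono[OF \<tau>[of i j], of 2] by (simp add: power_divide)

text \<open>The two increments of \<open>stein_factor_Suc\<close>, summed against
  \<open>\<tau>\<close>: orthogonality of the rows bounds the first, Cauchy-Schwarz over the rows
  the second. The number \<open>e\<close> here is later the square of the half-width of the
  box.\<close>

lemma gain_energy_Suc:
  assumes t: "Suc t < T" and j: "j < du"
  shows "energy (gain \<tau> (Suc t) j) \<le> energy (gain \<tau> t j) / 2 +
    (real dx * e\<^sup>2 * (\<Sum>q<T. energy (u q j)) + 34 * (real dx)\<^sup>2 * e\<^sup>2 * energy (u t j))"
proof -
  have tT: "t < T" using t by simp
  define r where "r = (\<lambda>i h. nt t i h / 2 * w t i h + sine_trunc (w t i h) * w t i h - cos (w t i h / 2))"
  define I1 where "I1 = (\<lambda>h. 0 + (\<Sum>i<dx. (\<tau> i j * sc t i j h) * sine_trunc (w t i h)))"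
  define I2 where "I2 = (\<lambda>h. u t j h * (\<Sum>i<dx. \<tau> i j * r i h))"
  have eq: "gain \<tau> (Suc t) j h = gain \<tau> t j h / 2 + I1 h + I2 h" for h
    unfolding gain_def I1_def I2_def r_def sum_divide_distrib sum_distrib_left
    by (simp add: stein_factor_Suc sum.distrib[symmetric] algebra_simps)
  have sc: "square_integrable (sc t i j)" "energy (sc t i j) \<le> (\<Sum>q<T. energy (u q j))" if "i < dx" for i
    using sc_square[OF tT that j] tT
    by (auto intro!: sum_mono2 energy_nonneg)
  note N = noise_square[OF t, where g=sine_trunc and a="\<lambda>_. 0" and I="{..<dx}" and f="\<lambda>i h. \<tau> i j * sc t i j h",
      OF adapted_const square_integrable_const adapted_mult[OF adapted_const sc_adapted[OF tT _ j]] square_integrable_cmult[OF sc(1)]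
       sine_trunc_measurable std_normal_sine_trunc(1,2) order_refl]
  have I1s: "square_integrable I1" unfolding I1_def by (rule N(1))
  \<comment> \<open>\<open>I2\<close> multiplies an input by unbounded noise; its square
    integrability is read off from the other terms of the recursion.\<close>
  have I2s: "square_integrable I2"
  proof -
    have "I2 = (\<lambda>h. gain \<tau> (Suc t) j h - gain \<tau> t j h / 2 - I1 h)" using eq by (simp add: fun_eq_iff)
    then show ?thesis
      by (simp only:) (intro square_integrable_diff square_integrable_divide gain_square I1s t tT j)
  qed
  have "energy I1 = (\<integral>v. (sine_trunc v)\<^sup>2 \<partial>std_normal) * (\<Sum>i<dx. (\<tau> i j)\<^sup>2 * energy (sc t i j))"
    using N(2) by (simp add: I1_def power_mult_distrib)
  also have "\<dots> \<le> 1 * (\<Sum>i<dx. e\<^sup>2 / 4 * (\<Sum>q<T. energy (u q j)))"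
    using std_normal_sine_trunc(3) sc(2) \<tau>_square j
    by (intro mult_mono sum_mono sum_nonneg mult_nonneg_nonneg energy_nonneg) auto
  finally have E1: "energy I1 \<le> real dx * (e\<^sup>2 / 4) * (\<Sum>q<T. energy (u q j))" by simp
  \<comment> \<open>The factor is at most \<open>4 * \<bar>w\<bar> + 1\<close>; the square of this
    gives \<open>32 * w\<^sup>2 + 2\<close>, whose mean is 34.\<close>
  have rb: "(r i h)\<^sup>2 \<le> 32 * (w t i h)\<^sup>2 + 2" for i h
  proof -
    let ?w = "w t i h"
    have "\<bar>nt t i h / 2 * ?w\<bar> \<le> 2 * \<bar>?w\<bar>"
      unfolding abs_mult using trunc_noise_bound[of "\<lambda>q. w q i h" t] by (intro mult_right_mono) auto
    moreover have "\<bar>sine_trunc ?w * ?w\<bar> \<le> 2 * \<bar>?w\<bar>"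
      unfolding abs_mult using sine_trunc_bounds(1)[of ?w] by (intro mult_right_mono) auto
    moreover have "\<bar>cos (?w / 2)\<bar> \<le> 1" by simp
    ultimately have "\<bar>r i h\<bar> \<le> 4 * \<bar>?w\<bar> + 1" unfolding r_def by linarith
    then have "\<bar>r i h\<bar>\<^sup>2 \<le> (4 * \<bar>?w\<bar> + 1)\<^sup>2" by (rule power_mono) simp
    also have "\<dots> \<le> 32 * ?w\<^sup>2 + 2"
      using zero_le_power2[of "4 * \<bar>?w\<bar> - 1"] by (simp add: power2_eq_square algebra_simps)
    finally show ?thesis by simp
  qed
  define c where "c = real dx * (e / 2)\<^sup>2"
  have I2b: "(I2 h)\<^sup>2 \<le> c * (\<Sum>i<dx. (u t j h)\<^sup>2 * (32 * (w t i h)\<^sup>2 + 2))" for h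
  proof -
    have "(\<Sum>i<dx. \<tau> i j * r i h)\<^sup>2 \<le> c * (\<Sum>i<dx. (r i h)\<^sup>2)"
      unfolding c_def by (rule sum_weighted_square_le) (use \<tau> j in auto)
    also have "\<dots> \<le> c * (\<Sum>i<dx. 32 * (w t i h)\<^sup>2 + 2)"
      using rb by (intro mult_left_mono sum_mono) (auto simp: c_def)
    finally have "(u t j h)\<^sup>2 * (\<Sum>i<dx. \<tau> i j * r i h)\<^sup>2 \<le> (u t j h)\<^sup>2 * (c * (\<Sum>i<dx. 32 * (w t i h)\<^sup>2 + 2))"
      by (rule mult_left_mono) simp
    also have "\<dots> = c * (\<Sum>i<dx. (u t j h)\<^sup>2 * (32 * (w t i h)\<^sup>2 + 2))"
      by (simp only: sum_distrib_left mult.left_commute)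
    finally show ?thesis
      unfolding I2_def power_mult_distrib .
  qed
  have gi: "integrable std_normal (\<lambda>v. 32 * v\<^sup>2 + 2 :: real)"
    using std_normal_power[of 2] by simp
  have gv: "(\<integral>v. 32 * v\<^sup>2 + 2 \<partial>std_normal) = (34 :: real)"
    using std_normal_power[of 2] std_normal_second std_normal.prob_space by simp
  have ui: "integrable M (\<lambda>h. (u t j h)\<^sup>2)" "adapted t (\<lambda>h. (u t j h)\<^sup>2)"
    using energy_integrable[OF u_square[OF tT j]] adapted_mult[OF u_adapted u_adapted, OF tT j tT j]
    by (simp_all add: power2_eq_square)
  note wc = w_component[OF t ui(2,1), where g="\<lambda>v. 32 * v\<^sup>2 + 2", OF _ _ gi]
  have "energy I2 \<le> (\<integral>h. c * (\<Sum>i<dx. (u t j h)\<^sup>2 * (32 * (w t i h)\<^sup>2 + 2)) \<partial>M)"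
    by (rule integral_mono[OF energy_integrable[OF I2s] _ I2b])
       (intro integrable_mult_right Bochner_Integration.integrable_sum wc(1); simp)
  also have "\<dots> = c * (\<Sum>i<dx. \<integral>h. (u t j h)\<^sup>2 * (32 * (w t i h)\<^sup>2 + 2) \<partial>M)"
    by (subst integral_mult_right_zero, subst Bochner_Integration.integral_sum) (auto intro: wc(1))
  also have "(\<Sum>i<dx. \<integral>h. (u t j h)\<^sup>2 * (32 * (w t i h)\<^sup>2 + 2) \<partial>M) = real dx * (energy (u t j) * 34)"
    using wc(2) gv by simp
  finally have E2: "energy I2 \<le> c * (real dx * (energy (u t j) * 34))" .
  have "energy (gain \<tau> (Suc t) j) \<le> (\<integral>h. (gain \<tau> t j h)\<^sup>2 / 2 + 4 * (I1 h)\<^sup>2 + 4 * (I2 h)\<^sup>2 \<partial>M)"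
  proof (rule integral_mono)
    fix h
    \<comment> \<open>Twice the squares of \<open>z / 2\<close> and of \<open>p + q\<close>. The
      factor for the old energy rises from 1/4 to 1/2, which still contracts.\<close>
    have "(z / 2 + p + q)\<^sup>2 \<le> z\<^sup>2 / 2 + 4 * p\<^sup>2 + 4 * q\<^sup>2" for z p q :: real
      using zero_le_power2[of "z / 2 - (p + q)"] zero_le_power2[of "p - q"]
      by (simp add: power2_eq_square field_simps)
    then show "(gain \<tau> (Suc t) j h)\<^sup>2 \<le> (gain \<tau> t j h)\<^sup>2 / 2 + 4 * (I1 h)\<^sup>2 + 4 * (I2 h)\<^sup>2"
      unfolding eq .
  qed (use energy_integrable[OF I1s] energy_integrable[OF I2s] energy_integrable[OF gain_square[OF t j]]
      energy_integrable[OF gain_square[OF tT j]] in simp_all)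
  also have "\<dots> = energy (gain \<tau> t j) / 2 + 4 * energy I1 + 4 * energy I2"
    using energy_integrable[OF I1s] energy_integrable[OF I2s] energy_integrable[OF gain_square[OF tT j]] by simp
  finally show ?thesis using E1 E2 by (simp add: c_def power_divide power2_eq_square algebra_simps)
qed

text \<open>The score accumulates the inputs of all earlier times, so each of the \<open>T\<close>
  steps may cost the total input energy. This is how \<open>T\<close> enters the choice of
  \<open>e\<close>.\<close>

lemma sum_gain_energy:
  assumes small: "e\<^sup>2 * (real T * real dx + 34 * (real dx)\<^sup>2) \<le> 1 / 8" and j: "j < du" and T: "T = Suc n"
  shows "(\<Sum>t<T. energy (gain \<tau> t j)) \<le> (\<Sum>q<T. energy (u q j)) / 4"
proof -
  let ?U = "\<Sum>q<T. energy (u q j)"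
  have U: "0 \<le> ?U" by (intro sum_nonneg energy_nonneg)
  have g0: "gain \<tau> 0 j = (\<lambda>_. 0)" by (simp add: gain_def stein_factor_def fun_eq_iff)
  have "(\<Sum>t<T. energy (gain \<tau> t j)) \<le>
      2 * (\<Sum>t<n. real dx * e\<^sup>2 * ?U + 34 * (real dx)\<^sup>2 * e\<^sup>2 * energy (u t j))"
    unfolding T by (rule sum_half_recursion)
      (use gain_energy_Suc[OF _ j] T energy_nonneg in \<open>auto simp: g0\<close>)
  also have "\<dots> = 2 * (real n * (real dx * e\<^sup>2 * ?U) + 34 * (real dx)\<^sup>2 * e\<^sup>2 * (\<Sum>t<n. energy (u t j)))"
    by (simp add: sum.distrib sum_distrib_left)
  also have "\<dots> \<le> 2 * (real T * (real dx * e\<^sup>2 * ?U) + 34 * (real dx)\<^sup>2 * e\<^sup>2 * ?U)"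
    using U T by (intro mult_left_mono add_mono mult_right_mono sum_mono2 energy_nonneg) auto
  also have "\<dots> = 2 * (e\<^sup>2 * (real T * real dx + 34 * (real dx)\<^sup>2)) * ?U"
    by (simp add: algebra_simps)
  also have "\<dots> \<le> 2 * (1 / 8) * ?U"
    using small U by (intro mult_right_mono mult_left_mono) auto
  finally show ?thesis by simp
qed

lemma stein_gap_integrable:
  assumes "t < T" "i < dx" "j < du"
  shows "integrable M (stein_gap \<tau> t i j)"
  unfolding stein_gap_def mult.assoc
  using assms by (intro Bochner_Integration.integrable_diff integrable_mult_right square_integrable_mult nt_square u_square sf_square)

text \<open>The correlation splits into truncation error, transformed part and
  \<open>stein_gap\<close>. Young's inequality charges a quarter of the input energy for each of the
  first two.\<close>

lemma correlation_ge:
  assumes t: "t < T"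
  shows "(\<Sum>i<dx. \<integral>h. flt t i h * Bu t i h \<partial>M) \<ge> (\<Sum>i<dx. \<Sum>j<du. \<integral>h. stein_gap \<tau> t i j h \<partial>M)
     - (\<Sum>j<du. energy (u t j)) / 2 - (\<Sum>j<du. \<Sum>i<dx. (b i j)\<^sup>2) / 24 - (\<Sum>j<du. energy (gain \<tau> t j))"
proof -
  have fs: "square_integrable (flt t i)" if "i < dx" for i
    using that t input_response_adapted x_square by (intro square_integrable_diff) auto
  have i1: "integrable M (\<lambda>h. u t j h * tail t j h)" "integrable M (\<lambda>h. u t j h * gain \<tau> t j h)" if "j < du" for j
    using that t by (auto intro!: square_integrable_mult u_square tail_square gain_square)
  have pw: "(\<Sum>i<dx. flt t i h * Bu t i h) = (\<Sum>j<du. u t j h * tail t j h) + (\<Sum>j<du. u t j h * gain \<tau> t j h)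
     + (\<Sum>i<dx. \<Sum>j<du. stein_gap \<tau> t i j h)" for h
  proof -
    have "(\<Sum>j<du. u t j h * tail t j h) = (\<Sum>i<dx. \<Sum>j<du. u t j h * (b i j * (flt t i h - nt t i h)))"
      unfolding tail_def sum_distrib_left by (rule sum.swap)
    moreover have "(\<Sum>j<du. u t j h * gain \<tau> t j h) = (\<Sum>i<dx. \<Sum>j<du. u t j h * (\<tau> i j * sf t i j h))"
      unfolding gain_def sum_distrib_left by (rule sum.swap)
    ultimately have "(\<Sum>j<du. u t j h * tail t j h) + (\<Sum>j<du. u t j h * gain \<tau> t j h) + (\<Sum>i<dx. \<Sum>j<du. stein_gap \<tau> t i j h)
       = (\<Sum>i<dx. \<Sum>j<du. u t j h * (b i j * (flt t i h - nt t i h)) + u t j h * (\<tau> i j * sf t i j h) + stein_gap \<tau> t i j h)"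
      by (simp add: sum.distrib)
    also have "\<dots> = (\<Sum>i<dx. \<Sum>j<du. flt t i h * (b i j * u t j h))"
      by (intro sum.cong refl) (simp add: stein_gap_def algebra_simps)
    finally show ?thesis by (simp add: sum_distrib_left)
  qed
  have "(\<Sum>i<dx. \<integral>h. flt t i h * Bu t i h \<partial>M) = (\<integral>h. (\<Sum>i<dx. flt t i h * Bu t i h) \<partial>M)"
    by (rule Bochner_Integration.integral_sum[symmetric]) (use fs Bu_square[OF t] in \<open>auto intro: square_integrable_mult\<close>)
  also have "\<dots> = (\<Sum>j<du. \<integral>h. u t j h * tail t j h \<partial>M) + (\<Sum>j<du. \<integral>h. u t j h * gain \<tau> t j h \<partial>M)
     + (\<Sum>i<dx. \<Sum>j<du. \<integral>h. stein_gap \<tau> t i j h \<partial>M)"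
    unfolding pw
    by (intro has_bochner_integral_integral_eq has_bochner_integral_add has_bochner_integral_sum
        has_bochner_integral_integrable i1 stein_gap_integrable t) auto
  also have "(\<Sum>j<du. \<integral>h. u t j h * tail t j h \<partial>M) \<ge> (\<Sum>j<du. - energy (u t j) / 4 - (\<Sum>i<dx. (b i j)\<^sup>2) / 24)"
  proof (rule sum_mono)
    fix j assume "j \<in> {..<du}"
    then show "- energy (u t j) / 4 - (\<Sum>i<dx. (b i j)\<^sup>2) / 24 \<le> (\<integral>h. u t j h * tail t j h \<partial>M)"
      using integral_mult_ge[OF u_square[OF t, of j] tail_square[OF t, of j]] tail_energy[OF t, of j] by simp
  qed
  moreover have "(\<Sum>j<du. \<integral>h. u t j h * gain \<tau> t j h \<partial>M) \<ge> (\<Sum>j<du. - energy (u t j) / 4 - energy (gain \<tau> t j))"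
    by (intro sum_mono integral_mult_ge u_square gain_square t) auto
  ultimately show ?thesis
    by (simp add: sum_subtractf sum_negf sum_divide_distrib[symmetric])
qed

text \<open>The charges are tuned to the weight bound 4/3: Young's inequality takes 1/2 and the gain
  1/4 of the input energy, and 4/3 * 3/4 = 1 is exactly what the learner pays for its inputs. The
  truncation leaves 4/3 * 1/24 = 1/18.\<close>

theorem cost_lower_bound:
  assumes small: "e\<^sup>2 * (real T * real dx + 34 * (real dx)\<^sup>2) \<le> 1 / 8" and T: "T = Suc n"
  shows "(4 / 3 * real T - 16 / 9) * real dx - real T / 18 * (\<Sum>j<du. \<Sum>i<dx. (b i j)\<^sup>2)
       + (\<Sum>t<n. discount_weight (n - t) * (\<Sum>i<dx. \<Sum>j<du. \<integral>h. stein_gap \<tau> t i j h \<partial>M))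
     \<le> (\<Sum>t<T. (\<Sum>i<dx. energy (x t i)) + (\<Sum>j<du. energy (u t j)))"
proof -
  let ?U = "\<Sum>t<T. \<Sum>j<du. energy (u t j)"
  let ?b = "\<Sum>j<du. \<Sum>i<dx. (b i j)\<^sup>2"
  let ?G = "\<lambda>t. \<Sum>i<dx. \<Sum>j<du. \<integral>h. stein_gap \<tau> t i j h \<partial>M"
  let ?g = "\<lambda>t. \<Sum>i<dx. \<integral>h. flt t i h * Bu t i h \<partial>M"
  let ?loss = "\<lambda>t. (\<Sum>j<du. energy (u t j)) / 2 + ?b / 24 + (\<Sum>j<du. energy (gain \<tau> t j))"
  have distrib: "(\<Sum>t<n. d t * G t) + (\<Sum>t<n. d t) * c - (\<Sum>t<n. d t * l t) = (\<Sum>t<n. d t * (G t - l t + c))"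
    for d G l :: "nat \<Rightarrow> real" and c
    by (simp add: ring_distribs sum.distrib sum_subtractf sum_distrib_right)
  have b0: "0 \<le> ?b" by (intro sum_nonneg) simp
  have loss0: "0 \<le> ?loss t" for t
    by (intro add_nonneg_nonneg divide_nonneg_nonneg sum_nonneg energy_nonneg b0) auto
  have "(\<Sum>t<T. \<Sum>j<du. energy (gain \<tau> t j)) = (\<Sum>j<du. \<Sum>t<T. energy (gain \<tau> t j))"
    by (rule sum.swap)
  also have "\<dots> \<le> (\<Sum>j<du. (\<Sum>q<T. energy (u q j)) / 4)"
    by (intro sum_mono sum_gain_energy[OF small _ T]) auto
  also have "\<dots> = ?U / 4"
    by (subst sum.swap) (simp add: sum_divide_distrib)
  finally have Z: "(\<Sum>t<T. \<Sum>j<du. energy (gain \<tau> t j)) \<le> ?U / 4" .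
  have "(\<Sum>t<n. discount_weight (n - t) * ?loss t) \<le> (\<Sum>t<n. 4 / 3 * ?loss t)"
    by (intro sum_mono mult_right_mono discount_weight_bounds loss0)
  also have "\<dots> \<le> (\<Sum>t<T. 4 / 3 * ?loss t)"
    by (intro sum_mono2 mult_nonneg_nonneg loss0) (use T in auto)
  also have "\<dots> = 4 / 3 * (?U / 2 + real T * ?b / 24 + (\<Sum>t<T. \<Sum>j<du. energy (gain \<tau> t j)))"
    by (subst sum_distrib_left[symmetric]) (simp add: sum.distrib flip: sum_divide_distrib)
  also have "\<dots> \<le> ?U + real T / 18 * ?b"
    using Z by simp
  finally have L: "(\<Sum>t<n. discount_weight (n - t) * ?loss t) \<le> ?U + real T / 18 * ?b" .
  have "(\<Sum>t<n. discount_weight (n - t) * ?G t) + (\<Sum>t<n. discount_weight (n - t)) * real dx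
      - (\<Sum>t<n. discount_weight (n - t) * ?loss t)
      = (\<Sum>t<n. discount_weight (n - t) * (?G t - ?loss t + real dx))"
    by (rule distrib)
  also have "\<dots> \<le> (\<Sum>t<n. discount_weight (n - t) * (?g t + real dx))"
  proof (intro sum_mono mult_left_mono discount_weight_bounds)
    fix t assume "t \<in> {..<n}"
    then show "?G t - ?loss t + real dx \<le> ?g t + real dx"
      using correlation_ge[of t] T by simp
  qed
  also have "\<dots> \<le> (\<Sum>t<T. \<Sum>i<dx. energy (x t i))" by (rule sum_state_energy[OF T])
  finally have main: "(\<Sum>t<n. discount_weight (n - t) * ?G t) + (\<Sum>t<n. discount_weight (n - t)) * real dx
      - (\<Sum>t<n. discount_weight (n - t) * ?loss t) \<le> (\<Sum>t<T. \<Sum>i<dx. energy (x t i))" .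
  have "(4 / 3 * real T - 16 / 9) * real dx \<le> (\<Sum>t<n. discount_weight (n - t)) * real dx"
    using sum_discount_weight[of n] T by (intro mult_right_mono) auto
  then show ?thesis using main L by (simp add: sum.distrib)
qed

end
end

section \<open>The trajectory law as an adapted process\<close>

definition half_id :: "nat \<Rightarrow> rmat" where
  "half_id n = (1 / 2) \<cdot>\<^sub>m 1\<^sub>m n"

lemma half_id_carrier [simp]: "half_id n \<in> carrier_mat n n"
  by (simp add: half_id_def)

lemma mult_mat_vec_sum: "B \<in> carrier_mat n m \<Longrightarrow> v \<in> carrier_vec m \<Longrightarrow> i < n \<Longrightarrow> (B *\<^sub>v v) $ i = (\<Sum>j<m. B $$ (i, j) * v $ j)"
  by (auto simp: scalar_prod_def atLeast0LessThan intro!: sum.cong)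

lemma half_id_mult:
  assumes "v \<in> carrier_vec n" "i < n"
  shows "(half_id n *\<^sub>v v) $ i = v $ i / 2"
proof -
  have "(half_id n *\<^sub>v v) $ i = (\<Sum>j<n. if i = j then v $ j / 2 else 0)"
    unfolding mult_mat_vec_sum[OF half_id_carrier assms]
    using assms by (intro sum.cong) (auto simp: half_id_def)
  then show ?thesis using assms by simp
qed

lemma one_smult_scalar_prod: "v \<in> carrier_vec n \<Longrightarrow> v \<bullet> (1\<^sub>m n *\<^sub>v v) = (\<Sum>i<n. (v $ i)\<^sup>2)" for v :: rvec
  by (auto simp: scalar_prod_def power2_eq_square atLeast0LessThan intro!: sum.cong)

text \<open>Time is shifted by one: \<open>xs t\<close> and \<open>us t\<close> are the paper's \<open>x\<^sub>t\<^sub>+\<^sub>1\<close> and \<open>u\<^sub>t\<^sub>+\<^sub>1\<close>.\<close>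

definition xs :: "nat \<Rightarrow> nat \<Rightarrow> history \<Rightarrow> real" where
  "xs t i h = fst h (Suc t) $ i"

definition us :: "nat \<Rightarrow> nat \<Rightarrow> history \<Rightarrow> real" where
  "us t j h = snd h (Suc t) $ j"

text \<open>For a fixed history the noise is an affine function of the candidate entries
  \<open>b\<close>; in this form it is differentiated later.\<close>

definition ws :: "nat \<Rightarrow> (nat \<Rightarrow> nat \<Rightarrow> real) \<Rightarrow> nat \<Rightarrow> nat \<Rightarrow> history \<Rightarrow> real" where
  "ws du b t i h = xs (Suc t) i h - xs t i h / 2 - (\<Sum>j<du. b i j * us t j h)"

locale half_system = lqr_system dx du "half_id dx" alg for dx du alg
begin

text \<open>Measurability with respect to the first \<open>t + 1\<close> states and inputs.
  Invariance under \<open>past\<close> takes the place of a sub-sigma-algebra; because time is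
  shifted by one, \<open>us t\<close> counts as known at \<open>t\<close>.\<close>

definition adapted :: "nat \<Rightarrow> (history \<Rightarrow> real) \<Rightarrow> bool" where
  "adapted t f \<longleftrightarrow> f \<in> borel_measurable (H (Suc t) (Suc t)) \<and> (\<forall>h. f (past (Suc t) h) = f h)"

lemma xs_measurable: "t < n \<Longrightarrow> i < dx \<Longrightarrow> xs t i \<in> borel_measurable (H n m)"
  unfolding xs_def by (rule measurable_vec_component'[OF measurable_state]) auto

lemma us_measurable: "t < m \<Longrightarrow> j < du \<Longrightarrow> us t j \<in> borel_measurable (H n m)"
  unfolding us_def by (rule measurable_vec_component'[OF measurable_input]) auto

lemma xs_past: "t < s \<Longrightarrow> xs t i (past s h) = xs t i h"
  by (simp add: xs_def past_def)

lemma us_past: "t < s \<Longrightarrow> us t j (past s h) = us t j h"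
  by (simp add: us_def past_def)

lemma ws_past: "Suc t < s \<Longrightarrow> ws du b t i (past s h) = ws du b t i h"
  by (simp add: ws_def xs_past us_past)

lemma ws_measurable: "Suc t < n \<Longrightarrow> i < dx \<Longrightarrow> ws du b t i \<in> borel_measurable (H n n)"
  unfolding ws_def
  by (intro borel_measurable_diff borel_measurable_divide borel_measurable_sum borel_measurable_times
      borel_measurable_const xs_measurable us_measurable) auto

lemma noise_eq_ws:
  assumes B: "B \<in> carrier_mat dx du" and h: "h \<in> space (H n n)" and t: "t < n"
  shows "noise B (Suc t) h = (\<lambda>i\<in>{..<dx}. ws du (\<lambda>i j. B $$ (i, j)) t i h)"
  using space_history[OF h, of "Suc t"] t B
  by (auto simp: noise_def ws_def xs_def us_def fun_eq_iff half_id_mult mult_mat_vec_sum simp del: index_mult_mat_vec)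

lemma adapted_process_trajectory:
  assumes B: "B \<in> carrier_mat dx du"
  shows "adapted_process (P B T) adapted dx T (ws du (\<lambda>i j. B $$ (i, j)))"
proof -
  interpret prob_space "P B T" by (rule prob_space_trajectory[OF B])
  have meas: "f \<in> borel_measurable (P B T)" if "t < T" "adapted t f" for t f
  proof -
    note fp = that(2)[unfolded adapted_def, THEN conjunct2, rule_format]
    have "(\<lambda>h. f (past (Suc t) h)) \<in> borel_measurable (H T T)"
      by (rule measurable_compose[OF measurable_past]) (use that in \<open>auto simp: adapted_def\<close>)
    then show ?thesis
      by (simp add: measurable_trajectory[OF B] fp)
  qed
  show ?thesis
  proof
    show "t < T \<Longrightarrow> adapted t f \<Longrightarrow> f \<in> borel_measurable (P B T)" for t f by (rule meas)
    show "adapted t (\<lambda>_. c)" for t c by (simp add: adapted_def)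
    show "adapted t f \<Longrightarrow> adapted t g \<Longrightarrow> adapted t (\<lambda>h. f h + g h)" for t f g
      by (auto simp: adapted_def intro!: borel_measurable_add)
    show "adapted t f \<Longrightarrow> adapted t g \<Longrightarrow> adapted t (\<lambda>h. f h * g h)" for t f g
      by (auto simp: adapted_def intro!: borel_measurable_times)
    show "\<phi> \<in> borel_measurable borel \<Longrightarrow> adapted t f \<Longrightarrow> adapted t (\<lambda>h. \<phi> (f h))" for \<phi> t f
      by (auto simp: adapted_def)
    show "adapted (Suc t) f" if "Suc t < T" "adapted t f" for t f
    proof -
      note fp = that(2)[unfolded adapted_def, THEN conjunct2, rule_format]
      have "(\<lambda>h. f (past (Suc t) h)) \<in> borel_measurable (H (Suc (Suc t)) (Suc (Suc t)))"
        by (rule measurable_compose[OF measurable_past]) (use that in \<open>auto simp: adapted_def\<close>)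
      moreover have "f (past (Suc (Suc t)) h) = f h" for h
        by (metis fp past_past le_SucI order_refl)
      ultimately show ?thesis by (simp add: adapted_def fp)
    qed
    show "Suc t < T \<Longrightarrow> i < dx \<Longrightarrow> adapted (Suc t) (ws du (\<lambda>i j. B $$ (i, j)) t i)" for t i
      by (simp add: adapted_def ws_measurable ws_past)
    fix t f and \<psi> :: "(nat \<Rightarrow> real) \<Rightarrow> real"
    assume a: "Suc t < T" "adapted t f" "integrable (P B T) f" "\<psi> \<in> borel_measurable (PiM {..<dx} (\<lambda>_. borel))"
      "integrable (std_gauss dx) \<psi>"
    note fpx = a(2)[unfolded adapted_def, THEN conjunct2, rule_format]
    have fp: "(\<lambda>h. f (past (Suc t) h)) = f" by (simp add: fpx)
    have fm: "f \<in> borel_measurable (H (Suc t) (Suc t))" using a(2) by (simp add: adapted_def)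
    note e = expectation_past_noise[OF B _ _ fm _ a(4,5), of T, unfolded fp, OF _ a(1) a(3)]
    have c: "f h * \<psi> (noise B (Suc t) h) = f h * \<psi> (\<lambda>i\<in>{..<dx}. ws du (\<lambda>i j. B $$ (i, j)) t i h)"
      if "h \<in> space (P B T)" for h
      using noise_eq_ws[OF B, of h T t] that a(1) by (simp add: space_trajectory[OF B])
    show "integrable (P B T) (\<lambda>h. f h * \<psi> (\<lambda>i\<in>{..<dx}. ws du (\<lambda>i j. B $$ (i, j)) t i h)) \<and>
       expectation (\<lambda>h. f h * \<psi> (\<lambda>i\<in>{..<dx}. ws du (\<lambda>i j. B $$ (i, j)) t i h)) = expectation f * integral\<^sup>L (std_gauss dx) \<psi>"
      using e by (simp add: fpx c cong: Bochner_Integration.integrable_cong Bochner_Integration.integral_cong)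
  qed
qed

lemma lqr_process_trajectory:
  assumes B: "B \<in> carrier_mat dx du"
    and x: "\<And>t i. t < T \<Longrightarrow> i < dx \<Longrightarrow> prob_space.square_integrable (P B T) (xs t i)"
    and u: "\<And>t j. t < T \<Longrightarrow> j < du \<Longrightarrow> prob_space.square_integrable (P B T) (us t j)"
  shows "lqr_process (P B T) adapted dx T (ws du (\<lambda>i j. B $$ (i, j))) du xs us (\<lambda>i j. B $$ (i, j))"
proof -
  interpret adapted_process "P B T" adapted dx T "ws du (\<lambda>i j. B $$ (i, j))"
    by (rule adapted_process_trajectory[OF B])
  show ?thesis
  proof
    show "t < T \<Longrightarrow> i < dx \<Longrightarrow> adapted t (xs t i)" for t i by (simp add: adapted_def xs_measurable xs_past)
    show "t < T \<Longrightarrow> j < du \<Longrightarrow> adapted t (us t j)" for t j by (simp add: adapted_def us_measurable us_past)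
  qed (auto simp: x u ws_def)
qed

abbreviation "cost \<equiv> total_cost (1\<^sub>m dx) (1\<^sub>m du)"

lemma total_cost_eq:
  assumes "h \<in> space (H T T)"
  shows "cost T h = (\<Sum>t<T. (\<Sum>i<dx. (xs t i h)\<^sup>2) + (\<Sum>j<du. (us t j h)\<^sup>2))"
proof -
  have "cost T h = (\<Sum>t=1..T. fst h t \<bullet> (1\<^sub>m dx *\<^sub>v fst h t) + snd h t \<bullet> (1\<^sub>m du *\<^sub>v snd h t))"
    by (simp add: total_cost_def case_prod_beta')
  also have "\<dots> = (\<Sum>t=1..T. (\<Sum>i<dx. (fst h t $ i)\<^sup>2) + (\<Sum>j<du. (snd h t $ j)\<^sup>2))"
    using space_history[OF assms]
    by (intro sum.cong arg_cong2[where f="(+)"] one_smult_scalar_prod) auto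
  also have "{1..T} = Suc ` {..<T}" by (simp add: image_Suc_lessThan)
  finally show ?thesis by (simp add: sum.reindex xs_def us_def)
qed

lemma total_cost_measurable: "cost T \<in> borel_measurable (H T T)"
  by (subst measurable_cong[OF total_cost_eq], assumption)
     (intro borel_measurable_sum borel_measurable_add borel_measurable_power xs_measurable us_measurable; simp)

end

lemma expect_ereal:
  assumes "integrable M f"
  shows "expect M (\<lambda>h. ereal (f h)) = ereal (\<integral>h. f h \<partial>M)"
proof -
  from assms obtain r q where *: "0 \<le> r" "0 \<le> q" "(\<integral>\<^sup>+ x. ennreal (f x) \<partial>M) = ennreal r"
      "(\<integral>\<^sup>+ x. ennreal (- f x) \<partial>M) = ennreal q" "(\<integral>h. f h \<partial>M) = r - q"
    by (rule integrableE) auto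
  have "e2ennreal (- ereal (f h)) = ennreal (- f h)" "e2ennreal (ereal (f h)) = ennreal (f h)" for h
    by (simp_all add: ennreal.abs_eq e2ennreal_def max_def zero_ereal_def ennreal_def)
  then show ?thesis unfolding expect_def using * by (simp add: enn2ereal_ennreal)
qed

section \<open>Upper bound on the optimal cost\<close>

lemma static_feedback_algorithm:
  assumes K: "K \<in> carrier_mat du dx"
  shows "static_feedback K \<in> algorithms dx du"
  unfolding algorithms_def
proof (intro CollectI allI impI)
  fix t :: nat assume t: "1 \<le> t"
  have "(\<lambda>h. fst h t) \<in> history_space dx du t (t - 1) \<rightarrow>\<^sub>M vec_borel dx"
    unfolding history_space_def
    by (rule measurable_compose[OF measurable_fst measurable_component_singleton]) (use t in auto)
  from measurable_compose[OF measurable_mult_mat_vec[OF this K] measurable_return_prob_space]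
  show "static_feedback K t \<in> history_space dx du t (t - 1) \<rightarrow>\<^sub>M prob_algebra (vec_borel du)"
    using K by (simp add: static_feedback_def case_prod_beta')
qed

text \<open>A static feedback is an algorithm, so its law is an instance of the general trajectory
  law and its moments follow from the same orthogonality identity.\<close>

locale feedback_system = half_system dx du "static_feedback K" for dx du K +
  fixes B :: rmat
  assumes K: "K \<in> carrier_mat du dx" and B: "B \<in> carrier_mat dx du"
begin

text \<open>The covariance of the closed loop, as a quadratic form in the functional
  \<open>l\<close>: one step pulls \<open>l\<close> back through \<open>1/2 + B K\<close>, and the
  noise adds the squared length of \<open>l\<close>.\<close>

primrec second_moment :: "nat \<Rightarrow> (nat \<Rightarrow> real) \<Rightarrow> real" where
  "second_moment 0 l = 0"
| "second_moment (Suc t) l = second_moment t (\<lambda>k. l k / 2 + (\<Sum>j<du. (\<Sum>i<dx. l i * B $$ (i, j)) * K $$ (j, k))) + (\<Sum>i<dx. (l i)\<^sup>2)"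

text \<open>From a start at rest the covariance can only grow. The induction is over all
  \<open>l\<close> because each step pulls \<open>l\<close> back.\<close>

lemma second_moment_mono: "second_moment t l \<le> second_moment (Suc t) l"
proof (induction t arbitrary: l)
  case 0
  show ?case by (simp add: sum_nonneg)
next
  case (Suc t)
  show ?case
    unfolding second_moment.simps(2)[of "Suc t" l] second_moment.simps(2)[of t l]
    by (rule add_right_mono[OF Suc.IH])
qed

lemma AE_pastI:
  assumes S: "S \<in> sets (H n n)" and nT: "n \<le> T" and 0: "(\<integral>\<^sup>+ h. indicator S h \<partial>P B n) = 0"
  shows "AE h in P B T. past n h \<notin> S"
proof -
  have m: "(\<lambda>h. indicator S (past n h) :: ennreal) \<in> borel_measurable (P B T)"
    using measurable_compose[OF measurable_past[OF nT], of "indicator S :: _ \<Rightarrow> ennreal" borel] S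
    by (simp add: measurable_trajectory[OF B])
  have "(\<integral>\<^sup>+ h. indicator S (past n h) \<partial>P B T) = (\<integral>\<^sup>+ h. indicator S h \<partial>P B n)"
    by (rule nn_integral_past[OF B _ nT]) (use S in simp)
  then have "AE h in P B T. indicator S (past n h) = (0 :: ennreal)"
    using 0 nn_integral_0_iff_AE[OF m] by simp
  then show ?thesis by eventually_elim (auto simp: indicator_def split: if_splits)
qed

text \<open>The algorithm's kernel is a point mass, so the event that the input differs from the
  feedback has integral 0 within its own step.\<close>

lemma feedback_AE:
  assumes t: "t < T" and j: "j < du"
  shows "AE h in P B T. us t j h = (\<Sum>i<dx. K $$ (j, i) * xs t i h)"
proof -
  let ?n = "Suc t"
  define S where "S = {h \<in> space (H ?n ?n). us t j h \<noteq> (\<Sum>i<dx. K $$ (j, i) * xs t i h)}"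
  have S: "S \<in> sets (H ?n ?n)"
    unfolding S_def by (intro borel_measurable_neq borel_measurable_sum borel_measurable_times borel_measurable_const
        us_measurable xs_measurable) (use j in auto)
  then have f: "(indicator S :: history \<Rightarrow> ennreal) \<in> borel_measurable (H ?n ?n)" by simp
  have "(\<integral>\<^sup>+ h. indicator S h \<partial>P B ?n) = (\<integral>\<^sup>+ h. \<integral>\<^sup>+ x'. 0 \<partial>next_state (half_id dx) B (1\<^sub>m dx) t h \<partial>P B t)"
    unfolding nn_integral_trajectory_Suc[OF B f]
  proof (intro nn_integral_cong)
    fix h x' assume "h \<in> space (P B t)" and x': "x' \<in> space (next_state (half_id dx) B (1\<^sub>m dx) t h)"
    then have h: "h \<in> space (H t t)" by (simp add: space_trajectory[OF B])
    have x': "x' \<in> carrier_vec dx" using x' next_state_prob(3)[OF B h] by simp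
    have Kx: "K *\<^sub>v x' \<in> carrier_vec du" using K x' by auto
    have "(\<lambda>u'. indicator S (push t h x' u') :: ennreal) \<in> borel_measurable (vec_borel du)"
      using measurable_compose[OF measurable_Pair1' measurable_compose[OF measurable_push f], of "(h, x')"] h x'
      by (simp add: space_pair_measure)
    then have "act t (indicator S) h x' = indicator S (push t h x' (K *\<^sub>v x'))"
      unfolding act_def using K Kx by (simp add: static_feedback_def nn_integral_return)
    also have "\<dots> = 0"
      using mult_mat_vec_sum[OF K x' j] by (simp add: S_def us_def xs_def push_def)
    finally show "act t (indicator S) h x' = 0" .
  qed
  then have "AE h in P B T. past ?n h \<notin> S"
    by (intro AE_pastI[OF S]) (use t in auto)
  moreover have "AE h in P B T. past ?n h \<in> space (H ?n ?n)"
    using measurable_space[OF measurable_past[of ?n T]] t by (intro AE_I2) (auto simp: space_trajectory[OF B])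
  ultimately show ?thesis
    by eventually_elim (auto simp: S_def us_past xs_past)
qed

lemma initial_AE:
  assumes T: "0 < T" and i: "i < dx"
  shows "AE h in P B T. xs 0 i h = 0"
proof -
  define S where "S = {h \<in> space (H 1 1). xs 0 i h \<noteq> 0}"
  have S: "S \<in> sets (H 1 1)"
    unfolding S_def by (intro borel_measurable_neq borel_measurable_const xs_measurable) (use i in auto)
  then have f: "(indicator S :: history \<Rightarrow> ennreal) \<in> borel_measurable (H (Suc 0) (Suc 0))" by simp
  have "(\<integral>\<^sup>+ h. indicator S h \<partial>P B (Suc 0)) = (\<integral>\<^sup>+ h. 0 \<partial>P B 0)"
    unfolding nn_integral_trajectory_Suc[OF B f]
  proof (intro nn_integral_cong)
    fix h assume "h \<in> space (P B 0)"
    then have h: "h \<in> space (H 0 0)" by (simp only: space_trajectory[OF B])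
    have "next_state (half_id dx) B (1\<^sub>m dx) 0 h = return (vec_borel dx) (0\<^sub>v dx)"
      by (simp add: next_state_def case_prod_beta' half_id_def)
    then have "(\<integral>\<^sup>+ x'. act 0 (indicator S) h x' \<partial>next_state (half_id dx) B (1\<^sub>m dx) 0 h) = act 0 (indicator S) h (0\<^sub>v dx)"
      using measurable_act'[OF f h] by (simp add: nn_integral_return)
    also have "\<dots> = 0"
      by (rule act_const[OF h]) (use i in \<open>auto simp: S_def xs_def push_def\<close>)
    finally show "(\<integral>\<^sup>+ x'. act 0 (indicator S) h x' \<partial>next_state (half_id dx) B (1\<^sub>m dx) 0 h) = 0" .
  qed
  then have "AE h in P B T. past 1 h \<notin> S"
    by (intro AE_pastI[OF S]) (use T in auto)
  moreover have "AE h in P B T. past 1 h \<in> space (H 1 1)"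
    using measurable_space[OF measurable_past[of 1 T]] T by (intro AE_I2) (auto simp: space_trajectory[OF B])
  ultimately show ?thesis
    by eventually_elim (auto simp: S_def xs_past)
qed

text \<open>Square integrability and exact moments are proved together: \<open>noise_square\<close>
  needs the former at time \<open>t\<close> to yield both for the states at \<open>t + 1\<close>,
  and the inputs follow through the feedback.\<close>

lemma moments:
  assumes "t < T"
  shows "(\<forall>i<dx. prob_space.square_integrable (P B T) (xs t i)) \<and>
    (\<forall>j<du. prob_space.square_integrable (P B T) (us t j)) \<and>
    (\<forall>l. (\<integral>h. (\<Sum>i<dx. l i * xs t i h)\<^sup>2 \<partial>P B T) = second_moment t l)"
proof -
  interpret adapted_process "P B T" adapted dx T "ws du (\<lambda>i j. B $$ (i, j))"
    by (rule adapted_process_trajectory[OF B])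
  have xm: "xs s i \<in> borel_measurable (P B T)" if "s < T" "i < dx" for s i
    using xs_measurable[OF that] by (simp add: measurable_trajectory[OF B])
  have um: "us s j \<in> borel_measurable (P B T)" if "s < T" "j < du" for s j
    using us_measurable[OF that] by (simp add: measurable_trajectory[OF B])
  have cong: "square_integrable f" if g: "square_integrable g" and f: "f \<in> borel_measurable (P B T)" and ae: "AE h in P B T. f h = g h" for f g
  proof -
    have "integrable (P B T) (\<lambda>h. (f h)\<^sup>2) = integrable (P B T) (\<lambda>h. (g h)\<^sup>2)"
      by (rule integrable_cong_AE) (use f g ae in \<open>auto simp: square_integrable_def\<close>)
    then show ?thesis using f g by (simp add: square_integrable_def)
  qed
  have us_sq: "square_integrable (us s j)" if s: "s < T" "j < du" and x: "\<And>i. i < dx \<Longrightarrow> square_integrable (xs s i)" for s j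
    by (rule cong[OF _ um feedback_AE])
       (use s in \<open>auto intro!: square_integrable_sum square_integrable_cmult x\<close>)
  show ?thesis using assms
  proof (induction t)
    case 0
    have x: "square_integrable (xs 0 i)" if "i < dx" for i
      by (rule cong[OF square_integrable_const[of 0] xm initial_AE]) (use that 0 in auto)
    have "(\<integral>h. (\<Sum>i<dx. l i * xs 0 i h)\<^sup>2 \<partial>P B T) = second_moment 0 l" for l
    proof -
      have "AE h in P B T. \<forall>i\<in>{..<dx}. xs 0 i h = 0"
        by (subst AE_finite_all) (use initial_AE 0 in auto)
      then have "(\<integral>h. (\<Sum>i<dx. l i * xs 0 i h)\<^sup>2 \<partial>P B T) = (\<integral>h. 0 \<partial>P B T)"
        using xm 0 by (intro integral_cong_AE) (auto elim: eventually_mono)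
      then show ?thesis by simp
    qed
    then show ?case using x us_sq[of 0] 0 by auto
  next
    case (Suc t)
    then have tT: "t < T" by simp
    have x: "\<And>i. i < dx \<Longrightarrow> square_integrable (xs t i)" and u: "\<And>j. j < du \<Longrightarrow> square_integrable (us t j)"
      and sm: "\<And>l. (\<integral>h. (\<Sum>i<dx. l i * xs t i h)\<^sup>2 \<partial>P B T) = second_moment t l"
      using Suc.IH[OF tT] by auto
    define m where "m = (\<lambda>i h. xs t i h / 2 + (\<Sum>j<du. B $$ (i, j) * us t j h))"
    have ms: "square_integrable (m i)" if "i < dx" for i
      unfolding m_def using that x u
      by (intro square_integrable_add square_integrable_divide square_integrable_sum square_integrable_cmult) auto
    have ma: "adapted t (m i)" if "i < dx" for i
      unfolding m_def using that
      by (intro adapted_intros) (auto simp: adapted_def xs_measurable us_measurable xs_past us_past)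
    have step: "xs (Suc t) i h = m i h + ws du (\<lambda>i j. B $$ (i, j)) t i h" for i h
      by (simp add: ws_def m_def)
    note N = noise_square[OF Suc.prems, where g="\<lambda>v. v"]
    have comb: "square_integrable (\<lambda>h. \<Sum>i<dx. l i * xs (Suc t) i h)"
      "(\<integral>h. (\<Sum>i<dx. l i * xs (Suc t) i h)\<^sup>2 \<partial>P B T) = (\<integral>h. (\<Sum>i<dx. l i * m i h)\<^sup>2 \<partial>P B T) + (\<Sum>i<dx. (l i)\<^sup>2)" for l
    proof -
      have eq: "(\<Sum>i<dx. l i * xs (Suc t) i h) = (\<Sum>i<dx. l i * m i h) + (\<Sum>i\<in>{..<dx}. l i * ws du (\<lambda>i j. B $$ (i, j)) t i h)" for h
        by (simp add: step ring_distribs sum.distrib)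
      have a: "adapted t (\<lambda>h. \<Sum>i<dx. l i * m i h)" "square_integrable (\<lambda>h. \<Sum>i<dx. l i * m i h)"
        using ma ms by (auto intro!: adapted_intros square_integrable_sum square_integrable_cmult)
      show "square_integrable (\<lambda>h. \<Sum>i<dx. l i * xs (Suc t) i h)" unfolding eq
        by (rule N(1)[OF a, where f="\<lambda>i _. l i"])
           (auto simp: adapted_const square_integrable_const std_normal_mean std_normal_power)
      show "(\<integral>h. (\<Sum>i<dx. l i * xs (Suc t) i h)\<^sup>2 \<partial>P B T) = (\<integral>h. (\<Sum>i<dx. l i * m i h)\<^sup>2 \<partial>P B T) + (\<Sum>i<dx. (l i)\<^sup>2)"
        unfolding eq
        by (subst N(2)[OF a, where f="\<lambda>i _. l i"])
           (auto simp: adapted_const square_integrable_const std_normal_mean std_normal_second std_normal_power prob_space)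
    qed
    have x': "square_integrable (xs (Suc t) i)" if "i < dx" for i
    proof -
      have "(\<Sum>k<dx. (if k = i then 1 else 0) * xs (Suc t) k h) = xs (Suc t) i h" for h
        using that by (simp add: if_distrib[where f="\<lambda>c. c * _"] cong: if_cong)
      then show ?thesis using comb(1)[of "\<lambda>k. if k = i then 1 else 0"] by simp
    qed
    have "(\<integral>h. (\<Sum>i<dx. l i * m i h)\<^sup>2 \<partial>P B T) =
        second_moment t (\<lambda>k. l k / 2 + (\<Sum>j<du. (\<Sum>i<dx. l i * B $$ (i, j)) * K $$ (j, k)))" for l
    proof -
      let ?L = "\<lambda>k. l k / 2 + (\<Sum>j<du. (\<Sum>i<dx. l i * B $$ (i, j)) * K $$ (j, k))"
      have "AE h in P B T. \<forall>j\<in>{..<du}. us t j h = (\<Sum>i<dx. K $$ (j, i) * xs t i h)"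
        by (subst AE_finite_all) (use feedback_AE[OF tT] in auto)
      then have "AE h in P B T. (\<Sum>i<dx. l i * m i h)\<^sup>2 = (\<Sum>k<dx. ?L k * xs t k h)\<^sup>2"
      proof eventually_elim
        case (elim h)
        have "(\<Sum>i<dx. l i * m i h) = (\<Sum>i<dx. l i / 2 * xs t i h) + (\<Sum>i<dx. \<Sum>j<du. l i * B $$ (i, j) * us t j h)"
          by (simp add: m_def ring_distribs sum.distrib sum_distrib_left mult.assoc)
        also have "(\<Sum>i<dx. \<Sum>j<du. l i * B $$ (i, j) * us t j h) = (\<Sum>j<du. (\<Sum>i<dx. l i * B $$ (i, j)) * us t j h)"
          by (subst sum.swap) (simp add: sum_distrib_right)
        also have "\<dots> = (\<Sum>j<du. \<Sum>k<dx. (\<Sum>i<dx. l i * B $$ (i, j)) * K $$ (j, k) * xs t k h)"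
          using elim by (intro sum.cong) (auto simp: sum_distrib_left mult.assoc)
        also have "\<dots> = (\<Sum>k<dx. (\<Sum>j<du. (\<Sum>i<dx. l i * B $$ (i, j)) * K $$ (j, k)) * xs t k h)"
          by (subst sum.swap) (simp add: sum_distrib_right)
        finally have "(\<Sum>i<dx. l i * m i h) = (\<Sum>k<dx. ?L k * xs t k h)"
          by (simp add: ring_distribs sum.distrib)
        then show ?case by simp
      qed
      then have "(\<integral>h. (\<Sum>i<dx. l i * m i h)\<^sup>2 \<partial>P B T) = (\<integral>h. (\<Sum>k<dx. ?L k * xs t k h)\<^sup>2 \<partial>P B T)"
        using ms xm[OF tT] by (intro integral_cong_AE) (auto simp: square_integrable_def intro!: borel_measurable_power borel_measurable_sum borel_measurable_times)
      then show ?thesis by (simp add: sm)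
    qed
    then show ?case using comb x' us_sq[OF Suc.prems] by auto
  qed
qed

definition step_cost :: "nat \<Rightarrow> real" where
  "step_cost t = (\<Sum>i<dx. second_moment t (\<lambda>k. if k = i then 1 else 0)) + (\<Sum>j<du. second_moment t (\<lambda>k. K $$ (j, k)))"

lemma unit_combination: "i < dx \<Longrightarrow> (\<Sum>k<dx. (if k = i then 1 else 0) * f k) = (f i :: real)"
  by (simp add: if_distrib[where f="\<lambda>c. c * _"] cong: if_cong)

lemma expected_total_cost:
  "expect (P B T) (\<lambda>h. ereal (cost T h)) = ereal (\<Sum>t<T. step_cost t)"
proof -
  interpret prob_space "P B T" by (rule prob_space_trajectory[OF B])
  let ?C = "\<lambda>h. \<Sum>t<T. (\<Sum>i<dx. (xs t i h)\<^sup>2) + (\<Sum>j<du. (us t j h)\<^sup>2)"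
  have xi: "has_bochner_integral (P B T) (\<lambda>h. (xs t i h)\<^sup>2) (second_moment t (\<lambda>k. if k = i then 1 else 0))"
    if "t < T" "i < dx" for t i
    using moments[OF that(1)] that(2) spec[of "\<lambda>l. (\<integral>h. (\<Sum>i<dx. l i * xs t i h)\<^sup>2 \<partial>P B T) = second_moment t l" "\<lambda>k. if k = i then 1 else 0"]
    unfolding unit_combination[OF that(2)] by (auto simp: has_bochner_integral_iff square_integrable_def)
  have ui: "has_bochner_integral (P B T) (\<lambda>h. (us t j h)\<^sup>2) (second_moment t (\<lambda>k. K $$ (j, k)))"
    if "t < T" "j < du" for t j
  proof -
    have xm: "xs t i \<in> borel_measurable (P B T)" if "i < dx" for i
      using moments[OF \<open>t < T\<close>] that by (auto simp: square_integrable_def)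
    have um: "us t j \<in> borel_measurable (P B T)"
      using moments[OF \<open>t < T\<close>] that by (auto simp: square_integrable_def)
    have "(\<integral>h. (us t j h)\<^sup>2 \<partial>P B T) = (\<integral>h. (\<Sum>k<dx. K $$ (j, k) * xs t k h)\<^sup>2 \<partial>P B T)"
      using feedback_AE[OF that] xm um by (intro integral_cong_AE) (auto elim: eventually_mono)
    then show ?thesis
      using moments[OF that(1)] that(2) by (auto simp: has_bochner_integral_iff square_integrable_def)
  qed
  have C: "has_bochner_integral (P B T) ?C (\<Sum>t<T. step_cost t)"
    unfolding step_cost_def
    by (intro has_bochner_integral_sum has_bochner_integral_add xi ui) auto
  have "has_bochner_integral (P B T) (cost T) r = has_bochner_integral (P B T) ?C r" for r
    by (rule has_bochner_integral_cong[OF refl _ refl]) (simp only: space_trajectory[OF B] total_cost_eq)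
  with C have "has_bochner_integral (P B T) (cost T) (\<Sum>t<T. step_cost t)"
    by simp
  then show ?thesis
    by (subst expect_ereal) (auto simp: has_bochner_integral_iff)
qed

lemma step_cost_mono: "step_cost t \<le> step_cost (Suc t)"
  unfolding step_cost_def by (intro add_mono sum_mono second_moment_mono)

text \<open>\<open>lqr_cost\<close> is a \<open>lim\<close>, which is informative only if the limit
  exists. Averages of a growing sequence grow, and bounded ones then converge.\<close>

lemma average_step_cost_mono: "incseq (\<lambda>T. (\<Sum>t<T. step_cost t) / real T)"
proof (rule incseq_SucI)
  fix T
  have m: "step_cost s \<le> step_cost t" if "s \<le> t" for s t
    by (rule lift_Suc_mono_le[of step_cost, OF step_cost_mono that])
  have 0: "0 \<le> step_cost t" for t
    using m[of 0 t] by (simp add: step_cost_def)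
  show "(\<Sum>t<T. step_cost t) / real T \<le> (\<Sum>t<Suc T. step_cost t) / real (Suc T)"
  proof (cases "T = 0")
    case False
    have "(\<Sum>t<T. step_cost t) \<le> (\<Sum>t<T. step_cost T)"
      by (intro sum_mono m) auto
    then show ?thesis using False by (simp add: field_simps)
  qed (simp add: 0)
qed

lemma lqr_cost_le:
  assumes "\<And>T. (\<Sum>t<T. step_cost t) \<le> real T * J"
  shows "lqr_cost (1\<^sub>m dx) (1\<^sub>m du) (1\<^sub>m dx) (half_id dx) B K \<le> ereal J"
proof -
  let ?a = "\<lambda>T. (\<Sum>t<T. step_cost t) / real T"
  have J0: "0 \<le> J" using assms[of 1] by (simp add: step_cost_def)
  have aJ: "?a T \<le> J" for T
    using assms[of T] J0 by (cases "T = 0") (auto simp: field_simps)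
  obtain L where L: "?a \<longlonglongrightarrow> L" "\<forall>T. ?a T \<le> L"
    using incseq_convergent[OF average_step_cost_mono] aJ by blast
  have "expect (P B T) (\<lambda>h. ereal (cost T h)) / ereal (real T) = ereal (?a T)" for T
    unfolding expected_total_cost by (cases "T = 0") auto
  then have "lqr_cost (1\<^sub>m dx) (1\<^sub>m du) (1\<^sub>m dx) (half_id dx) B K = lim (\<lambda>T. ereal (?a T))"
    unfolding lqr_cost_def by simp
  also have "\<dots> = ereal L"
    by (rule limI) (use L in simp)
  also have "L \<le> J"
    by (rule LIMSEQ_le_const2[OF L(1)]) (use aJ in auto)
  finally show ?thesis by simp
qed

end

text \<open>At \<open>B = 0\<close> the value function is 4/3 times the squared length; minimizing
  one step of it to first order in \<open>B\<close> gives the feedback factor -2/3. To second order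
  the coefficient of the squares of \<open>v\<close> would be 16/27; the weaker 1/3 leaves room for
  the terms in \<open>r\<close>, of fourth order in \<open>B\<close> and at most 1/16 of those in
  \<open>v\<close>.\<close>

lemma lyapunov_step:
  fixes x :: "nat \<Rightarrow> real" and b :: "nat \<Rightarrow> nat \<Rightarrow> real" and n m :: nat
  defines "v \<equiv> \<lambda>j. \<Sum>i<n. b i j * x i"
  defines "r \<equiv> \<lambda>i. \<Sum>j<m. b i j * v j"
  defines "q \<equiv> \<lambda>j. \<Sum>i<n. b i j * r i"
  assumes b: "(\<Sum>j<m. \<Sum>i<n. (b i j)\<^sup>2) \<le> 1 / 16"
  shows "4 / 3 * (\<Sum>i<n. (x i / 2 - 2 / 3 * r i)\<^sup>2) - 1 / 3 * (\<Sum>j<m. (v j / 2 - 2 / 3 * q j)\<^sup>2)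
     + (\<Sum>i<n. (x i)\<^sup>2) + (\<Sum>j<m. (2 / 3 * v j)\<^sup>2) \<le> 4 / 3 * (\<Sum>i<n. (x i)\<^sup>2) - 1 / 3 * (\<Sum>j<m. (v j)\<^sup>2)"
    and "(\<Sum>j<m. (v j)\<^sup>2) \<le> (\<Sum>i<n. (x i)\<^sup>2) / 16"
proof -
  let ?b = "\<Sum>j<m. \<Sum>i<n. (b i j)\<^sup>2"
  have xr: "(\<Sum>i<n. x i * r i) = (\<Sum>j<m. (v j)\<^sup>2)"
  proof -
    have "(\<Sum>i<n. x i * r i) = (\<Sum>i<n. \<Sum>j<m. b i j * x i * v j)"
      by (simp add: r_def sum_distrib_left mult_ac)
    also have "\<dots> = (\<Sum>j<m. \<Sum>i<n. b i j * x i * v j)" by (rule sum.swap)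
    also have "\<dots> = (\<Sum>j<m. (v j)\<^sup>2)" by (simp add: power2_eq_square sum_distrib_right[symmetric] v_def)
    finally show ?thesis .
  qed
  have vq: "(\<Sum>j<m. v j * q j) = (\<Sum>i<n. (r i)\<^sup>2)"
  proof -
    have "(\<Sum>j<m. v j * q j) = (\<Sum>j<m. \<Sum>i<n. b i j * v j * r i)"
      by (simp add: q_def sum_distrib_left mult_ac)
    also have "\<dots> = (\<Sum>i<n. \<Sum>j<m. b i j * v j * r i)" by (rule sum.swap)
    also have "\<dots> = (\<Sum>i<n. (r i)\<^sup>2)" by (simp add: power2_eq_square sum_distrib_right[symmetric] r_def)
    finally show ?thesis .
  qed
  have rr: "(\<Sum>i<n. (r i)\<^sup>2) \<le> (\<Sum>j<m. (v j)\<^sup>2) / 16"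
  proof -
    have "(\<Sum>i<n. (r i)\<^sup>2) \<le> (\<Sum>i<n. (\<Sum>j<m. (b i j)\<^sup>2) * (\<Sum>j<m. (v j)\<^sup>2))"
      unfolding r_def by (intro sum_mono Cauchy_Schwarz_ineq_sum)
    also have "\<dots> = ?b * (\<Sum>j<m. (v j)\<^sup>2)"
      by (subst sum.swap) (simp add: sum_distrib_right)
    also have "\<dots> \<le> 1 / 16 * (\<Sum>j<m. (v j)\<^sup>2)"
      using b by (intro mult_right_mono sum_nonneg) auto
    finally show ?thesis by simp
  qed
  show "(\<Sum>j<m. (v j)\<^sup>2) \<le> (\<Sum>i<n. (x i)\<^sup>2) / 16"
  proof -
    have "(\<Sum>j<m. (v j)\<^sup>2) \<le> (\<Sum>j<m. (\<Sum>i<n. (b i j)\<^sup>2) * (\<Sum>i<n. (x i)\<^sup>2))"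
      unfolding v_def by (intro sum_mono Cauchy_Schwarz_ineq_sum)
    also have "\<dots> = ?b * (\<Sum>i<n. (x i)\<^sup>2)"
      by (simp add: sum_distrib_right)
    also have "\<dots> \<le> 1 / 16 * (\<Sum>i<n. (x i)\<^sup>2)"
      using b by (intro mult_right_mono sum_nonneg) auto
    finally show ?thesis by simp
  qed
  have e1: "(\<Sum>i<n. (x i / 2 - 2 / 3 * r i)\<^sup>2) = (\<Sum>i<n. (x i)\<^sup>2) / 4 - 2 / 3 * (\<Sum>j<m. (v j)\<^sup>2) + 4 / 9 * (\<Sum>i<n. (r i)\<^sup>2)"
    unfolding xr[symmetric] sum_distrib_left sum_divide_distrib sum.distrib[symmetric] sum_subtractf[symmetric]
    by (intro sum.cong refl) (simp add: power2_eq_square field_simps)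
  have e2: "(\<Sum>j<m. (v j / 2 - 2 / 3 * q j)\<^sup>2) = (\<Sum>j<m. (v j)\<^sup>2) / 4 - 2 / 3 * (\<Sum>i<n. (r i)\<^sup>2) + 4 / 9 * (\<Sum>j<m. (q j)\<^sup>2)"
    unfolding vq[symmetric] sum_distrib_left sum_divide_distrib sum.distrib[symmetric] sum_subtractf[symmetric]
    by (intro sum.cong refl) (simp add: power2_eq_square field_simps)
  have e3: "(\<Sum>j<m. (2 / 3 * v j)\<^sup>2) = 4 / 9 * (\<Sum>j<m. (v j)\<^sup>2)"
    by (simp add: power_mult_distrib power_divide sum_distrib_left)
  have "0 \<le> (\<Sum>j<m. (q j)\<^sup>2)" "0 \<le> (\<Sum>j<m. (v j)\<^sup>2)" by (auto intro: sum_nonneg)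
  then show "4 / 3 * (\<Sum>i<n. (x i / 2 - 2 / 3 * r i)\<^sup>2) - 1 / 3 * (\<Sum>j<m. (v j / 2 - 2 / 3 * q j)\<^sup>2)
     + (\<Sum>i<n. (x i)\<^sup>2) + (\<Sum>j<m. (2 / 3 * v j)\<^sup>2) \<le> 4 / 3 * (\<Sum>i<n. (x i)\<^sup>2) - 1 / 3 * (\<Sum>j<m. (v j)\<^sup>2)"
    unfolding e1 e2 e3 using rr by (simp add: algebra_simps)
qed

text \<open>The feedback \<open>-2/3 B\<^sup>T\<close> is optimal to first order; \<open>4/3 |x|\<^sup>2 - 1/3 |B\<^sup>T x|\<^sup>2\<close> is a Lyapunov function for it.\<close>

lemma opt_cost_le:
  assumes B: "B \<in> carrier_mat dx du" and small: "(\<Sum>j<du. \<Sum>i<dx. (B $$ (i, j))\<^sup>2) \<le> 1 / 16"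
  shows "opt_cost (1\<^sub>m dx) (1\<^sub>m du) (1\<^sub>m dx) (half_id dx) B
    \<le> ereal (4 / 3 * real dx - 1 / 3 * (\<Sum>j<du. \<Sum>i<dx. (B $$ (i, j))\<^sup>2))"
proof -
  define K where "K = Matrix.mat du dx (\<lambda>(j, i). - (2 / 3) * B $$ (i, j))"
  have K: "K \<in> carrier_mat du dx" by (simp add: K_def)
  have Kji: "K $$ (j, i) = - (2 / 3) * B $$ (i, j)" if "j < du" "i < dx" for i j
    using that by (simp add: K_def)
  interpret feedback_system dx du K B
    by unfold_locales (use K B static_feedback_algorithm in auto)
  let ?b = "\<Sum>j<du. \<Sum>i<dx. (B $$ (i, j))\<^sup>2"
  let ?d = "\<lambda>i k :: nat. if k = i then 1 else (0 :: real)"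
  let ?B = "\<lambda>j i. B $$ (i, j)"
  \<comment> \<open>\<open>J\<close> is the trace of the Lyapunov form, the amount by which the
    noise of one step raises its expectation.\<close>
  define J where "J = 4 / 3 * real dx - 1 / 3 * ?b"
  define V where "V = (\<lambda>t. 4 / 3 * (\<Sum>i<dx. second_moment t (?d i)) - 1 / 3 * (\<Sum>j<du. second_moment t (?B j)))"
  have hb0: "has_bochner_integral (P B T) (\<lambda>h. (\<Sum>k<dx. l k * xs t k h)\<^sup>2) (second_moment t l)" if "t < T" for t T l
  proof -
    interpret prob_space "P B T" by (rule prob_space_trajectory[OF B])
    have "square_integrable (\<lambda>h. \<Sum>k<dx. l k * xs t k h)"
      using moments[OF that] by (intro square_integrable_sum square_integrable_cmult) auto
    then show ?thesis using moments[OF that]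
      by (auto simp: has_bochner_integral_iff square_integrable_def)
  qed
  \<comment> \<open>\<open>Suc t\<close> is the shortest horizon that contains the state
    \<open>xs t\<close>.\<close>
  define M where "M = (\<lambda>t. P B (Suc t))"
  have hb: "has_bochner_integral (M t) (\<lambda>h. (\<Sum>k<dx. l k * xs t k h)\<^sup>2) (second_moment t l)" for t l
    unfolding M_def by (rule hb0) (rule lessI)
  have V0: "0 \<le> V t" for t
  proof -
    have hv: "has_bochner_integral (M t) (\<lambda>h. 4 / 3 * (\<Sum>i<dx. (\<Sum>k<dx. ?d i k * xs t k h)\<^sup>2)
        - 1 / 3 * (\<Sum>j<du. (\<Sum>k<dx. ?B j k * xs t k h)\<^sup>2)) (V t)"
      unfolding V_def
      by (intro has_bochner_integral_diff has_bochner_integral_mult_right has_bochner_integral_sum hb)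
    have "0 \<le> 4 / 3 * (\<Sum>i<dx. (\<Sum>k<dx. ?d i k * xs t k h)\<^sup>2) - 1 / 3 * (\<Sum>j<du. (\<Sum>k<dx. ?B j k * xs t k h)\<^sup>2)" for h
    proof -
      have "(\<Sum>j<du. (\<Sum>k<dx. ?B j k * xs t k h)\<^sup>2) \<le> (\<Sum>i<dx. (xs t i h)\<^sup>2) / 16"
        by (rule lyapunov_step(2)[OF small])
      moreover have "(\<Sum>i<dx. (\<Sum>k<dx. ?d i k * xs t k h)\<^sup>2) = (\<Sum>i<dx. (xs t i h)\<^sup>2)"
        by (intro sum.cong refl) (simp add: unit_combination)
      moreover have "0 \<le> (\<Sum>i<dx. (xs t i h)\<^sup>2)" by (intro sum_nonneg) simp
      ultimately show ?thesis by linarith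
    qed
    then have "0 \<le> (\<integral>h. 4 / 3 * (\<Sum>i<dx. (\<Sum>k<dx. ?d i k * xs t k h)\<^sup>2)
        - 1 / 3 * (\<Sum>j<du. (\<Sum>k<dx. ?B j k * xs t k h)\<^sup>2) \<partial>M t)"
      by (intro integral_nonneg_AE AE_I2)
    then show ?thesis using has_bochner_integral_integral_eq[OF hv] by (simp only:)
  qed
  let ?L = "\<lambda>l k. l k / 2 + (\<Sum>j<du. (\<Sum>i<dx. l i * B $$ (i, j)) * K $$ (j, k))"
  have VSuc: "V (Suc t) + step_cost t \<le> V t + J" for t
  proof -
    let ?X = "4 / 3 * (\<Sum>i<dx. second_moment t (?L (?d i))) - 1 / 3 * (\<Sum>j<du. second_moment t (?L (?B j))) + step_cost t"
    have "(\<Sum>k<dx. (?d i k)\<^sup>2) = 1" if "i < dx" for i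
      using that by (simp add: if_distrib[where f="\<lambda>c. c\<^sup>2"] cong: if_cong)
    then have "V (Suc t) + step_cost t = ?X + J"
      unfolding V_def second_moment.simps J_def by (simp add: sum.distrib algebra_simps)
    moreover have "?X \<le> V t"
    proof -
      let ?f = "\<lambda>h. 4 / 3 * (\<Sum>i<dx. (\<Sum>k<dx. ?L (?d i) k * xs t k h)\<^sup>2) - 1 / 3 * (\<Sum>j<du. (\<Sum>k<dx. ?L (?B j) k * xs t k h)\<^sup>2)
         + ((\<Sum>i<dx. (\<Sum>k<dx. ?d i k * xs t k h)\<^sup>2) + (\<Sum>j<du. (\<Sum>k<dx. K $$ (j, k) * xs t k h)\<^sup>2))"
      let ?g = "\<lambda>h. 4 / 3 * (\<Sum>i<dx. (\<Sum>k<dx. ?d i k * xs t k h)\<^sup>2) - 1 / 3 * (\<Sum>j<du. (\<Sum>k<dx. ?B j k * xs t k h)\<^sup>2)"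
      have f: "has_bochner_integral (M t) ?f ?X"
        unfolding step_cost_def
        by (intro has_bochner_integral_add has_bochner_integral_diff has_bochner_integral_mult_right has_bochner_integral_sum hb)
      have g: "has_bochner_integral (M t) ?g (V t)"
        unfolding V_def
        by (intro has_bochner_integral_diff has_bochner_integral_mult_right has_bochner_integral_sum hb)
      have "?f h \<le> ?g h" for h
      proof -
        define x where "x = (\<lambda>k. xs t k h)"
        define v where "v = (\<lambda>j. \<Sum>i<dx. B $$ (i, j) * x i)"
        define r where "r = (\<lambda>i. \<Sum>j<du. B $$ (i, j) * v j)"
        have Kx: "(\<Sum>k<dx. K $$ (j, k) * x k) = - (2 / 3) * v j" if "j < du" for j
          using that by (simp add: v_def sum_distrib_left Kji sum_negf mult.assoc)
        have L: "(\<Sum>k<dx. ?L l k * x k) = (\<Sum>k<dx. l k * x k) / 2 - 2 / 3 * (\<Sum>i<dx. l i * r i)" for l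
        proof -
          have "(\<Sum>k<dx. ?L l k * x k) = (\<Sum>k<dx. l k * x k) / 2 + (\<Sum>k<dx. \<Sum>j<du. (\<Sum>i<dx. l i * B $$ (i, j)) * (K $$ (j, k) * x k))"
            by (simp add: ring_distribs sum.distrib sum_distrib_right sum_divide_distrib mult.assoc)
          also have "(\<Sum>k<dx. \<Sum>j<du. (\<Sum>i<dx. l i * B $$ (i, j)) * (K $$ (j, k) * x k)) =
              (\<Sum>j<du. (\<Sum>i<dx. l i * B $$ (i, j)) * (\<Sum>k<dx. K $$ (j, k) * x k))"
            by (subst sum.swap) (simp add: sum_distrib_left)
          also have "\<dots> = (\<Sum>j<du. \<Sum>i<dx. - (2 / 3) * (l i * (B $$ (i, j) * v j)))"
          proof (intro sum.cong refl)
            fix j assume "j \<in> {..<du}"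
            then show "(\<Sum>i<dx. l i * B $$ (i, j)) * (\<Sum>k<dx. K $$ (j, k) * x k) = (\<Sum>i<dx. - (2 / 3) * (l i * (B $$ (i, j) * v j)))"
              by (simp only: Kx lessThan_iff sum_distrib_right) (simp add: mult_ac)
          qed
          also have "\<dots> = - (2 / 3) * (\<Sum>i<dx. l i * r i)"
            by (subst sum.swap) (simp add: r_def sum_distrib_left)
          finally show ?thesis by simp
        qed
        have 1: "(\<Sum>i<dx. (\<Sum>k<dx. ?L (?d i) k * x k)\<^sup>2) = (\<Sum>i<dx. (x i / 2 - 2 / 3 * r i)\<^sup>2)"
          unfolding L by (intro sum.cong refl) (simp only: unit_combination lessThan_iff)
        have 2: "(\<Sum>j<du. (\<Sum>k<dx. ?L (?B j) k * x k)\<^sup>2) = (\<Sum>j<du. (v j / 2 - 2 / 3 * (\<Sum>i<dx. B $$ (i, j) * r i))\<^sup>2)"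
          unfolding L v_def ..
        have 3: "(\<Sum>i<dx. (\<Sum>k<dx. ?d i k * x k)\<^sup>2) = (\<Sum>i<dx. (x i)\<^sup>2)"
          by (intro sum.cong refl) (simp only: unit_combination lessThan_iff)
        have 4: "(\<Sum>j<du. (\<Sum>k<dx. K $$ (j, k) * x k)\<^sup>2) = (\<Sum>j<du. (2 / 3 * v j)\<^sup>2)"
          by (intro sum.cong refl) (simp add: Kx)
        have "4 / 3 * (\<Sum>i<dx. (x i / 2 - 2 / 3 * r i)\<^sup>2) - 1 / 3 * (\<Sum>j<du. (v j / 2 - 2 / 3 * (\<Sum>i<dx. B $$ (i, j) * r i))\<^sup>2)
           + (\<Sum>i<dx. (x i)\<^sup>2) + (\<Sum>j<du. (2 / 3 * v j)\<^sup>2) \<le> 4 / 3 * (\<Sum>i<dx. (x i)\<^sup>2) - 1 / 3 * (\<Sum>j<du. (v j)\<^sup>2)"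
          using lyapunov_step(1)[OF small, of x] unfolding r_def v_def .
        then show ?thesis
          unfolding x_def[symmetric, THEN fun_cong] 1 2 3 4 unfolding v_def by linarith
      qed
      then have "(\<integral>h. ?f h \<partial>M t) \<le> (\<integral>h. ?g h \<partial>M t)"
        using f g by (intro integral_mono) (simp_all add: has_bochner_integral_iff)
      then show ?thesis
        by (simp only: has_bochner_integral_integral_eq[OF f] has_bochner_integral_integral_eq[OF g])
    qed
    ultimately show ?thesis by simp
  qed
  have "(\<Sum>t<T. step_cost t) + V T \<le> real T * J" for T
  proof (induction T)
    case 0
    show ?case by (simp add: V_def)
  next
    case (Suc T)
    then show ?case using VSuc[of T] by (simp add: ring_distribs)
  qed
  then have "(\<Sum>t<T. step_cost t) \<le> real T * J" for T
    using V0[of T] by (smt (verit))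
  then have "lqr_cost (1\<^sub>m dx) (1\<^sub>m du) (1\<^sub>m dx) (half_id dx) B K \<le> ereal J"
    by (rule lqr_cost_le)
  moreover have "opt_cost (1\<^sub>m dx) (1\<^sub>m du) (1\<^sub>m dx) (half_id dx) B \<le> lqr_cost (1\<^sub>m dx) (1\<^sub>m du) (1\<^sub>m dx) (half_id dx) B K"
    unfolding opt_cost_def using B K by (intro INF_lower) (auto simp: half_id_def)
  ultimately show ?thesis unfolding J_def by (rule order_trans[rotated])
qed

section \<open>Stein identity for the uniform prior\<close>

definition unif :: "real \<Rightarrow> real measure" where
  "unif e = density lborel (\<lambda>b. ennreal (indicator {- e..e} b / (2 * e)))"

lemma sets_unif [measurable_cong, simp]: "sets (unif e) = sets borel"
  and space_unif [simp]: "space (unif e) = UNIV"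
  by (auto simp: unif_def)

lemma prob_space_unif:
  assumes "0 < e"
  shows "prob_space (unif e)"
proof
  have "emeasure (unif e) (space (unif e)) = (\<integral>\<^sup>+ b. ennreal (1 / (2 * e)) * indicator {- e..e} b \<partial>lborel)"
    unfolding unif_def by (subst emeasure_density) (auto intro!: nn_integral_cong simp: indicator_def)
  also have "\<dots> = ennreal (1 / (2 * e)) * ennreal (2 * e)"
    using assms by (subst nn_integral_cmult_indicator) auto
  also have "\<dots> = 1"
    using assms by (simp flip: ennreal_mult)
  finally show "emeasure (unif e) (space (unif e)) = 1" .
qed

lemma integral_unif:
  fixes f :: "real \<Rightarrow> real"
  assumes [measurable]: "f \<in> borel_measurable borel" and "0 < e"
  shows "(\<integral>b. f b \<partial>unif e) = (\<integral>b. f b * indicator {- e..e} b \<partial>lborel) / (2 * e)"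
proof -
  have "(\<integral>b. f b \<partial>unif e) = (\<integral>b. (f b * indicator {- e..e} b) / (2 * e) \<partial>lborel)"
    unfolding unif_def using assms(2) by (subst integral_density) (auto simp: ac_simps)
  then show ?thesis by simp
qed

lemma AE_unif: "AE b in unif e. \<bar>b\<bar> \<le> e"
  unfolding unif_def by (subst AE_density) (auto simp: indicator_def intro!: AE_I2)

lemma integral_unif_square:
  assumes "0 < e"
  shows "(\<integral>b. b\<^sup>2 \<partial>unif e) = e\<^sup>2 / 3"
proof -
  have "(\<integral>b. b\<^sup>2 * indicator {- e..e} b \<partial>lborel) = (e ^ 3 - (- e) ^ 3) / 3"
    using assms integral_power[of "- e" e 2] by (simp add: numeral_3_eq_3 numeral_2_eq_2)
  then show ?thesis
    using assms by (simp add: integral_unif power2_eq_square power3_eq_cube field_simps)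
qed

text \<open>Integration by parts against the Stein kernel \<open>(e\<^sup>2 - b\<^sup>2) / 2\<close> of the uniform distribution.\<close>

lemma integral_unif_stein:
  fixes g g' :: "real \<Rightarrow> real"
  assumes g: "\<And>b. (g has_real_derivative g' b) (at b)" and g': "\<And>b. isCont g' b" and e: "0 < e"
  shows "(\<integral>b. b * g b - (e\<^sup>2 - b\<^sup>2) / 2 * g' b \<partial>unif e) = 0"
proof -
  let ?f = "\<lambda>b. b * g b - (e\<^sup>2 - b\<^sup>2) / 2 * g' b"
  have cont: "isCont ?f b" for b
    by (intro continuous_intros DERIV_isCont[OF g] g') auto
  have "((\<lambda>b. - ((e\<^sup>2 - b\<^sup>2) / 2) * g b) has_real_derivative ?f b) (at b)" for b
    using g by (auto intro!: derivative_eq_intros simp: field_simps)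
  then have "(\<integral>b. ?f b * indicator {- e..e} b \<partial>lborel) = - ((e\<^sup>2 - e\<^sup>2) / 2) * g e - - ((e\<^sup>2 - (- e)\<^sup>2) / 2) * g (- e)"
    using e cont by (intro integral_FTC_Icc_real) auto
  moreover have "?f \<in> borel_measurable borel"
    using cont by (intro borel_measurable_continuous_onI continuous_at_imp_continuous_on) auto
  ultimately show ?thesis using e by (simp add: integral_unif)
qed

section \<open>Differentiation in one entry of the input matrix\<close>

lemma score_eq_sum: "score w u k = (\<Sum>q<k. w q * u q)"
  by (induction k) auto

lemma sine_trunc_derivative: "(sine_trunc has_real_derivative cos (v / 2)) (at v)"
  unfolding sine_trunc_def by (auto intro!: derivative_eq_intros)

lemma trunc_noise_derivative:
  assumes "\<And>q. ((\<lambda>b. w b q) has_real_derivative - u q) (at b)"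
  shows "((\<lambda>b. trunc_noise (w b) k) has_real_derivative - sensitivity (w b) u k) (at b)"
proof (induction k)
  case (Suc k)
  have "((\<lambda>b. sine_trunc (w b k)) has_real_derivative cos (w b k / 2) * - u k) (at b)"
    by (rule DERIV_chain2[OF sine_trunc_derivative assms])
  then show ?case using Suc by (auto intro!: derivative_eq_intros)
qed simp

lemma isCont_score: "(\<And>q. isCont (\<lambda>b. w b q) b) \<Longrightarrow> isCont (\<lambda>b. score (w b) u k) b" for b :: real
  unfolding score_eq_sum by (intro continuous_intros)

lemma isCont_sensitivity: "(\<And>q. isCont (\<lambda>b. w b q) b) \<Longrightarrow> isCont (\<lambda>b. sensitivity (w b) u k) b" for b :: real
  by (induction k) (auto intro!: continuous_intros)

abbreviation wb :: "nat \<Rightarrow> (nat \<times> nat \<Rightarrow> real) \<Rightarrow> nat \<Rightarrow> history \<Rightarrow> nat \<Rightarrow> real" where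
  "wb du \<beta> i h \<equiv> \<lambda>q. ws du (\<lambda>i j. \<beta> (i, j)) q i h"

text \<open>Logarithm of \<open>likelihood\<close> at time \<open>Suc k\<close>, written in shifted
  time: \<open>k\<close> transitions. The input \<open>us k\<close> does not occur in it.\<close>

definition log_lik :: "nat \<Rightarrow> nat \<Rightarrow> nat \<Rightarrow> (nat \<times> nat \<Rightarrow> real) \<Rightarrow> history \<Rightarrow> real" where
  "log_lik dx du k \<beta> h = (\<Sum>q<k. \<Sum>i<dx. (xs (Suc q) i h - xs q i h / 2) * (\<Sum>j<du. \<beta> (i, j) * us q j h)
      - (\<Sum>j<du. \<beta> (i, j) * us q j h)\<^sup>2 / 2)"

lemma sum_upd_derivative:
  fixes \<beta> :: "nat \<times> nat \<Rightarrow> real" and v :: "nat \<Rightarrow> real"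
  assumes j: "j < du"
  shows "((\<lambda>b. \<Sum>j'<du. (\<beta>((i, j) := b)) (i', j') * v j') has_real_derivative (if i' = i then v j else 0)) (at b)"
proof -
  have "((\<lambda>b. \<Sum>j'<du. (\<beta>((i, j) := b)) (i', j') * v j') has_real_derivative
      (\<Sum>j'<du. (if i' = i \<and> j' = j then 1 else 0) * v j')) (at b)"
  proof (intro DERIV_sum DERIV_cmult_right)
    fix j'
    show "((\<lambda>b. (\<beta>((i, j) := b)) (i', j')) has_real_derivative (if i' = i \<and> j' = j then 1 else 0)) (at b)"
      by auto
  qed
  moreover have "(\<Sum>j'<du. (if i' = i \<and> j' = j then 1 else 0) * v j') = (if i' = i then v j else 0)"
  proof -
    have "(\<Sum>j'<du. (if i' = i \<and> j' = j then 1 else 0) * v j') = (\<Sum>j'<du. if j' = j then if i' = i then v j' else 0 else 0)"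
      by (intro sum.cong) auto
    also have "\<dots> = (if i' = i then v j else 0)" using j by (subst sum.delta) auto
    finally show ?thesis .
  qed
  ultimately show ?thesis by simp
qed

lemma ws_upd_derivative:
  assumes "j < du"
  shows "((\<lambda>b. wb du (\<beta>((i, j) := b)) i h q) has_real_derivative - us q j h) (at b)"
  unfolding ws_def
  by (rule DERIV_cong[OF DERIV_diff[OF DERIV_const sum_upd_derivative[OF assms]]]) simp

text \<open>The entry belongs to row \<open>i\<close>, so only the noise of coordinate
  \<open>i\<close> enters the score.\<close>

lemma log_lik_derivative:
  assumes i: "i < dx" and j: "j < du"
  shows "((\<lambda>b. log_lik dx du k (\<beta>((i, j) := b)) h) has_real_derivative
     score (wb du (\<beta>((i, j) := b)) i h) (\<lambda>q. us q j h) k) (at b)"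
proof -
  let ?m = "\<lambda>b q i'. \<Sum>j'<du. (\<beta>((i, j) := b)) (i', j') * us q j' h"
  have "((\<lambda>b. log_lik dx du k (\<beta>((i, j) := b)) h) has_real_derivative
      (\<Sum>q<k. \<Sum>i'<dx. if i' = i then wb du (\<beta>((i, j) := b)) i h q * us q j h else 0)) (at b)"
    unfolding log_lik_def
  proof (intro DERIV_sum)
    fix q i'
    note d = sum_upd_derivative[OF j, of \<beta> i i' "\<lambda>j. us q j h" b]
    have "((\<lambda>b. (xs (Suc q) i' h - xs q i' h / 2) * ?m b q i' - (?m b q i')\<^sup>2 / 2) has_real_derivative
       (xs (Suc q) i' h - xs q i' h / 2) * (if i' = i then us q j h else 0) - ?m b q i' * (if i' = i then us q j h else 0)) (at b)"
      by (rule DERIV_cong[OF DERIV_diff[OF DERIV_cmult[OF d] DERIV_cdivide[OF DERIV_power[OF d, of 2]]]]) simp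
    then show "((\<lambda>b. (xs (Suc q) i' h - xs q i' h / 2) * ?m b q i' - (?m b q i')\<^sup>2 / 2) has_real_derivative
       (if i' = i then wb du (\<beta>((i, j) := b)) i h q * us q j h else 0)) (at b)"
      by (rule DERIV_cong) (auto simp: ws_def left_diff_distrib)
  qed
  then show ?thesis
    by (rule DERIV_cong) (use i in \<open>simp add: score_eq_sum\<close>)
qed

definition stein_term :: "nat \<Rightarrow> real \<Rightarrow> nat \<Rightarrow> nat \<Rightarrow> nat \<Rightarrow> (nat \<times> nat \<Rightarrow> real) \<Rightarrow> history \<Rightarrow> real" where
  "stein_term du e k i j \<beta> h = \<beta> (i, j) * trunc_noise (wb du \<beta> i h) k * us k j h
     - (e\<^sup>2 - (\<beta> (i, j))\<^sup>2) / 2 * stein_factor (wb du \<beta> i h) (\<lambda>q. us q j h) k * us k j h"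

text \<open>The product rule turns truncated noise times likelihood into \<open>stein_factor\<close>
  times likelihood: the score comes from the density, the sensitivity from the noise. The inputs are
  constants here, as the history is fixed.\<close>

lemma integral_stein_term_coordinate:
  assumes i: "i < dx" and j: "j < du" and e: "0 < e"
  shows "(\<integral>b. stein_term du e k i j (\<beta>((i, j) := b)) h * exp (log_lik dx du k (\<beta>((i, j) := b)) h) \<partial>unif e) = 0"
proof -
  let ?w = "\<lambda>b. wb du (\<beta>((i, j) := b)) i h" and ?u = "\<lambda>q. us q j h"
  let ?l = "\<lambda>b. exp (log_lik dx du k (\<beta>((i, j) := b)) h)"
  let ?g = "\<lambda>b. trunc_noise (?w b) k * us k j h * ?l b"
  let ?g' = "\<lambda>b. stein_factor (?w b) ?u k * us k j h * ?l b"
  have w: "((\<lambda>b. ?w b q) has_real_derivative - ?u q) (at b)" for q b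
    by (rule ws_upd_derivative[OF j])
  have wc: "isCont (\<lambda>b. ?w b q) b" for q b by (rule DERIV_isCont[OF w])
  note t = trunc_noise_derivative[of ?w ?u, OF w]
  have l: "(?l has_real_derivative ?l b * score (?w b) ?u k) (at b)" for b
    by (rule DERIV_chain2[OF DERIV_exp log_lik_derivative[OF i j]])
  have "(?g has_real_derivative ?g' b) (at b)" for b
    by (rule DERIV_cong[OF DERIV_mult[OF DERIV_cmult_right[OF t] l]])
       (simp add: stein_factor_def algebra_simps)
  moreover have "isCont ?g' b" for b
    unfolding stein_factor_def
    by (intro continuous_intros DERIV_isCont[OF t] isCont_score isCont_sensitivity wc DERIV_isCont[OF l])
  ultimately have "(\<integral>b. b * ?g b - (e\<^sup>2 - b\<^sup>2) / 2 * ?g' b \<partial>unif e) = 0"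
    by (rule integral_unif_stein) (rule e)
  moreover have "b * ?g b - (e\<^sup>2 - b\<^sup>2) / 2 * ?g' b = stein_term du e k i j (\<beta>((i, j) := b)) h * ?l b" for b
    by (simp add: stein_term_def algebra_simps)
  ultimately show ?thesis by simp
qed

section \<open>The prior on the input matrix\<close>

definition box_law :: "nat \<Rightarrow> nat \<Rightarrow> real \<Rightarrow> (nat \<times> nat \<Rightarrow> real) measure" where
  "box_law dx du e = PiM ({..<dx} \<times> {..<du}) (\<lambda>_. unif e)"

lemma integral_stein_term_box:
  assumes i: "i < dx" and j: "j < du" and e: "0 < e"
  shows "(\<integral>\<beta>. stein_term du e k i j \<beta> h * exp (log_lik dx du k \<beta> h) \<partial>box_law dx du e) = 0"
    (is "(\<integral>\<beta>. ?f \<beta> \<partial>_) = 0")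
\<comment> \<open>Without integrability the Bochner integral is 0 by convention and the claim holds;
  with it, the entry \<open>(i, j)\<close> is integrated first.\<close>
proof (cases "integrable (box_law dx du e) ?f")
  case True
  interpret product_sigma_finite "\<lambda>_. unif e"
    by (intro product_sigma_finite.intro prob_space_imp_sigma_finite prob_space_unif e)
  let ?I = "{..<dx} \<times> {..<du} - {(i, j)}"
  have I: "{..<dx} \<times> {..<du} = insert (i, j) ?I" using i j by auto
  have "(\<integral>\<beta>. ?f \<beta> \<partial>box_law dx du e) = (\<integral>\<beta>. (\<integral>b. ?f (\<beta>((i, j) := b)) \<partial>unif e) \<partial>PiM ?I (\<lambda>_. unif e))"
    using True unfolding box_law_def by (subst (asm) I, subst I) (intro product_integral_insert, auto)
  also have "\<dots> = 0"
    unfolding integral_stein_term_coordinate[OF i j e] by simp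
  finally show ?thesis .
qed (simp add: not_integrable_integral_eq)

lemma prob_space_box_law: "0 < e \<Longrightarrow> prob_space (box_law dx du e)"
  unfolding box_law_def by (intro prob_space_PiM prob_space_unif)

lemma box_law_component:
  assumes e: "0 < e" and p: "p \<in> {..<dx} \<times> {..<du}"
  shows "distr (box_law dx du e) (unif e) (\<lambda>\<beta>. \<beta> p) = unif e"
proof -
  interpret product_prob_space "\<lambda>_. unif e" "{..<dx} \<times> {..<du}"
    using prob_space_unif[OF e]
    by (simp add: product_prob_space_def product_prob_space_axioms_def product_sigma_finite_def prob_space_imp_sigma_finite)
  show ?thesis unfolding box_law_def using PiM_component[OF p] .
qed

lemma measurable_box_law_component [measurable]:
  "p \<in> {..<dx} \<times> {..<du} \<Longrightarrow> (\<lambda>\<beta>. \<beta> p) \<in> borel_measurable (box_law dx du e)"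
  using measurable_component_singleton[of p "{..<dx} \<times> {..<du}" "\<lambda>_. unif e"]
  by (simp add: box_law_def cong: measurable_cong_sets)

lemma AE_box_law:
  assumes e: "0 < e"
  shows "AE \<beta> in box_law dx du e. \<forall>p\<in>{..<dx} \<times> {..<du}. \<bar>\<beta> p\<bar> \<le> e"
proof (subst AE_finite_all)
  show "\<forall>p\<in>{..<dx} \<times> {..<du}. AE \<beta> in box_law dx du e. \<bar>\<beta> p\<bar> \<le> e"
  proof
    fix p assume p: "p \<in> {..<dx} \<times> {..<du}"
    have "AE b in distr (box_law dx du e) (unif e) (\<lambda>\<beta>. \<beta> p). \<bar>b\<bar> \<le> e"
      unfolding box_law_component[OF e p] by (rule AE_unif)
    then show "AE \<beta> in box_law dx du e. \<bar>\<beta> p\<bar> \<le> e"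
      by (subst (asm) AE_distr_iff) (use measurable_box_law_component[OF p] in \<open>simp_all cong: measurable_cong_sets\<close>)
  qed
qed simp

lemma box_law_square:
  assumes e: "0 < e" and p: "p \<in> {..<dx} \<times> {..<du}"
  shows "has_bochner_integral (box_law dx du e) (\<lambda>\<beta>. (\<beta> p)\<^sup>2) (e\<^sup>2 / 3)"
proof -
  interpret prob_space "box_law dx du e" by (rule prob_space_box_law[OF e])
  note m = measurable_box_law_component[OF p, of e]
  have m': "(\<lambda>\<beta>. \<beta> p) \<in> box_law dx du e \<rightarrow>\<^sub>M unif e" using m by (simp cong: measurable_cong_sets)
  have "AE \<beta> in box_law dx du e. norm ((\<beta> p)\<^sup>2) \<le> e\<^sup>2"
    using AE_box_law[OF e] by eventually_elim (use p e in \<open>auto simp: abs_le_square_iff[symmetric]\<close>)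
  then have i: "integrable (box_law dx du e) (\<lambda>\<beta>. (\<beta> p)\<^sup>2)"
    using m by (intro integrable_const_bound[where B="e\<^sup>2"]) auto
  have "(\<integral>\<beta>. (\<beta> p)\<^sup>2 \<partial>box_law dx du e) = (\<integral>b. b\<^sup>2 \<partial>distr (box_law dx du e) (unif e) (\<lambda>\<beta>. \<beta> p))"
    by (rule integral_distr[symmetric, OF m']) (simp cong: measurable_cong_sets)
  also have "\<dots> = e\<^sup>2 / 3"
    unfolding box_law_component[OF e p] by (rule integral_unif_square[OF e])
  finally show ?thesis using i by (simp add: has_bochner_integral_iff)
qed

section \<open>Change of measure and exchange of prior and history\<close>

context half_system
begin

abbreviation "Bm \<beta> \<equiv> Matrix.mat dx du \<beta>"

lemma ws_Bm: "i < dx \<Longrightarrow> ws du (\<lambda>i j. Bm \<beta> $$ (i, j)) q i h = wb du \<beta> i h q"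
  unfolding ws_def by simp

lemma likelihood_Bm:
  assumes h: "h \<in> space (H (Suc k) (Suc k))"
  shows "likelihood (Bm \<beta>) (Suc k) h = exp (log_lik dx du k \<beta> h)"
proof -
  have eq: "{1..<Suc k} = Suc ` {..<k}" by (auto simp: image_iff Suc_le_eq gr0_conv_Suc)
  have B: "Bm \<beta> \<in> carrier_mat dx du" by simp
  have "(\<Sum>q\<in>{1..<Suc k}. \<Sum>i<dx. (fst h (Suc q) $ i - (half_id dx *\<^sub>v fst h q) $ i) * (Bm \<beta> *\<^sub>v snd h q) $ i
     - ((Bm \<beta> *\<^sub>v snd h q) $ i)\<^sup>2 / 2) = log_lik dx du k \<beta> h"
    unfolding eq sum.reindex[OF inj_Suc] comp_def log_lik_def
  proof (intro sum.cong refl)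
    fix q i assume q: "q \<in> {..<k}" and i: "i \<in> {..<dx}"
    then have c: "fst h (Suc q) \<in> carrier_vec dx" "snd h (Suc q) \<in> carrier_vec du"
      using space_history[OF h, of "Suc q"] by auto
    have "(Bm \<beta> *\<^sub>v snd h (Suc q)) $ i = (\<Sum>j<du. \<beta> (i, j) * us q j h)"
      using mult_mat_vec_sum[OF B c(2), of i] i by (simp add: us_def del: index_mult_mat_vec)
    then show "(fst h (Suc (Suc q)) $ i - (half_id dx *\<^sub>v fst h (Suc q)) $ i) * (Bm \<beta> *\<^sub>v snd h (Suc q)) $ i
       - ((Bm \<beta> *\<^sub>v snd h (Suc q)) $ i)\<^sup>2 / 2 =
      (xs (Suc q) i h - xs q i h / 2) * (\<Sum>j<du. \<beta> (i, j) * us q j h) - (\<Sum>j<du. \<beta> (i, j) * us q j h)\<^sup>2 / 2"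
      using half_id_mult[OF c(1), of i] i by (simp add: xs_def del: index_mult_mat_vec)
  qed
  then show ?thesis unfolding likelihood_def by simp
qed

lemma trajectory_Bm:
  fixes f :: "history \<Rightarrow> real"
  assumes f: "f \<in> borel_measurable (H (Suc k) (Suc k))"
  shows "integrable (P (Bm \<beta>) (Suc k)) f \<longleftrightarrow> integrable (P (0\<^sub>m dx du) (Suc k)) (\<lambda>h. f h * exp (log_lik dx du k \<beta> h))"
    and "(\<integral>h. f h \<partial>P (Bm \<beta>) (Suc k)) = (\<integral>h. f h * exp (log_lik dx du k \<beta> h) \<partial>P (0\<^sub>m dx du) (Suc k))"
proof -
  let ?Z = "0\<^sub>m dx du :: rmat"
  have Z: "?Z \<in> carrier_mat dx du" and B: "Bm \<beta> \<in> carrier_mat dx du" by auto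
  define M where "M = P ?Z (Suc k)"
  have sM: "sets M = sets (H (Suc k) (Suc k))" "space M = space (H (Suc k) (Suc k))"
    unfolding M_def by (simp_all only: sets_trajectory[OF Z] space_trajectory[OF Z])
  have l: "likelihood (Bm \<beta>) (Suc k) \<in> borel_measurable M" and fM: "f \<in> borel_measurable M"
    using measurable_likelihood[OF B, of "Suc k"] f by (simp_all cong: measurable_cong_sets add: sM)
  have d: "P (Bm \<beta>) (Suc k) = density M (\<lambda>h. ennreal (likelihood (Bm \<beta>) (Suc k) h))"
    unfolding M_def by (rule trajectory_eq_density[OF B])
  have nn: "AE h in M. 0 \<le> likelihood (Bm \<beta>) (Suc k) h" by (simp add: less_imp_le[OF likelihood_pos])
  have eq: "likelihood (Bm \<beta>) (Suc k) h *\<^sub>R f h = f h * exp (log_lik dx du k \<beta> h)" if "h \<in> space M" for h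
    using likelihood_Bm[of h k \<beta>] that by (simp add: sM)
  show "integrable (P (Bm \<beta>) (Suc k)) f \<longleftrightarrow> integrable (P ?Z (Suc k)) (\<lambda>h. f h * exp (log_lik dx du k \<beta> h))"
    unfolding d M_def[symmetric] integrable_density[OF fM l nn]
    by (rule Bochner_Integration.integrable_cong[OF refl eq])
  show "(\<integral>h. f h \<partial>P (Bm \<beta>) (Suc k)) = (\<integral>h. f h * exp (log_lik dx du k \<beta> h) \<partial>P ?Z (Suc k))"
    unfolding d M_def[symmetric] integral_density[OF fM l nn]
    by (rule Bochner_Integration.integral_cong[OF refl eq])
qed

lemma wb_measurable_pair:
  fixes N :: "((nat \<times> nat \<Rightarrow> real) \<times> history) measure"
  assumes N: "\<And>p. p \<in> {..<dx} \<times> {..<du} \<Longrightarrow> (\<lambda>z. fst z p) \<in> borel_measurable N"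
      "\<And>t i. t < n \<Longrightarrow> i < dx \<Longrightarrow> (\<lambda>z. xs t i (snd z)) \<in> borel_measurable N"
      "\<And>t j. t < n \<Longrightarrow> j < du \<Longrightarrow> (\<lambda>z. us t j (snd z)) \<in> borel_measurable N"
    and q: "Suc q < n" and i: "i < dx"
  shows "(\<lambda>z. wb du (fst z) i (snd z) q) \<in> borel_measurable N"
  unfolding ws_def using q i
  by (intro borel_measurable_diff borel_measurable_divide borel_measurable_const borel_measurable_sum borel_measurable_times N) auto

text \<open>Joint measurability in the entries and the history, as Fubini requires. The measure
  \<open>N\<close> is left general so that the proof also covers a fixed matrix.\<close>

lemma stein_term_measurable_pair:
  fixes N :: "((nat \<times> nat \<Rightarrow> real) \<times> history) measure"
  assumes N: "\<And>p. p \<in> {..<dx} \<times> {..<du} \<Longrightarrow> (\<lambda>z. fst z p) \<in> borel_measurable N"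
      "\<And>t i. t < Suc k \<Longrightarrow> i < dx \<Longrightarrow> (\<lambda>z. xs t i (snd z)) \<in> borel_measurable N"
      "\<And>t j. t < Suc k \<Longrightarrow> j < du \<Longrightarrow> (\<lambda>z. us t j (snd z)) \<in> borel_measurable N"
    and i: "i < dx" and j: "j < du"
  shows "(\<lambda>z. stein_term du e k i j (fst z) (snd z)) \<in> borel_measurable N"
proof -
  have w: "(\<lambda>z. wb du (fst z) i (snd z) q) \<in> borel_measurable N" if "q < k" for q
    by (rule wb_measurable_pair[where n="Suc k"]) (use N that i in auto)
  have t: "(\<lambda>z. trunc_noise (wb du (fst z) i (snd z)) q) \<in> borel_measurable N" if "q \<le> k" for q
    using that
  proof (induction q)
    case (Suc q)
    then show ?case
      using measurable_compose[OF w[of q] sine_trunc_measurable] by (auto intro!: borel_measurable_add borel_measurable_divide)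
  qed simp
  have s: "(\<lambda>z. score (wb du (fst z) i (snd z)) (\<lambda>q. us q j (snd z)) q) \<in> borel_measurable N" if "q \<le> k" for q
    unfolding score_eq_sum using that w N(3) j by (auto intro!: borel_measurable_sum borel_measurable_times)
  have se: "(\<lambda>z. sensitivity (wb du (fst z) i (snd z)) (\<lambda>q. us q j (snd z)) q) \<in> borel_measurable N" if "q \<le> k" for q
    using that
  proof (induction q)
    case (Suc q)
    have "(\<lambda>v::real. cos (v / 2)) \<in> borel_measurable borel" by measurable
    from measurable_compose[OF w[of q] this] show ?case
      using Suc N(3)[of q j] j by (auto intro!: borel_measurable_add borel_measurable_divide borel_measurable_times)
  qed simp
  show ?thesis
    unfolding stein_term_def stein_factor_def
    by (intro borel_measurable_diff borel_measurable_times borel_measurable_divide borel_measurable_power borel_measurable_const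
       t s se N(1,3)) (use i j in auto)
qed

lemma log_lik_measurable_pair:
  fixes N :: "((nat \<times> nat \<Rightarrow> real) \<times> history) measure"
  assumes N: "\<And>p. p \<in> {..<dx} \<times> {..<du} \<Longrightarrow> (\<lambda>z. fst z p) \<in> borel_measurable N"
      "\<And>t i. t < Suc k \<Longrightarrow> i < dx \<Longrightarrow> (\<lambda>z. xs t i (snd z)) \<in> borel_measurable N"
      "\<And>t j. t < Suc k \<Longrightarrow> j < du \<Longrightarrow> (\<lambda>z. us t j (snd z)) \<in> borel_measurable N"
  shows "(\<lambda>z. log_lik dx du k (fst z) (snd z)) \<in> borel_measurable N"
  unfolding log_lik_def
  by (intro borel_measurable_sum borel_measurable_diff borel_measurable_times borel_measurable_divide borel_measurable_power
      borel_measurable_const N) auto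

lemma stein_term_measurable:
  assumes "i < dx" "j < du"
  shows "stein_term du e k i j \<beta> \<in> borel_measurable (H (Suc k) (Suc k))"
proof -
  \<comment> \<open>A point mass on a discrete space fixes \<open>\<beta>\<close> and reduces the
    claim to joint measurability.\<close>
  let ?N = "return (count_space UNIV) \<beta> \<Otimes>\<^sub>M H (Suc k) (Suc k)"
  have "(\<lambda>z. stein_term du e k i j (fst z) (snd z)) \<in> borel_measurable ?N"
    by (rule stein_term_measurable_pair)
       (use assms in \<open>auto intro!: measurable_compose[OF measurable_snd xs_measurable] measurable_compose[OF measurable_snd us_measurable]
         measurable_compose[OF measurable_fst]\<close>)
  from measurable_compose[OF measurable_Pair1' this, of \<beta>] show ?thesis by simp
qed

text \<open>Under the common law for the zero matrix the integrals over prior and history can be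
  exchanged, and the one over the prior vanishes for each history. The uniform bound
  \<open>C\<close> gives integrability on the product.\<close>

lemma stein_term_mean_zero:
  assumes i: "i < dx" and j: "j < du" and e: "0 < e"
    and bnd: "\<And>\<beta>. \<forall>p\<in>{..<dx} \<times> {..<du}. \<bar>\<beta> p\<bar> \<le> e \<Longrightarrow>
      integrable (P (Bm \<beta>) (Suc k)) (stein_term du e k i j \<beta>) \<and> (\<integral>h. \<bar>stein_term du e k i j \<beta> h\<bar> \<partial>P (Bm \<beta>) (Suc k)) \<le> C"
  shows "has_bochner_integral (box_law dx du e) (\<lambda>\<beta>. \<integral>h. stein_term du e k i j \<beta> h \<partial>P (Bm \<beta>) (Suc k)) 0"
proof -
  let ?Z = "0\<^sub>m dx du :: rmat"
  have Z: "?Z \<in> carrier_mat dx du" by simp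
  define M where "M = P ?Z (Suc k)"
  have sM: "sets M = sets (H (Suc k) (Suc k))"
    unfolding M_def by (simp only: sets_trajectory[OF Z])
  interpret M: prob_space M unfolding M_def by (rule prob_space_trajectory[OF Z])
  interpret \<Pi>: prob_space "box_law dx du e" by (rule prob_space_box_law[OF e])
  interpret pair_sigma_finite "box_law dx du e" M ..
  let ?f = "\<lambda>\<beta> h. stein_term du e k i j \<beta> h * exp (log_lik dx du k \<beta> h)"
  have x: "(\<lambda>z. xs t i (snd z)) \<in> borel_measurable (box_law dx du e \<Otimes>\<^sub>M M)" if "t < Suc k" "i < dx" for t i
    by (rule measurable_compose[OF measurable_snd]) (use xs_measurable[OF that] in \<open>simp cong: measurable_cong_sets add: sM\<close>)
  have u: "(\<lambda>z. us t j (snd z)) \<in> borel_measurable (box_law dx du e \<Otimes>\<^sub>M M)" if "t < Suc k" "j < du" for t j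
    by (rule measurable_compose[OF measurable_snd]) (use us_measurable[OF that] in \<open>simp cong: measurable_cong_sets add: sM\<close>)
  have p: "(\<lambda>z. fst z p) \<in> borel_measurable (box_law dx du e \<Otimes>\<^sub>M M)" if "p \<in> {..<dx} \<times> {..<du}" for p
    by (rule measurable_compose[OF measurable_fst measurable_box_law_component[OF that]])
  have fm: "(\<lambda>z. ?f (fst z) (snd z)) \<in> borel_measurable (box_law dx du e \<Otimes>\<^sub>M M)"
    by (intro borel_measurable_times measurable_compose[OF log_lik_measurable_pair borel_measurable_exp]
        stein_term_measurable_pair i j p x u)
  have fm': "case_prod ?f \<in> borel_measurable (box_law dx du e \<Otimes>\<^sub>M M)"
    using fm by (simp add: case_prod_beta')
  note sm = stein_term_measurable[OF i j, of e k]
  have eq: "(\<integral>h. stein_term du e k i j \<beta> h \<partial>P (Bm \<beta>) (Suc k)) = (\<integral>h. ?f \<beta> h \<partial>M)" for \<beta>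
    unfolding M_def by (rule trajectory_Bm(2)[OF sm])
  have eqa: "(\<integral>h. \<bar>stein_term du e k i j \<beta> h\<bar> \<partial>P (Bm \<beta>) (Suc k)) = (\<integral>h. norm (?f \<beta> h) \<partial>M)" for \<beta>
    unfolding M_def using trajectory_Bm(2)[OF borel_measurable_abs[OF sm], of \<beta>] by (simp add: abs_mult)
  have int: "integrable (box_law dx du e \<Otimes>\<^sub>M M) (case_prod ?f)"
  proof (rule Fubini_integrable[OF fm'])
    have "AE \<beta> in box_law dx du e. norm (\<integral>h. norm (case_prod ?f (\<beta>, h)) \<partial>M) \<le> C"
      using AE_box_law[OF e]
    proof eventually_elim
      case (elim \<beta>)
      then show ?case using bnd[of \<beta>] eqa[of \<beta>] by (simp add: abs_of_nonneg)
    qed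
    then show "integrable (box_law dx du e) (\<lambda>\<beta>. \<integral>h. norm (case_prod ?f (\<beta>, h)) \<partial>M)"
      by (rule \<Pi>.integrable_const_bound)
         (use fm in \<open>auto intro!: M.borel_measurable_lebesgue_integral simp: case_prod_beta'\<close>)
    show "AE \<beta> in box_law dx du e. integrable M (\<lambda>h. case_prod ?f (\<beta>, h))"
      using AE_box_law[OF e]
      by eventually_elim (use bnd trajectory_Bm(1)[OF sm] in \<open>simp add: M_def\<close>)
  qed
  have "integrable (box_law dx du e) (\<lambda>\<beta>. \<integral>h. ?f \<beta> h \<partial>M)"
    using integrable_fst'[OF int] by simp
  moreover have "(\<integral>\<beta>. (\<integral>h. ?f \<beta> h \<partial>M) \<partial>box_law dx du e) = (\<integral>h. (\<integral>\<beta>. ?f \<beta> h \<partial>box_law dx du e) \<partial>M)"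
    by (rule Fubini_integral[OF int, symmetric])
  moreover have "\<dots> = 0"
    by (simp add: integral_stein_term_box[OF i j e])
  ultimately show ?thesis
    unfolding eq by (simp add: has_bochner_integral_iff)
qed

lemma integral_past:
  fixes f :: "history \<Rightarrow> real"
  assumes B: "B \<in> carrier_mat dx du" and f: "f \<in> borel_measurable (H s s)" "\<And>h. f (past s h) = f h" and st: "s \<le> t"
  shows "integrable (P B t) f \<longleftrightarrow> integrable (P B s) f" and "(\<integral>h. f h \<partial>P B t) = (\<integral>h. f h \<partial>P B s)"
proof -
  have m: "past s \<in> P B t \<rightarrow>\<^sub>M H s s"
    using measurable_past[OF st] by (simp add: measurable_trajectory[OF B])
  show "integrable (P B t) f \<longleftrightarrow> integrable (P B s) f"
    using integrable_distr_eq[OF m f(1)] by (simp add: distr_past[OF B st] f(2))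
  show "(\<integral>h. f h \<partial>P B t) = (\<integral>h. f h \<partial>P B s)"
    using integral_distr[OF m f(1)] by (simp add: distr_past[OF B st] f(2))
qed

end

section \<open>Averaging over the prior\<close>

text \<open>Domination for Fubini, with convenient constants: 15 collects 9 from the input, 4 from
  the score and 2 from the sensitivity.\<close>

lemma (in lqr_process) stein_gap_bound:
  assumes t: "t < T" "i < dx" "j < du" and le: "\<bar>b i j\<bar> \<le> 1" "\<bar>s\<bar> \<le> 1"
  shows "integrable M (\<lambda>h. b i j * nt t i h * u t j h - s * sf t i j h * u t j h)"
    and "(\<integral>h. \<bar>b i j * nt t i h * u t j h - s * sf t i j h * u t j h\<bar> \<partial>M) \<le> 4 + 15 * (\<Sum>q<T. energy (u q j))"
proof -
  let ?U = "\<Sum>q<T. energy (u q j)"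
  show int: "integrable M (\<lambda>h. b i j * nt t i h * u t j h - s * sf t i j h * u t j h)"
    unfolding mult.assoc using t
    by (intro Bochner_Integration.integrable_diff integrable_mult_right square_integrable_mult nt_square u_square sf_square)
  have eu: "energy (u t j) \<le> ?U"
    using t by (intro member_le_sum) auto
  have esc: "energy (sc t i j) \<le> ?U"
    using sc_square[OF t] t by (auto intro!: sum_mono2)
  have i: "integrable M (\<lambda>h. (u t j h)\<^sup>2)" "integrable M (\<lambda>h. (sc t i j h)\<^sup>2)" "integrable M (\<lambda>h. (se t i j h)\<^sup>2)"
    using energy_integrable[OF u_square] energy_integrable[OF sc_square[THEN conjunct1]] energy_integrable[OF se_square] t by auto
  have ese: "energy (se t i j) \<le> 2 * ?U"
  proof -
    have ui: "integrable M (\<lambda>h. (u q j h)\<^sup>2)" if "q < t" for q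
      using energy_integrable[OF u_square] t that by auto
    have "energy (se t i j) \<le> (\<integral>h. 2 * (\<Sum>q<t. (u q j h)\<^sup>2) \<partial>M)"
      using ui by (intro integral_mono i sensitivity_bound) auto
    also have "\<dots> = 2 * (\<Sum>q<t. energy (u q j))"
      using ui by (simp add: Bochner_Integration.integral_sum)
    also have "\<dots> \<le> 2 * ?U" using t by (intro mult_left_mono sum_mono2) auto
    finally show ?thesis .
  qed
  have pw: "\<bar>b i j * nt t i h * u t j h - s * sf t i j h * u t j h\<bar> \<le>
      4 + 9 * (u t j h)\<^sup>2 + 4 * (sc t i j h)\<^sup>2 + (se t i j h)\<^sup>2" for h
  proof -
    let ?n = "nt t i h" and ?u = "u t j h" and ?s = "sc t i j h" and ?e = "se t i j h"
    have n: "\<bar>?n\<bar> \<le> 4" by (rule trunc_noise_bound)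
    have ab: "\<bar>x\<bar> * \<bar>y\<bar> \<le> x\<^sup>2 + y\<^sup>2" for x y :: real
      using sum_squares_bound[of "\<bar>x\<bar>" "\<bar>y\<bar>"] mult_nonneg_nonneg[of "\<bar>x\<bar>" "\<bar>y\<bar>"] unfolding power2_abs by linarith
    have "\<bar>b i j * ?n * ?u\<bar> \<le> 1 * 4 * \<bar>?u\<bar>"
      unfolding abs_mult using le n by (intro mult_mono) auto
    moreover have "\<bar>?u\<bar> \<le> 1 + ?u\<^sup>2" using ab[of 1 ?u] by simp
    moreover have "\<bar>s * sf t i j h * ?u\<bar> \<le> 1 * (4 * \<bar>?s\<bar> + \<bar>?e\<bar>) * \<bar>?u\<bar>"
    proof -
      have "\<bar>?n * ?s\<bar> \<le> 4 * \<bar>?s\<bar>" unfolding abs_mult using n by (intro mult_right_mono) auto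
      then have "\<bar>sf t i j h\<bar> \<le> 4 * \<bar>?s\<bar> + \<bar>?e\<bar>" unfolding stein_factor_def by linarith
      then show ?thesis unfolding abs_mult using le by (intro mult_mono) auto
    qed
    moreover have "(4 * \<bar>?s\<bar> + \<bar>?e\<bar>) * \<bar>?u\<bar> = 4 * (\<bar>?s\<bar> * \<bar>?u\<bar>) + \<bar>?e\<bar> * \<bar>?u\<bar>" by (simp add: algebra_simps)
    ultimately show ?thesis using ab[of ?s ?u] ab[of ?e ?u] by linarith
  qed
  have "(\<integral>h. \<bar>b i j * nt t i h * u t j h - s * sf t i j h * u t j h\<bar> \<partial>M) \<le>
      (\<integral>h. 4 + 9 * (u t j h)\<^sup>2 + 4 * (sc t i j h)\<^sup>2 + (se t i j h)\<^sup>2 \<partial>M)"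
    using i by (intro integral_mono integrable_abs int pw) auto
  also have "\<dots> = 4 + 9 * energy (u t j) + 4 * energy (sc t i j) + energy (se t i j)"
    using i by (simp add: prob_space)
  finally show "(\<integral>h. \<bar>b i j * nt t i h * u t j h - s * sf t i j h * u t j h\<bar> \<partial>M) \<le> 4 + 15 * ?U"
    using eu esc ese by simp
qed

text \<open>The minorant \<open>f\<close> limits the negative part of \<open>g\<close>, so an upper
  bound on the extended expectation forces the positive part to be finite. This turns finite regret
  into integrability of the cost.\<close>

lemma expect_leD:
  fixes f :: "'a \<Rightarrow> real" and g :: "'a \<Rightarrow> ereal"
  assumes M: "prob_space M" and f: "f \<in> borel_measurable M" and lb: "\<And>h. h \<in> space M \<Longrightarrow> - c \<le> f h"
    and fg: "\<And>h. h \<in> space M \<Longrightarrow> ereal (f h) \<le> g h" and le: "expect M g \<le> ereal R"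
  shows "integrable M f" and "(\<integral>h. f h \<partial>M) \<le> R"
proof -
  interpret prob_space M by fact
  let ?p = "\<lambda>g. \<integral>\<^sup>+ h. e2ennreal (g h) \<partial>M" and ?n = "\<lambda>g. \<integral>\<^sup>+ h. e2ennreal (- g h) \<partial>M"
  let ?f = "\<lambda>h. ereal (f h)"
  have e: "e2ennreal (ereal r) = ennreal r" for r
    by (simp add: ennreal_def e2ennreal_def max_def zero_ereal_def)
  have pos: "?p ?f \<le> ?p g" by (intro nn_integral_mono e2ennreal_mono fg)
  have neg: "?n g \<le> ?n ?f"
    by (intro nn_integral_mono e2ennreal_mono) (use fg in \<open>simp only: ereal_minus_le_minus\<close>)
  have "?n ?f \<le> (\<integral>\<^sup>+ h. ennreal c \<partial>M)"
  proof (intro nn_integral_mono)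
    fix h assume "h \<in> space M"
    then show "e2ennreal (- ?f h) \<le> ennreal c"
      using lb[of h] by (simp add: e ennreal_leI)
  qed
  also have "\<dots> < \<infinity>" by (simp add: emeasure_space_1)
  finally have nf: "?n ?f < \<infinity>" .
  then have ng: "?n g < \<infinity>" using neg by (rule order.strict_trans1[rotated])
  have "enn2ereal (?p g) \<noteq> \<infinity>"
    using le ng unfolding expect_def by (cases "?n g") (auto simp: enn2ereal_ennreal)
  then have "?p g < \<infinity>"
    using less_top[of "?p g"] by (auto simp: infinity_ennreal_def top_ennreal.rep_eq top_ereal_def)
  then have "?p ?f < \<infinity>" using pos by (rule order.strict_trans1[rotated])
  then have "(\<integral>\<^sup>+ h. ennreal \<bar>f h\<bar> \<partial>M) < \<infinity>"
  proof -
    have "(\<integral>\<^sup>+ h. ennreal \<bar>f h\<bar> \<partial>M) \<le> (\<integral>\<^sup>+ h. e2ennreal (?f h) + e2ennreal (- ?f h) \<partial>M)"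
      by (intro nn_integral_mono) (auto simp: e abs_if ennreal_neg)
    also have "\<dots> = ?p ?f + ?n ?f"
      by (rule nn_integral_add) (use f in \<open>simp_all add: e\<close>)
    finally show ?thesis using \<open>?p ?f < \<infinity>\<close> nf by (simp add: order.strict_trans1)
  qed
  then show int: "integrable M f"
    using f by (simp add: integrable_iff_bounded)
  have "ereal (\<integral>h. f h \<partial>M) = expect M ?f" by (rule expect_ereal[OF int, symmetric])
  also have "\<dots> \<le> expect M g"
    unfolding expect_def by (intro ereal_minus_mono) (use pos neg in \<open>simp_all add: less_eq_ennreal.rep_eq\<close>)
  also have "\<dots> \<le> ereal R" by (rule le)
  finally show "(\<integral>h. f h \<partial>M) \<le> R" by simp
qed

context half_system
begin

text \<open>The source of integrability for an arbitrary algorithm. Since the regret subtracts the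
  optimal cost, an upper bound on the latter is the right direction.\<close>

lemma total_cost_le_of_regret:
  assumes B: "B \<in> carrier_mat dx du" and small: "(\<Sum>j<du. \<Sum>i<dx. (B $$ (i, j))\<^sup>2) \<le> 1 / 16"
    and R: "expected_regret (1\<^sub>m dx) (1\<^sub>m du) (1\<^sub>m dx) alg T (half_id dx) B \<le> ereal R"
  shows "integrable (P B T) (cost T)"
    and "(\<integral>h. cost T h \<partial>P B T) \<le>
      R + real T * (4 / 3 * real dx - 1 / 3 * (\<Sum>j<du. \<Sum>i<dx. (B $$ (i, j))\<^sup>2))"
proof -
  interpret prob_space "P B T" by (rule prob_space_trajectory[OF B])
  let ?J = "4 / 3 * real dx - 1 / 3 * (\<Sum>j<du. \<Sum>i<dx. (B $$ (i, j))\<^sup>2)"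
  let ?c = "cost T"
  have c: "?c \<in> borel_measurable (P B T)"
    using total_cost_measurable[of T] by (simp add: measurable_trajectory[OF B])
  have c0: "0 \<le> ?c h" if "h \<in> space (P B T)" for h
    using that by (subst total_cost_eq) (auto simp: space_trajectory[OF B] intro!: sum_nonneg add_nonneg_nonneg)
  have le: "ereal (?c h - real T * ?J) \<le> regret (1\<^sub>m dx) (1\<^sub>m du) (1\<^sub>m dx) (half_id dx) B T h" for h
  proof -
    have "ereal (real T) * opt_cost (1\<^sub>m dx) (1\<^sub>m du) (1\<^sub>m dx) (half_id dx) B \<le> ereal (real T) * ereal ?J"
      by (intro ereal_mult_left_mono opt_cost_le B small) simp
    then have "ereal (?c h) - ereal (real T) * ereal ?J \<le> regret (1\<^sub>m dx) (1\<^sub>m du) (1\<^sub>m dx) (half_id dx) B T h"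
      unfolding regret_def by (intro ereal_minus_mono order_refl)
    then show ?thesis by simp
  qed
  note e = expect_leD[OF prob_space_axioms _ _ le R[unfolded expected_regret_def], of "real T * ?J"]
  have m: "(\<lambda>h. ?c h - real T * ?J) \<in> borel_measurable (P B T)" using c by measurable
  have i: "integrable (P B T) (\<lambda>h. ?c h - real T * ?J)"
    by (rule e(1)[OF m]) (use c0 in auto)
  have "integrable (P B T) (\<lambda>h. (?c h - real T * ?J) + real T * ?J)"
    using i by (intro Bochner_Integration.integrable_add) auto
  then show ic: "integrable (P B T) ?c" by simp
  have "(\<integral>h. ?c h - real T * ?J \<partial>P B T) \<le> R"
    by (rule e(2)[OF m]) (use c0 in auto)
  then show "(\<integral>h. ?c h \<partial>P B T) \<le> R + real T * ?J"
    using ic by (simp add: prob_space)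
qed

lemma stein_term_past: "k < s \<Longrightarrow> stein_term du e k i j \<beta> (past s h) = stein_term du e k i j \<beta> h"
proof -
  assume k: "k < s"
  have t: "trunc_noise (wb du \<beta> i (past s h)) q = trunc_noise (wb du \<beta> i h) q" if "q \<le> k" for q
    using that by (induction q) (use k in \<open>auto simp: ws_past\<close>)
  have sc: "score (wb du \<beta> i (past s h)) (\<lambda>q. us q j (past s h)) q = score (wb du \<beta> i h) (\<lambda>q. us q j h) q" if "q \<le> k" for q
    using that by (induction q) (use k in \<open>auto simp: ws_past us_past\<close>)
  have se: "sensitivity (wb du \<beta> i (past s h)) (\<lambda>q. us q j (past s h)) q = sensitivity (wb du \<beta> i h) (\<lambda>q. us q j h) q" if "q \<le> k" for q
    using that by (induction q) (use k in \<open>auto simp: ws_past us_past\<close>)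
  show ?thesis unfolding stein_term_def stein_factor_def
    by (simp only: t[OF order_refl] sc[OF order_refl] se[OF order_refl] us_past[OF k])
qed

text \<open>The saving 1/3 of the informed controller minus the truncation loss 1/18 leaves 5/18.
  The second claim is the domination for Fubini, uniform over the box.\<close>

lemma box_instance:
  assumes e: "0 < e" and small: "real dx * real du * e\<^sup>2 \<le> 1 / 16" "(e\<^sup>2)\<^sup>2 * (real T * real dx + 34 * (real dx)\<^sup>2) \<le> 1 / 8"
    and T: "T = Suc n" and \<beta>: "\<forall>p\<in>{..<dx} \<times> {..<du}. \<bar>\<beta> p\<bar> \<le> e"
    and R: "expected_regret (1\<^sub>m dx) (1\<^sub>m du) (1\<^sub>m dx) alg T (half_id dx) (Bm \<beta>) \<le> ereal R"
  shows "0 \<le> R + 16 / 9 * real dx - 5 / 18 * real T * (\<Sum>j<du. \<Sum>i<dx. (\<beta> (i, j))\<^sup>2)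
      - (\<Sum>t<n. discount_weight (n - t) * (\<Sum>i<dx. \<Sum>j<du. \<integral>h. stein_term du e t i j \<beta> h \<partial>P (Bm \<beta>) (Suc t)))"
    and "i < dx \<Longrightarrow> j < du \<Longrightarrow> k < T \<Longrightarrow> e \<le> 1 \<Longrightarrow> integrable (P (Bm \<beta>) (Suc k)) (stein_term du e k i j \<beta>) \<and>
      (\<integral>h. \<bar>stein_term du e k i j \<beta> h\<bar> \<partial>P (Bm \<beta>) (Suc k)) \<le> 4 + 15 * (R + real T * (4 / 3 * real dx))"
proof -
  have B: "Bm \<beta> \<in> carrier_mat dx du" by simp
  let ?S = "\<Sum>j<du. \<Sum>i<dx. (\<beta> (i, j))\<^sup>2"
  have S_eq: "(\<Sum>j<du. \<Sum>i<dx. (Bm \<beta> $$ (i, j))\<^sup>2) = ?S" by (intro sum.cong refl) auto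
  have S0: "0 \<le> ?S" by (intro sum_nonneg) simp
  have be: "(\<beta> (i, j))\<^sup>2 \<le> e\<^sup>2" if "i < dx" "j < du" for i j
    using \<beta> that e by (simp add: abs_le_square_iff[symmetric])
  have "?S \<le> (\<Sum>j<du. \<Sum>i<dx. e\<^sup>2)" by (intro sum_mono be) auto
  then have S_small: "?S \<le> 1 / 16" using small(1) by (simp add: mult_ac)
  note cost = total_cost_le_of_regret[OF B _ R, unfolded S_eq, OF S_small]
  define M where "M = P (Bm \<beta>) T"
  interpret prob_space M unfolding M_def by (rule prob_space_trajectory[OF B])
  have sM: "sets M = sets (H T T)" "space M = space (H T T)"
    unfolding M_def by (simp_all only: sets_trajectory[OF B] space_trajectory[OF B])
  let ?C = "\<lambda>h. \<Sum>t<T. (\<Sum>i<dx. (xs t i h)\<^sup>2) + (\<Sum>j<du. (us t j h)\<^sup>2)"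
  have "integrable M ?C = integrable M (cost T)" "(\<integral>h. ?C h \<partial>M) = (\<integral>h. cost T h \<partial>M)"
    by (rule Bochner_Integration.integrable_cong Bochner_Integration.integral_cong; simp add: sM total_cost_eq)+
  then have C: "integrable M ?C" "(\<integral>h. ?C h \<partial>M) \<le> R + real T * (4 / 3 * real dx - 1 / 3 * ?S)"
    using cost unfolding M_def by auto
  have xC: "(xs t i h)\<^sup>2 \<le> ?C h" if "t < T" "i < dx" for t i h
  proof -
    have "(xs t i h)\<^sup>2 \<le> (\<Sum>i<dx. (xs t i h)\<^sup>2)" using that by (intro member_le_sum) auto
    also have "\<dots> \<le> (\<Sum>i<dx. (xs t i h)\<^sup>2) + (\<Sum>j<du. (us t j h)\<^sup>2)" by (simp add: sum_nonneg)
    also have "\<dots> \<le> ?C h" using that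
      by (intro member_le_sum[where f="\<lambda>t. (\<Sum>i<dx. (xs t i h)\<^sup>2) + (\<Sum>j<du. (us t j h)\<^sup>2)"]) (auto simp: sum_nonneg)
    finally show ?thesis .
  qed
  have uC: "(us t j h)\<^sup>2 \<le> ?C h" if "t < T" "j < du" for t j h
  proof -
    have "(us t j h)\<^sup>2 \<le> (\<Sum>j<du. (us t j h)\<^sup>2)" using that by (intro member_le_sum) auto
    also have "\<dots> \<le> (\<Sum>i<dx. (xs t i h)\<^sup>2) + (\<Sum>j<du. (us t j h)\<^sup>2)" by (simp add: sum_nonneg)
    also have "\<dots> \<le> ?C h" using that
      by (intro member_le_sum[where f="\<lambda>t. (\<Sum>i<dx. (xs t i h)\<^sup>2) + (\<Sum>j<du. (us t j h)\<^sup>2)"]) (auto simp: sum_nonneg)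
    finally show ?thesis .
  qed
  have xsq: "square_integrable (xs t i)" if "t < T" "i < dx" for t i
  proof -
    have m: "xs t i \<in> borel_measurable M" using xs_measurable[OF that] by (simp cong: measurable_cong_sets add: sM)
    then have "integrable M (\<lambda>h. (xs t i h)\<^sup>2)"
      using xC[OF that] by (intro Bochner_Integration.integrable_bound[OF C(1)]) (auto simp: order_trans[OF _ abs_ge_self])
    then show ?thesis using m by (simp add: square_integrable_def)
  qed
  have usq: "square_integrable (us t j)" if "t < T" "j < du" for t j
  proof -
    have m: "us t j \<in> borel_measurable M" using us_measurable[OF that] by (simp cong: measurable_cong_sets add: sM)
    then have "integrable M (\<lambda>h. (us t j h)\<^sup>2)"
      using uC[OF that] by (intro Bochner_Integration.integrable_bound[OF C(1)]) (auto simp: order_trans[OF _ abs_ge_self])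
    then show ?thesis using m by (simp add: square_integrable_def)
  qed
  let ?b = "\<lambda>i j. Bm \<beta> $$ (i, j)"
  interpret lqr_process M adapted dx T "ws du ?b" du xs us ?b
    unfolding M_def by (rule lqr_process_trajectory[OF B]) (use xsq usq in \<open>auto simp: M_def\<close>)
  let ?\<tau> = "\<lambda>i j. (e\<^sup>2 - (\<beta> (i, j))\<^sup>2) / 2"
  \<comment> \<open>\<open>e\<^sup>2\<close> takes the place of \<open>e\<close> in
    \<open>cost_lower_bound\<close>.\<close>
  have \<tau>: "\<bar>?\<tau> i j\<bar> \<le> e\<^sup>2 / 2" if "i < dx" "j < du" for i j
    using be[OF that] by simp
  have gap: "stein_gap ?\<tau> t i j h = stein_term du e t i j \<beta> h" if "i < dx" "j < du" for t i j h
    unfolding stein_gap_def stein_term_def using that by (simp add: ws_Bm)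
  \<comment> \<open>Lowering the horizon to \<open>Suc t\<close> leaves exactly the transitions that
    \<open>log_lik\<close> covers in the Stein identity for time \<open>t\<close>.\<close>
  have past: "integrable M (stein_term du e t i j \<beta>) = integrable (P (Bm \<beta>) (Suc t)) (stein_term du e t i j \<beta>)"
     "(\<integral>h. stein_term du e t i j \<beta> h \<partial>M) = (\<integral>h. stein_term du e t i j \<beta> h \<partial>P (Bm \<beta>) (Suc t))"
     "(\<integral>h. \<bar>stein_term du e t i j \<beta> h\<bar> \<partial>M) = (\<integral>h. \<bar>stein_term du e t i j \<beta> h\<bar> \<partial>P (Bm \<beta>) (Suc t))"
    if "t < T" "i < dx" "j < du" for t i j
    unfolding M_def using that stein_term_measurable[OF that(2,3), of e t \<beta>]
    by (intro integral_past[OF B] borel_measurable_abs; simp add: stein_term_past)+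
  have energy: "(\<Sum>t<T. (\<Sum>i<dx. energy (xs t i)) + (\<Sum>j<du. energy (us t j))) = (\<integral>h. ?C h \<partial>M)"
    by (intro has_bochner_integral_integral_eq[symmetric] has_bochner_integral_sum has_bochner_integral_add
        has_bochner_integral_integrable energy_integrable xsq usq) auto
  have G: "(\<Sum>i<dx. \<Sum>j<du. \<integral>h. stein_gap ?\<tau> t i j h \<partial>M) = (\<Sum>i<dx. \<Sum>j<du. \<integral>h. stein_term du e t i j \<beta> h \<partial>P (Bm \<beta>) (Suc t))"
    if "t < n" for t
    using that T by (intro sum.cong refl) (simp add: gap past)
  have "(4 / 3 * real T - 16 / 9) * real dx - real T / 18 * (\<Sum>j<du. \<Sum>i<dx. (?b i j)\<^sup>2)
       + (\<Sum>t<n. discount_weight (n - t) * (\<Sum>i<dx. \<Sum>j<du. \<integral>h. stein_gap ?\<tau> t i j h \<partial>M))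
     \<le> (\<Sum>t<T. (\<Sum>i<dx. energy (xs t i)) + (\<Sum>j<du. energy (us t j)))"
    by (rule cost_lower_bound[OF \<tau> small(2) T])
  then have "(4 / 3 * real T - 16 / 9) * real dx - real T / 18 * ?S
       + (\<Sum>t<n. discount_weight (n - t) * (\<Sum>i<dx. \<Sum>j<du. \<integral>h. stein_term du e t i j \<beta> h \<partial>P (Bm \<beta>) (Suc t)))
     \<le> R + real T * (4 / 3 * real dx - 1 / 3 * ?S)"
    using C(2) unfolding energy S_eq by (simp add: G)
  then show "0 \<le> R + 16 / 9 * real dx - 5 / 18 * real T * ?S
      - (\<Sum>t<n. discount_weight (n - t) * (\<Sum>i<dx. \<Sum>j<du. \<integral>h. stein_term du e t i j \<beta> h \<partial>P (Bm \<beta>) (Suc t)))"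
    by (simp add: algebra_simps)
  assume k: "i < dx" "j < du" "k < T" and e1: "e \<le> 1"
  have b1: "\<bar>?b i j\<bar> \<le> 1" using k \<beta> e1 by force
  have e21: "e\<^sup>2 \<le> 1" using e e1 by (simp add: power_le_one)
  have t1: "\<bar>?\<tau> i j\<bar> \<le> 1" using \<tau>[OF k(1,2)] e21 by linarith
  have st: "?b i j * trunc_noise (\<lambda>q. ws du ?b q i h) k * us k j h
      - ?\<tau> i j * stein_factor (\<lambda>q. ws du ?b q i h) (\<lambda>q. us q j h) k * us k j h = stein_term du e k i j \<beta> h" for h
    unfolding stein_term_def using k by (simp add: ws_Bm)
  have U: "(\<Sum>q<T. energy (us q j)) \<le> R + real T * (4 / 3 * real dx)"
  proof -
    have "(\<Sum>q<T. energy (us q j)) \<le> (\<Sum>t<T. (\<Sum>i<dx. energy (xs t i)) + (\<Sum>j<du. energy (us t j)))"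
    proof (rule sum_mono)
      fix t
      have "energy (us t j) \<le> (\<Sum>j<du. energy (us t j))" using k by (intro member_le_sum) auto
      moreover have "0 \<le> (\<Sum>i<dx. energy (xs t i))" by (intro sum_nonneg) simp
      ultimately show "energy (us t j) \<le> (\<Sum>i<dx. energy (xs t i)) + (\<Sum>j<du. energy (us t j))" by simp
    qed
    also have "\<dots> \<le> R + real T * (4 / 3 * real dx - 1 / 3 * ?S)" unfolding energy by (rule C(2))
    also have "\<dots> \<le> R + real T * (4 / 3 * real dx)" using S0 by (intro add_left_mono mult_left_mono) auto
    finally show ?thesis .
  qed
  note sb = stein_gap_bound[OF k(3,1,2) b1 t1, unfolded st]
  have "(\<integral>h. \<bar>stein_term du e k i j \<beta> h\<bar> \<partial>M) \<le> 4 + 15 * (\<Sum>q<T. energy (us q j))"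
    by (rule sb(2))
  then show "integrable (P (Bm \<beta>) (Suc k)) (stein_term du e k i j \<beta>) \<and>
      (\<integral>h. \<bar>stein_term du e k i j \<beta> h\<bar> \<partial>P (Bm \<beta>) (Suc k)) \<le> 4 + 15 * (R + real T * (4 / 3 * real dx))"
    using sb(1) U past[OF k(3,1,2)] by auto
qed

text \<open>A bound valid on the whole box survives averaging. The average removes the Stein gap,
  and each squared entry has mean \<open>e\<^sup>2 / 3\<close>, so 5/18 becomes 5/54.\<close>

theorem regret_lower_bound:
  assumes e: "0 < e" "e \<le> 1"
    and small: "real dx * real du * e\<^sup>2 \<le> 1 / 16" "(e\<^sup>2)\<^sup>2 * (real T * real dx + 34 * (real dx)\<^sup>2) \<le> 1 / 8"
    and T: "0 < T"
    and R: "\<And>\<beta>. \<forall>p\<in>{..<dx} \<times> {..<du}. \<bar>\<beta> p\<bar> \<le> e \<Longrightarrow>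
      expected_regret (1\<^sub>m dx) (1\<^sub>m du) (1\<^sub>m dx) alg T (half_id dx) (Bm \<beta>) \<le> ereal R"
  shows "5 / 54 * (real T * real dx * real du * e\<^sup>2) - 16 / 9 * real dx \<le> R"
proof -
  obtain n where n: "T = Suc n" using T by (cases T) auto
  note inst = box_instance[OF e(1) small n _ R]
  let ?g = "\<lambda>t i j \<beta>. \<integral>h. stein_term du e t i j \<beta> h \<partial>P (Bm \<beta>) (Suc t)"
  let ?F = "\<lambda>\<beta>. R + 16 / 9 * real dx - 5 / 18 * real T * (\<Sum>j<du. \<Sum>i<dx. (\<beta> (i, j))\<^sup>2)
      - (\<Sum>t<n. discount_weight (n - t) * (\<Sum>i<dx. \<Sum>j<du. ?g t i j \<beta>))"
  interpret \<Pi>: prob_space "box_law dx du e" by (rule prob_space_box_law[OF e(1)])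
  have c: "has_bochner_integral (box_law dx du e) (\<lambda>_. r) r" for r :: real
    by (simp add: has_bochner_integral_iff \<Pi>.prob_space)
  have g: "has_bochner_integral (box_law dx du e) (?g t i j) 0" if "t < n" "i < dx" "j < du" for t i j
    by (rule stein_term_mean_zero[OF that(2,3) e(1) inst(2)[OF _ _ that(2,3) _ e(2)]]) (use that n in auto)
  have "has_bochner_integral (box_law dx du e) ?F
     (R + 16 / 9 * real dx - 5 / 18 * real T * (\<Sum>j<du. \<Sum>i<dx. e\<^sup>2 / 3)
      - (\<Sum>t<n. discount_weight (n - t) * (\<Sum>i<dx. \<Sum>j<du. 0)))"
    by (intro has_bochner_integral_diff has_bochner_integral_mult_right has_bochner_integral_sum c box_law_square g e(1)) auto
  then have eq: "(\<integral>\<beta>. ?F \<beta> \<partial>box_law dx du e) = R + 16 / 9 * real dx - 5 / 54 * (real T * real dx * real du * e\<^sup>2)"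
    by (subst has_bochner_integral_integral_eq) (auto simp: algebra_simps)
  have "AE \<beta> in box_law dx du e. 0 \<le> ?F \<beta>"
    using AE_box_law[OF e(1)] by eventually_elim (rule inst(1))
  then have "0 \<le> (\<integral>\<beta>. ?F \<beta> \<partial>box_law dx du e)"
    by (rule integral_nonneg_AE)
  then show ?thesis unfolding eq by simp
qed

end

section \<open>Choice of the covariance and of the box\<close>

lemma op_norm_one:
  assumes "0 < n"
  shows "op_norm (1\<^sub>m n) = 1"
proof -
  let ?S = "{vec_norm (1\<^sub>m n *\<^sub>v v) | v. v \<in> carrier_vec (dim_col (1\<^sub>m n :: rmat)) \<and> vec_norm v \<le> 1}"
  have "vec_norm (1\<^sub>m n *\<^sub>v unit_vec n 0) = 1" "vec_norm (unit_vec n 0) \<le> 1"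
    using assms by (auto simp: vec_norm_def)
  then have "1 \<in> ?S" by (force intro!: exI[of _ "unit_vec n 0"])
  moreover have "y \<le> 1" if "y \<in> ?S" for y using that by auto
  ultimately show ?thesis unfolding op_norm_def by (rule cSup_eq_maximum)
qed

lemma trace_one: "trace_mat (1\<^sub>m n) = real n"
  by (simp add: trace_mat_def)

lemma half_id_in_instance_class:
  assumes B: "B \<in> carrier_mat dx du" and le: "(\<Sum>i<dx. \<Sum>j<du. (B $$ (i, j))\<^sup>2) \<le> 1 / 16"
  shows "(half_id dx, B) \<in> instance_class dx du"
proof -
  have "hs_norm B = sqrt (\<Sum>i<dx. \<Sum>j<du. (B $$ (i, j))\<^sup>2)" using B by (simp add: hs_norm_def)
  also have "\<dots> \<le> sqrt ((1 / 4)\<^sup>2)" by (intro real_sqrt_le_mono) (use le in \<open>simp add: power2_eq_square\<close>)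
  finally have "hs_norm B \<le> 1 / 4" by simp
  moreover have "hs_norm (half_id dx - (1 / 2) \<cdot>\<^sub>m 1\<^sub>m dx) = 0"
    by (simp add: hs_norm_def half_id_def)
  ultimately show ?thesis using B by (simp add: instance_class_def)
qed

text \<open>\<open>\<epsilon>\<close> is the square of the half-width of the box. Its first bound
  controls the gain over \<open>T\<close> steps; the second keeps the matrix in the class and, as
  \<open>du\<close> is at least 1, also absorbs the term
  \<open>34 * (real dx)\<^sup>2\<close>.\<close>

lemma minimax_regret_lower_bound:
  fixes dx du T :: nat and W \<epsilon> :: real
  assumes dx: "0 < dx" and du: "0 < du" and T: "0 < T"
    and W: "W < 5 / 54 * (real T * (real dx * (real du * \<epsilon>))) - 16 / 9 * real dx"
    and \<epsilon>: "\<epsilon> = min (1 / (4 * sqrt (real dx * real T))) (1 / (64 * (real dx * real du)))"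
  shows "minimax_regret (1\<^sub>m dx) (1\<^sub>m du) (1\<^sub>m dx) dx du T \<ge> ereal W"
  unfolding minimax_regret_def
proof (rule INF_greatest)
  fix alg assume alg: "alg \<in> algorithms dx du"
  interpret half_system dx du alg by unfold_locales (use alg in auto)
  have pos: "0 < real dx" "1 \<le> real dx" "0 < real du" "1 \<le> real du" "0 < real T" using dx du T by auto
  have e0: "0 < \<epsilon>" unfolding \<epsilon> using pos by simp
  have e_le: "\<epsilon> \<le> 1 / (4 * sqrt (real dx * real T))" "\<epsilon> \<le> 1 / (64 * (real dx * real du))" unfolding \<epsilon> by auto
  have dd: "1 \<le> real dx * real du" using mult_mono[of 1 "real dx" 1 "real du"] pos by simp
  have small1: "real dx * real du * \<epsilon> \<le> 1 / 64"
    using e_le(2) pos by (simp add: field_simps)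
  have "\<epsilon> * real dx \<le> \<epsilon> * (real dx * real du)" using e0 pos by (intro mult_left_mono) auto
  then have edx: "\<epsilon> * real dx \<le> 1 / 64" using small1 by (simp add: mult_ac)
  have e1: "\<epsilon> \<le> 1"
    using small1 mult_right_mono[OF dd, of \<epsilon>] e0 by linarith
  have "\<epsilon>\<^sup>2 \<le> (1 / (4 * sqrt (real dx * real T)))\<^sup>2" using e_le(1) e0 by (intro power_mono) auto
  also have "\<dots> = 1 / (16 * (real dx * real T))" using pos by (simp add: power_divide power_mult_distrib)
  finally have "\<epsilon>\<^sup>2 * (real T * real dx) \<le> 1 / 16" using pos by (simp add: field_simps)
  moreover have "\<epsilon>\<^sup>2 * (34 * (real dx)\<^sup>2) \<le> 1 / 16"
  proof -
    have "(\<epsilon> * real dx)\<^sup>2 \<le> (1 / 64)\<^sup>2" using edx e0 by (intro power_mono) auto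
    then show ?thesis by (simp add: power_mult_distrib power_divide)
  qed
  ultimately have small2: "\<epsilon>\<^sup>2 * (real T * real dx + 34 * (real dx)\<^sup>2) \<le> 1 / 8"
    by (simp add: ring_distribs)
  show "ereal W \<le> (SUP (A, B)\<in>instance_class dx du. expected_regret (1\<^sub>m dx) (1\<^sub>m du) (1\<^sub>m dx) alg T A B)" (is "_ \<le> ?S")
  proof (rule ccontr)
    \<comment> \<open>Failure of the bound makes the regret at most the finite number
      \<open>W\<close> on every instance, as \<open>regret_lower_bound\<close> requires.\<close>
    assume "\<not> ereal W \<le> ?S"
    then have SW: "?S \<le> ereal W" by simp
    have "5 / 54 * (real T * real dx * real du * (sqrt \<epsilon>)\<^sup>2) - 16 / 9 * real dx \<le> W"
    proof (rule regret_lower_bound)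
      show "0 < sqrt \<epsilon>" "sqrt \<epsilon> \<le> 1" using e0 e1 by auto
      show "real dx * real du * (sqrt \<epsilon>)\<^sup>2 \<le> 1 / 16" "((sqrt \<epsilon>)\<^sup>2)\<^sup>2 * (real T * real dx + 34 * (real dx)\<^sup>2) \<le> 1 / 8"
        using small1 small2 e0 by auto
      show "0 < T" by fact
      fix \<beta> :: "nat \<times> nat \<Rightarrow> real" assume \<beta>: "\<forall>p\<in>{..<dx} \<times> {..<du}. \<bar>\<beta> p\<bar> \<le> sqrt \<epsilon>"
      have "(\<Sum>i<dx. \<Sum>j<du. (Bm \<beta> $$ (i, j))\<^sup>2) \<le> (\<Sum>i<dx. \<Sum>j<du. \<epsilon>)"
      proof (intro sum_mono)
        fix i j assume "i \<in> {..<dx}" "j \<in> {..<du}"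
        then show "(Bm \<beta> $$ (i, j))\<^sup>2 \<le> \<epsilon>"
          using power_mono[OF \<beta>[rule_format, of "(i, j)"] abs_ge_zero, of 2] e0 by simp
      qed
      also have "\<dots> \<le> 1 / 16" using small1 by (simp add: mult_ac)
      finally have "(half_id dx, Bm \<beta>) \<in> instance_class dx du"
        by (intro half_id_in_instance_class) auto
      then have "expected_regret (1\<^sub>m dx) (1\<^sub>m du) (1\<^sub>m dx) alg T (half_id dx) (Bm \<beta>) \<le> ?S"
        by (rule SUP_upper2) simp
      then show "expected_regret (1\<^sub>m dx) (1\<^sub>m du) (1\<^sub>m dx) alg T (half_id dx) (Bm \<beta>) \<le> ereal W"
        using SW by (rule order_trans)
    qed
    then show False using W e0 by (simp add: mult_ac)
  qed
qed

theorem theorem1p1: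
  "\<exists>c>0. \<exists>c'>0. \<forall>\<gamma>::real. \<gamma> \<ge> 1 \<longrightarrow>
     (let dx = nat \<lfloor>\<gamma>\<rfloor> in
      \<exists>S. psd_mat dx S \<and> op_norm S = 1 \<and> trace_mat S \<le> \<gamma> \<and>
        (\<forall>du::nat. real du \<ge> sqrt (ln (1 + \<gamma>)) \<longrightarrow>
          (\<forall>T::nat. real T \<ge> c' * \<gamma> * ln (1 + \<gamma>) \<longrightarrow>
            (real T \<le> \<gamma> * (real du)\<^sup>2 \<longrightarrow>
               minimax_regret (1\<^sub>m dx) (1\<^sub>m du) S dx du T \<ge> ereal (c * real T)) \<and>
            (real T \<ge> \<gamma> * (real du)\<^sup>2 \<longrightarrow>
               minimax_regret (1\<^sub>m dx) (1\<^sub>m du) S dx du T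
                 \<ge> ereal (c * sqrt (\<gamma> * (real du)\<^sup>2 * real T))))))"
proof (rule exI[of _ "1 / 5000"], rule conjI, simp, rule exI[of _ "10 ^ 8"], rule conjI, simp, intro allI impI)
  fix \<gamma> :: real assume \<gamma>: "1 \<le> \<gamma>"
  define dx where "dx = nat \<lfloor>\<gamma>\<rfloor>"
  have dx1: "1 \<le> real dx" "real dx \<le> \<gamma>" "\<gamma> \<le> 2 * real dx"
  proof -
    have "1 \<le> \<lfloor>\<gamma>\<rfloor>" using \<gamma> by (simp add: le_floor_iff)
    then have "real dx = real_of_int \<lfloor>\<gamma>\<rfloor>" "1 \<le> real_of_int \<lfloor>\<gamma>\<rfloor>" unfolding dx_def by simp_all
    then show "1 \<le> real dx" "real dx \<le> \<gamma>" "\<gamma> \<le> 2 * real dx"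
      using floor_correct[of \<gamma>] by linarith+
  qed
  then have dx0: "0 < dx" by simp
  \<comment> \<open>\<open>W\<close> stands for the rate of either regime, at most the other rate in
    its range of \<open>T\<close>. Since \<open>\<gamma>\<close> is at most \<open>W / 5000\<close>,
    the leading term \<open>5 / 54 * (W / 64)\<close> exceeds the startup loss
    \<open>16 / 9 * real dx\<close> by more than \<open>W / 5000\<close>.\<close>
  have key: "ereal (1 / 5000 * W) \<le> minimax_regret (1\<^sub>m dx) (1\<^sub>m du) (1\<^sub>m dx) dx du T"
    if du: "real du \<ge> sqrt (ln (1 + \<gamma>))" and T: "real T \<ge> 10 ^ 8 * \<gamma> * ln (1 + \<gamma>)"
      and W: "W \<le> T" "W \<le> sqrt (\<gamma> * (real du)\<^sup>2 * T)" "5000 * \<gamma> \<le> W" for du T :: nat and W :: real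
  proof (rule minimax_regret_lower_bound[OF dx0, where \<epsilon>="min (1 / (4 * sqrt (real dx * real T))) (1 / (64 * (real dx * real du)))"])
    have W0: "0 < W" using W(3) \<gamma> by linarith
    have "0 < ln (1 + \<gamma>)" using \<gamma> by simp
    then show du0: "0 < du" using du by (metis less_le_trans of_nat_0_less_iff real_sqrt_gt_zero)
    show T0: "0 < T" using W(1) W0 by simp
    let ?e = "min (1 / (4 * sqrt (real dx * real T))) (1 / (64 * (real dx * real du)))"
    let ?m = "real T * (real dx * (real du * ?e))"
    have pos: "0 < real dx" "0 < real du" "0 < real T" using dx0 du0 T0 by auto
    have "W / 64 \<le> real T * (real dx * (real du * (1 / (64 * (real dx * real du)))))"
      using W(1) pos by simp
    moreover have "W / 64 \<le> real T * (real dx * (real du * (1 / (4 * sqrt (real dx * real T)))))"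
    proof -
      let ?r = "sqrt (real dx * real T)"
      have r: "0 < ?r" "?r * ?r = real dx * real T" using pos by auto
      \<comment> \<open>The bound \<open>\<gamma> \<le> 2 * real dx\<close> is relaxed to the factor
        4, whose root is exact.\<close>
      have "sqrt (\<gamma> * (real du)\<^sup>2 * T) \<le> sqrt (4 * ((real du)\<^sup>2 * (real dx * real T)))"
      proof (intro real_sqrt_le_mono)
        have "\<gamma> * ((real du)\<^sup>2 * real T) \<le> 4 * real dx * ((real du)\<^sup>2 * real T)"
          using dx1 by (intro mult_right_mono) auto
        then show "\<gamma> * (real du)\<^sup>2 * T \<le> 4 * ((real du)\<^sup>2 * (real dx * real T))" by (simp add: mult_ac)
      qed
      also have "\<dots> = 2 * (real du * ?r)" by (simp add: real_sqrt_mult)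
      finally have "W \<le> 2 * (real du * ?r)" using W(2) by linarith
      moreover have "real T * (real dx * (real du * (1 / (4 * ?r)))) = real du * ?r / 4"
      proof -
        have "real T * (real dx * (real du * (1 / (4 * ?r)))) = real du * (?r * ?r) / (4 * ?r)"
          unfolding r(2) by (simp add: mult_ac)
        also have "\<dots> = real du * ?r / 4"
        proof -
          have "d * (s * s) / (4 * s) = d * s / 4" if "0 < s" for d s :: real using that by simp
          from this[OF r(1)] show ?thesis .
        qed
        finally show ?thesis .
      qed
      moreover have "0 \<le> real du * ?r" using pos by simp
      ultimately show ?thesis using W0 by linarith
    qed
    ultimately have m: "W / 64 \<le> ?m" by (simp add: min_def)
    show "1 / 5000 * W < 5 / 54 * ?m - 16 / 9 * real dx"
      using m W0 W(3) dx1 by linarith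
  qed simp
  have ln2: "1 / 2 \<le> ln (1 + \<gamma>)"
  proof -
    have "ln (1 / 2 :: real) \<le> 1 / 2 - 1" by (rule ln_le_minus_one) simp
    then have "1 / 2 \<le> ln (2 :: real)" by (simp add: ln_div)
    also have "\<dots> \<le> ln (1 + \<gamma>)" using \<gamma> by simp
    finally show ?thesis .
  qed
  have lo: "5000 * \<gamma> \<le> T" if "real T \<ge> 10 ^ 8 * \<gamma> * ln (1 + \<gamma>)" for T :: nat
  proof -
    have "10 ^ 8 * \<gamma> * (1 / 2) \<le> 10 ^ 8 * \<gamma> * ln (1 + \<gamma>)" using ln2 \<gamma> by (intro mult_left_mono) auto
    then have "10 ^ 8 * \<gamma> * (1 / 2) \<le> real T" using that by (rule order_trans)
    then show ?thesis using \<gamma> by simp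
  qed
  show "let dx = nat \<lfloor>\<gamma>\<rfloor> in
      \<exists>S. psd_mat dx S \<and> op_norm S = 1 \<and> trace_mat S \<le> \<gamma> \<and>
        (\<forall>du::nat. real du \<ge> sqrt (ln (1 + \<gamma>)) \<longrightarrow>
          (\<forall>T::nat. real T \<ge> 10 ^ 8 * \<gamma> * ln (1 + \<gamma>) \<longrightarrow>
            (real T \<le> \<gamma> * (real du)\<^sup>2 \<longrightarrow>
               minimax_regret (1\<^sub>m dx) (1\<^sub>m du) S dx du T \<ge> ereal (1 / 5000 * real T)) \<and>
            (real T \<ge> \<gamma> * (real du)\<^sup>2 \<longrightarrow>
               minimax_regret (1\<^sub>m dx) (1\<^sub>m du) S dx du T
                 \<ge> ereal (1 / 5000 * sqrt (\<gamma> * (real du)\<^sup>2 * real T)))))"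
    unfolding Let_def dx_def[symmetric]
  proof (intro exI[of _ "1\<^sub>m dx"] conjI allI impI)
    show "psd_mat dx (1\<^sub>m dx)" by (rule psd_mat_one)
    show "op_norm (1\<^sub>m dx) = 1" by (rule op_norm_one[OF dx0])
    show "trace_mat (1\<^sub>m dx) \<le> \<gamma>" using dx1 by (simp add: trace_one)
    fix du T :: nat
    assume du: "real du \<ge> sqrt (ln (1 + \<gamma>))" and T: "real T \<ge> 10 ^ 8 * \<gamma> * ln (1 + \<gamma>)"
    have du2: "ln (1 + \<gamma>) \<le> (real du)\<^sup>2"
      using du ln2 by (intro sqrt_le_D) auto
    show "ereal (1 / 5000 * real T) \<le> minimax_regret (1\<^sub>m dx) (1\<^sub>m du) (1\<^sub>m dx) dx du T"
      if "real T \<le> \<gamma> * (real du)\<^sup>2"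
    proof (rule key[OF du T order_refl _ lo[OF T]])
      have "(real T)\<^sup>2 \<le> \<gamma> * (real du)\<^sup>2 * real T"
        unfolding power2_eq_square[of "real T"] using that by (intro mult_right_mono) auto
      then show "real T \<le> sqrt (\<gamma> * (real du)\<^sup>2 * T)" by (rule real_le_rsqrt)
    qed
    show "ereal (1 / 5000 * sqrt (\<gamma> * (real du)\<^sup>2 * real T)) \<le> minimax_regret (1\<^sub>m dx) (1\<^sub>m du) (1\<^sub>m dx) dx du T"
      if "real T \<ge> \<gamma> * (real du)\<^sup>2"
    proof (rule key[OF du T _ order_refl])
      have "\<gamma> * (real du)\<^sup>2 * real T \<le> (real T)\<^sup>2"
        unfolding power2_eq_square[of "real T"] using that by (intro mult_right_mono) auto
      then show "sqrt (\<gamma> * (real du)\<^sup>2 * real T) \<le> real T" by (intro real_le_lsqrt) auto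
      \<comment> \<open>This fixes \<open>10 ^ 8\<close>: the two halves bound
        \<open>ln (1 + \<gamma>)\<close> from below, once through \<open>du\<close> and once through
        \<open>T\<close>, and \<open>10 ^ 8 / 4\<close> is the square of 5000.\<close>
      have "(5000 * \<gamma>)\<^sup>2 \<le> \<gamma> * (1 / 2) * (10 ^ 8 * \<gamma> * (1 / 2))"
        by (simp add: power2_eq_square)
      also have "\<dots> \<le> \<gamma> * (real du)\<^sup>2 * (10 ^ 8 * \<gamma> * ln (1 + \<gamma>))"
        using \<gamma> ln2 du2 by (intro mult_mono) auto
      also have "\<dots> \<le> \<gamma> * (real du)\<^sup>2 * real T" using T \<gamma> by (intro mult_left_mono) auto
      finally show "5000 * \<gamma> \<le> sqrt (\<gamma> * (real du)\<^sup>2 * real T)" by (rule real_le_rsqrt)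
    qed
  qed
qed

end
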